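(* For every prime $p < 2000$, the set $\mathcal{L}_p$ has a least element $\min \mathcal{L}_p$, this least element is an isolated point of $\mathcal{L}_p$, and $\min \mathcal{L}_p$ is the irrational square root of a rational number.
   Context: For a positive integer $n$ and an irrational real $\xi$, define the $n$-Lagrange approximability $\lambda_n(\xi) = \limsup_{s/t \to \xi} \dfrac{\gcd(t,n)}{t^2 \left| \frac{s}{t} - \xi\right|} \in \mathbb{R}\cup\{\infty\}$, where the limsup is over rationals $s/t$ ($s,t\in\mathbb{Z}$, $t>0$) tending to $\xi$. The $n$-Lagrange spectrum is $\mathcal{L}_n = \{\lambda_n(\xi) \in \mathbb{R} : \xi \in \mathbb{R}\setminus\mathbb{Q}\}$ (the set of finite values). *)

theory Defs
  imports "HOL-Analysis.Analysis"
begin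

definition rat_approach :: "real \<Rightarrow> (int \<times> int) filter" where
  "rat_approach xi =
     inf (filtercomap (\<lambda>(s, t). real_of_int s / real_of_int t) (at xi))
         (principal {(s, t). t > 0})"

definition lagrange_approx :: "nat \<Rightarrow> real \<Rightarrow> ereal" where
  "lagrange_approx n xi =
     Limsup (rat_approach xi)
       (\<lambda>(s, t). ereal (real_of_int (gcd t (int n)) /
          ((real_of_int t)\<^sup>2 * \<bar>real_of_int s / real_of_int t - xi\<bar>)))"

definition lagrange_spectrum :: "nat \<Rightarrow> real set" where
  "lagrange_spectrum n = {x. \<exists>xi. xi \<notin> \<rat> \<and> lagrange_approx n xi = ereal x}"

end

theory Submission
  imports Defs
begin

text \<open>For a prime \<open>p\<close> one has \<open>\<lambda>\<^sub>p(\<xi>) = max (\<lambda>\<^sub>1(\<xi>)) (\<lambda>\<^sub>1(p \<xi>))\<close>. It therefore suffices to find a bound \<open>K\<close> such that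
  \<open>\<L>\<^sub>p\<close> has an element below \<open>K\<close> but only finitely many, all of them square roots of rationals.

  A value \<open>\<lambda>\<^sub>1(\<xi>) < K\<close> forbids certain words in the Stern--Brocot expansion of \<open>\<xi>\<close>, and the expansion of \<open>p \<xi>\<close> is
  obtained from that of \<open>\<xi>\<close> by a transducer whose states are integer matrices of determinant \<open>p\<close>. Every expansion
  passes infinitely often through doubly balanced matrices. A depth-first search from each of these, restricted to the
  allowed words on both sides, ends in a dead branch, at a smaller doubly balanced matrix, or on an isolated closed orbit;
  in the last case \<open>\<xi>\<close> is a quadratic irrational, for which \<open>\<lambda>\<^sub>1\<close> and \<open>\<lambda>\<^sub>p\<close> are square roots of rationals.

  Elements below \<open>K\<close> come from indefinite binary quadratic forms, whose minima are read off their rivers. If 5 or 8 is a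
  square modulo \<open>4 p\<close>, the value \<open>\<surd>5\<close> or \<open>\<surd>8\<close> bounds the minimum and the search for \<open>p = 1\<close>, \<open>K = 2.997\<close> suffices; the
  same search covers 38 further primes, and 41 primes have a search of their own.\<close>

section \<open>Approximation by rationals\<close>

text \<open>Below 3 the values of \<open>lam\<close> are those of Markov, beginning with sqrt 5,
  sqrt 8, sqrt 221 / 5, sqrt 1517 / 13 = 2.9960... and sqrt 7565 / 29 = 2.9992..., and they
  accumulate at 3. The bound 2.997 separates the fourth from the fifth. For the 41 primes searched
  individually the bounds exceed 3, and infinitely many values of \<open>lam\<close> lie below them.
  There it is the coupling that helps: forbidden words must be avoided by the expansions of xi and
  of p xi at the same time, and only finitely many pairs of values survive this. The surviving
  expansions never die in a search, so each must be known beforehand as a closed orbit; a finite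
  search can then confirm that every deviation from it ends. The automata, orbits and forms are data
  that the proof only checks: an automaton may accept too much, and a pair of forms only has to stay
  below the bound, for the least element is then one of finitely many candidates and its exact
  position is never computed.\<close>

lemma eventually_rat_approach:
  "eventually P (rat_approach x) \<longleftrightarrow>
     (\<exists>e>0. \<forall>s t. t > 0 \<longrightarrow> real_of_int s / real_of_int t \<noteq> x \<longrightarrow>
        \<bar>real_of_int s / real_of_int t - x\<bar> < e \<longrightarrow> P (s, t))" (is "_ = ?R")
proof
  assume "eventually P (rat_approach x)"
  then obtain Q where Q: "eventually Q (at x)"
    "\<And>s t. t > 0 \<Longrightarrow> Q (real_of_int s / real_of_int t) \<Longrightarrow> P (s, t)"
    unfolding rat_approach_def eventually_inf_principal eventually_filtercomap by fastforce
  then obtain e where "e > 0" "\<And>y. y \<noteq> x \<Longrightarrow> dist y x < e \<Longrightarrow> Q y"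
    unfolding eventually_at by auto
  with Q(2) show ?R
    by (intro exI[of _ e]) (auto simp: dist_real_def)
next
  assume ?R
  then obtain e where e: "e > 0"
    "\<And>s t. t > 0 \<Longrightarrow> real_of_int s / real_of_int t \<noteq> x \<Longrightarrow>
        \<bar>real_of_int s / real_of_int t - x\<bar> < e \<Longrightarrow> P (s, t)" by blast
  have "eventually (\<lambda>y. y \<noteq> x \<and> \<bar>y - x\<bar> < e) (at x)"
    unfolding eventually_at using e(1) by (auto simp: dist_real_def)
  then show "eventually P (rat_approach x)"
    unfolding rat_approach_def eventually_inf_principal eventually_filtercomap
    using e(2) by (intro exI[of _ "\<lambda>y. y \<noteq> x \<and> \<bar>y - x\<bar> < e"]) auto
qed

definition apx :: "real \<Rightarrow> int \<Rightarrow> int \<Rightarrow> real" where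
  "apx x s t = 1 / ((real_of_int t)\<^sup>2 * \<bar>real_of_int s / real_of_int t - x\<bar>)"

abbreviation lam :: "real \<Rightarrow> ereal" where "lam \<equiv> lagrange_approx 1"

lemma lam_alt: "lam x = Limsup (rat_approach x) (\<lambda>(s, t). ereal (apx x s t))"
  unfolding lagrange_approx_def apx_def by simp

lemma lam_lessD:
  assumes "lam x < ereal c"
  shows "\<exists>e>0. \<forall>s t. t > 0 \<longrightarrow> real_of_int s / real_of_int t \<noteq> x \<longrightarrow>
        \<bar>real_of_int s / real_of_int t - x\<bar> < e \<longrightarrow> apx x s t < c"
  using Limsup_lessD[OF assms[unfolded lam_alt]]
  unfolding eventually_rat_approach by simp

lemma lam_leI:
  assumes "e > 0" "\<And>s t. t > 0 \<Longrightarrow> real_of_int s / real_of_int t \<noteq> x \<Longrightarrow>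
        \<bar>real_of_int s / real_of_int t - x\<bar> < e \<Longrightarrow> apx x s t \<le> c"
  shows "lam x \<le> ereal c"
  unfolding lam_alt
  by (rule Limsup_bounded) (use assms in \<open>auto simp: eventually_rat_approach\<close>)

text \<open>The gap between \<open>c\<close> and \<open>d\<close> absorbs errors that vanish only in
  the limit, such as the factor tending to 1 in \<open>lam_moebius_le\<close>.\<close>

lemma ereal_le_by_reals:
  fixes u v :: ereal
  assumes "\<And>c d. v < ereal c \<Longrightarrow> c < d \<Longrightarrow> u \<le> ereal d"
  shows "u \<le> v"
proof (rule dense_ge)
  fix w assume "v < w"
  then obtain c where c: "v < ereal c" "ereal c < w"
    by (metis ereal_dense3 less_ereal.simps(4) ereal_dense2)
  then obtain d where d: "ereal c < ereal d" "ereal d < w" by (meson ereal_dense2)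
  have "u \<le> ereal d" using assms[OF c(1)] d(1) by simp
  also have "ereal d \<le> w" using d(2) by (rule less_imp_le)
  finally show "u \<le> w" .
qed

text \<open>A denominator prime to p has weight 1 and contributes to \<open>lam x\<close>. For t = p
  u the weight p turns the quality of s / (p u) as an approximation to x into exactly that of s / u
  as an approximation to p x (\<open>scale\<close>), so these denominators contribute the second
  value.\<close>

lemma lagrange_approx_prime:
  assumes "prime p"
  shows "lagrange_approx p x = max (lam x) (lam (real p * x))"
proof -
  have p0: "p > 0" using assms prime_gt_0_nat by blast
  let ?g = "\<lambda>(s, t). ereal (real_of_int (gcd t (int p)) * apx x s t)"
  have L: "lagrange_approx p x = Limsup (rat_approach x) ?g"
    unfolding lagrange_approx_def apx_def by simp
  have apx0: "apx z s t \<ge> 0" for z s t by (simp add: apx_def)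
  have scale: "real p * apx x s (int p * t) = apx (real p * x) s t" if "t > 0" for s t
  proof -
    have "real_of_int s / real_of_int (int p * t) - x = (real_of_int s / real_of_int t - real p * x) / real p"
      using p0 that by (simp add: field_simps)
    then have "\<bar>real_of_int s / real_of_int (int p * t) - x\<bar> = \<bar>real_of_int s / real_of_int t - real p * x\<bar> / real p"
      using p0 by simp
    then show ?thesis
      using p0 that by (simp add: apx_def power2_eq_square field_simps)
  qed
  have "lam x \<le> lagrange_approx p x"
    unfolding L lam_alt
  proof (rule Limsup_mono)
    show "\<forall>\<^sub>F y in rat_approach x. (case y of (s, t) \<Rightarrow> ereal (apx x s t)) \<le> ?g y"
      unfolding eventually_rat_approach
    proof (intro exI[of _ 1] conjI allI impI)
      fix s t :: int assume "t > 0"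
      then have "real_of_int (gcd t (int p)) \<ge> 1" 
        by (metis gcd_pos_int int_one_le_iff_zero_less less_irrefl of_int_1_le_iff)
      then have "1 * apx x s t \<le> real_of_int (gcd t (int p)) * apx x s t"
        by (intro mult_right_mono apx0)
      then show "(case (s, t) of (s, t) \<Rightarrow> ereal (apx x s t)) \<le> ?g (s, t)" by simp
    qed simp
  qed
  moreover have "lam (real p * x) \<le> lagrange_approx p x"
  proof (rule ereal_le_by_reals)
    fix c d assume c: "lagrange_approx p x < ereal c" "c < d"
    from Limsup_lessD[OF c(1)[unfolded L]]
    obtain e where e: "e > 0" "\<And>s t. t > 0 \<Longrightarrow> real_of_int s / real_of_int t \<noteq> x \<Longrightarrow>
        \<bar>real_of_int s / real_of_int t - x\<bar> < e \<Longrightarrow> real_of_int (gcd t (int p)) * apx x s t < c"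
      unfolding eventually_rat_approach by auto
    have "lam (real p * x) \<le> ereal c"
    proof (rule lam_leI[of e])
      fix s t :: int
      assume t: "t > 0" and ne: "real_of_int s / real_of_int t \<noteq> real p * x"
        and le: "\<bar>real_of_int s / real_of_int t - real p * x\<bar> < e"
      have q: "real_of_int s / real_of_int (int p * t) - x = (real_of_int s / real_of_int t - real p * x) / real p"
        using p0 t by (simp add: field_simps)
      have a: "\<bar>real_of_int s / real_of_int (int p * t) - x\<bar> \<le> \<bar>real_of_int s / real_of_int t - real p * x\<bar>"
        unfolding q using p0 by (simp add: divide_le_eq mult_le_cancel_left1)
      have "real_of_int (gcd (int p * t) (int p)) * apx x s (int p * t) < c"
      proof (rule e(2))
        show "0 < int p * t" using p0 t by simp
        show "real_of_int s / real_of_int (int p * t) \<noteq> x" using q ne p0 by auto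
        show "\<bar>real_of_int s / real_of_int (int p * t) - x\<bar> < e" using a le by linarith
      qed
      then show "apx (real p * x) s t \<le> c"
        using scale[OF t, of s] by simp
    qed (rule e(1))
    then show "lam (real p * x) \<le> ereal d" using c(2) by (meson ereal_less_eq(3) less_imp_le order_trans)
  qed
  moreover have "lagrange_approx p x \<le> max (lam x) (lam (real p * x))"
  proof (rule ereal_le_by_reals)
    fix c d assume c: "max (lam x) (lam (real p * x)) < ereal c" "c < d"
    obtain e1 where e1: "e1 > 0" "\<And>s t. t > 0 \<Longrightarrow> real_of_int s / real_of_int t \<noteq> x \<Longrightarrow>
        \<bar>real_of_int s / real_of_int t - x\<bar> < e1 \<Longrightarrow> apx x s t < c"
      using lam_lessD[of x c] c(1) by auto
    obtain e2 where e2: "e2 > 0" "\<And>s t. t > 0 \<Longrightarrow> real_of_int s / real_of_int t \<noteq> real p * x \<Longrightarrow>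
        \<bar>real_of_int s / real_of_int t - real p * x\<bar> < e2 \<Longrightarrow> apx (real p * x) s t < c"
      using lam_lessD[of "real p * x" c] c(1) by auto
    have "lagrange_approx p x \<le> ereal c"
      unfolding L
    proof (rule Limsup_bounded)
      show "\<forall>\<^sub>F y in rat_approach x. ?g y \<le> ereal c"
        unfolding eventually_rat_approach
      proof (intro exI[of _ "min e1 (e2 / real p)"] conjI allI impI)
        show "min e1 (e2 / real p) > 0" using e1(1) e2(1) p0 by simp
        fix s t :: int
        assume t: "t > 0" and ne: "real_of_int s / real_of_int t \<noteq> x"
          and le: "\<bar>real_of_int s / real_of_int t - x\<bar> < min e1 (e2 / real p)"
        show "?g (s, t) \<le> ereal c"
        proof (cases "int p dvd t")
          case False
          then have "coprime t (int p)" using assms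
            by (metis coprime_commute prime_imp_coprime_int prime_nat_int_transfer)
          then have "gcd t (int p) = 1" by simp
          then show ?thesis using e1(2)[OF t ne] le by simp
        next
          case True
          then obtain u where u: "t = int p * u" by blast
          have u0: "u > 0" using t u p0 by (simp add: zero_less_mult_iff)
          have q: "real_of_int s / real_of_int t - x = (real_of_int s / real_of_int u - real p * x) / real p"
            using p0 u0 u by (simp add: field_simps)
          have "\<bar>real_of_int s / real_of_int u - real p * x\<bar> < e2"
            using le p0 unfolding q by (simp add: field_simps)
          moreover have "real_of_int s / real_of_int u \<noteq> real p * x" using q ne by auto
          ultimately have "apx (real p * x) s u < c" using e2(2)[OF u0] by blast
          then show ?thesis using scale[OF u0, of s] u u0 by simp
        qed
      qed
    qed
    then show "lagrange_approx p x \<le> ereal d" using c(2) by (meson ereal_less_eq(3) less_imp_le order_trans)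
  qed
  ultimately show ?thesis by (intro antisym) auto
qed

lemma lam_moebius_le:
  fixes a b c d :: int
  assumes det: "\<bar>a * d - b * c\<bar> = 1" and nz: "real_of_int c * x + real_of_int d \<noteq> 0"
    and y: "y = (real_of_int a * x + real_of_int b) / (real_of_int c * x + real_of_int d)"
  shows "lam y \<le> lam x"
proof (rule ereal_le_by_reals)
  fix k l assume k: "lam x < ereal k" "k < l"
  obtain e where e: "e > 0" "\<And>s t. t > 0 \<Longrightarrow> real_of_int s / real_of_int t \<noteq> x \<Longrightarrow>
        \<bar>real_of_int s / real_of_int t - x\<bar> < e \<Longrightarrow> apx x s t < k"
    using lam_lessD[OF k(1)] by auto
  define D where "D = a * d - b * c"
  have D: "D = 1 \<or> D = -1" using det unfolding D_def by linarith
  define w where "w = real_of_int c * x + real_of_int d"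
  have w: "w \<noteq> 0" using nz w_def by simp
  have inv1: "real_of_int a - real_of_int c * y = real_of_int D / w"
    using w unfolding y w_def[symmetric] D_def by (simp add: field_simps w_def)
  have inv2: "real_of_int d * y - real_of_int b = real_of_int D * x / w"
    using w unfolding y w_def[symmetric] D_def by (simp add: field_simps w_def)
  define q where "q r = real_of_int a - real_of_int c * r" for r :: real
  define g where "g r = (real_of_int d * r - real_of_int b) / q r" for r :: real
  have qy: "q y = real_of_int D / w" using inv1 q_def by simp
  have qy0: "q y \<noteq> 0" using D w qy by auto
  have gy: "g y = x" unfolding g_def inv2 qy using D w by auto
  have c1: "isCont g y" unfolding g_def using qy0 unfolding q_def by (intro continuous_intros) auto
  have c2: "isCont (\<lambda>r. \<bar>w\<bar> * \<bar>q r\<bar>) y" unfolding q_def by (intro continuous_intros)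
  have l1: "\<bar>w\<bar> * \<bar>q y\<bar> = 1" unfolding qy using D w by (auto simp: abs_mult[symmetric])
  \<comment> \<open>The 1/2 keeps \<open>q r\<close> away from 0, and l / k - 1 fits the factor into
    the gap between k and l. The case k <= 0 needs a default here because \<open>k > 0\<close>
    follows only later, from an actual approximation of quality below k.\<close>
  define r0 where "r0 = (if k > 0 then min (1/2) (l / k - 1) else 1/2)"
  have r01: "0 < r0" "r0 \<le> 1/2" using k(2) unfolding r0_def by (auto simp: field_simps)
  obtain s1 where s1: "s1 > 0" "\<And>r. \<bar>r - y\<bar> < s1 \<Longrightarrow> \<bar>g r - x\<bar> < e"
    using c1 e(1) unfolding continuous_at_eps_delta dist_real_def gy by metis
  obtain s2 where s2: "s2 > 0" "\<And>r. \<bar>r - y\<bar> < s2 \<Longrightarrow> \<bar>\<bar>w\<bar> * \<bar>q r\<bar> - 1\<bar> < r0"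
    using c2 r01(1) unfolding continuous_at_eps_delta dist_real_def l1 by metis
  define e' where "e' = min s1 s2"
  have e': "e' > 0" "\<And>r. \<bar>r - y\<bar> < e' \<Longrightarrow> \<bar>g r - x\<bar> < e"
      "\<And>r. \<bar>r - y\<bar> < e' \<Longrightarrow> \<bar>\<bar>w\<bar> * \<bar>q r\<bar> - 1\<bar> < r0"
    using s1 s2 unfolding e'_def by auto
  have "lam y \<le> ereal l"
  proof (rule lam_leI[OF e'(1)])
    fix s t :: int
    assume t: "t > 0" and ne: "real_of_int s / real_of_int t \<noteq> y"
      and le: "\<bar>real_of_int s / real_of_int t - y\<bar> < e'"
    define r where "r = real_of_int s / real_of_int t"
    have st: "real_of_int s = r * real_of_int t" using t r_def by simp
    define s' t' where "s' = d * s - b * t" and "t' = a * t - c * s"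
    have t'r: "real_of_int t' = real_of_int t * q r" unfolding t'_def q_def using st by (simp add: algebra_simps)
    have s'r: "real_of_int s' = real_of_int t * (real_of_int d * r - real_of_int b)"
      unfolding s'_def using st by (simp add: algebra_simps)
    have qr: "\<bar>\<bar>w\<bar> * \<bar>q r\<bar> - 1\<bar> < r0" using e'(3)[of r] le r_def by auto
    then have qr0: "q r \<noteq> 0" using r01 by auto
    have gr: "real_of_int s' / real_of_int t' = g r" unfolding t'r s'r g_def using t by simp
    have key: "g r - x = real_of_int D * (r - y) / (q r * q y)"
    proof -
      have "g r - g y = ((real_of_int d * r - real_of_int b) * q y - (real_of_int d * y - real_of_int b) * q r) / (q r * q y)"
        unfolding g_def using qr0 qy0 by (simp add: field_simps)
      also have "(real_of_int d * r - real_of_int b) * q y - (real_of_int d * y - real_of_int b) * q r = real_of_int D * (r - y)"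
        unfolding q_def D_def by (simp add: algebra_simps)
      finally show ?thesis using gy by simp
    qed
    have ne': "g r \<noteq> x" using key ne qr0 qy0 D r_def by auto
    have ab: "\<bar>g r - x\<bar> = \<bar>r - y\<bar> * \<bar>w\<bar> / \<bar>q r\<bar>"
      using key D w unfolding qy by (auto simp: abs_mult)
    have le2: "\<bar>g r - x\<bar> < e" using e'(2)[of r] le r_def by auto
    have val: "1 / ((real_of_int t')\<^sup>2 * \<bar>g r - x\<bar>) < k"
    proof (cases "t' > 0")
      case True
      show ?thesis using e(2)[OF True, of s'] ne' le2 unfolding apx_def gr by simp
    next
      case False
      then have "- t' > 0" using t'r qr0 t by (cases "t' = 0") auto
      moreover have "real_of_int (- s') / real_of_int (- t') = g r" using gr by simp
      ultimately show ?thesis using e(2)[of "-t'" "-s'"] ne' le2 unfolding apx_def by simp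
    qed
    have rpos: "\<bar>r - y\<bar> > 0" using ne r_def by auto
    have "(real_of_int t')\<^sup>2 * \<bar>g r - x\<bar> = (real_of_int t)\<^sup>2 * \<bar>r - y\<bar> * (\<bar>w\<bar> * \<bar>q r\<bar>)"
    proof -
      define Q where "Q = \<bar>q r\<bar>"
      have "Q \<noteq> 0" using qr0 Q_def by simp
      moreover have "(real_of_int t')\<^sup>2 = (real_of_int t)\<^sup>2 * (Q * Q)"
        unfolding t'r Q_def by (simp add: power_mult_distrib power2_eq_square)
      ultimately show ?thesis unfolding ab Q_def[symmetric] by simp
    qed
    then have v2: "1 / ((real_of_int t)\<^sup>2 * \<bar>r - y\<bar>) = (\<bar>w\<bar> * \<bar>q r\<bar>) * (1 / ((real_of_int t')\<^sup>2 * \<bar>g r - x\<bar>))"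
      using qr0 w by simp
    have "k > 0" using val by (rule le_less_trans[rotated]) simp
    have "(\<bar>w\<bar> * \<bar>q r\<bar>) * (1 / ((real_of_int t')\<^sup>2 * \<bar>g r - x\<bar>)) \<le> (l / k) * k"
    proof (rule mult_mono)
      show "\<bar>w\<bar> * \<bar>q r\<bar> \<le> l / k" using qr \<open>k > 0\<close> unfolding r0_def by auto
      show "0 \<le> l / k" using \<open>k > 0\<close> k(2) by simp
    qed (use val in auto)
    then show "apx y s t \<le> l" unfolding apx_def r_def[symmetric] v2 using \<open>k > 0\<close> by simp
  qed
  then show "lam y \<le> ereal l" .
qed

lemma lam_shift: "lam (x + real_of_int k) = lam x"
proof (rule antisym)
  show "lam (x + real_of_int k) \<le> lam x"
    by (rule lam_moebius_le[of 1 1 k 0]) auto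
  show "lam x \<le> lam (x + real_of_int k)"
    by (rule lam_moebius_le[of 1 1 "-k" 0]) auto
qed

lemma lam_moebius:
  fixes a b c d :: int
  assumes det: "\<bar>a * d - b * c\<bar> = 1" and nz: "real_of_int c * x + real_of_int d \<noteq> 0"
    and y: "y = (real_of_int a * x + real_of_int b) / (real_of_int c * x + real_of_int d)"
  shows "lam y = lam x"
proof (rule antisym)
  show "lam y \<le> lam x" by (rule lam_moebius_le[OF assms])
  define D where "D = a * d - b * c"
  have D: "D = 1 \<or> D = -1" using det unfolding D_def by linarith
  define w where "w = real_of_int c * x + real_of_int d"
  have w: "w \<noteq> 0" using nz w_def by simp
  have 1: "real_of_int (-c) * y + real_of_int a = real_of_int D / w"
    using w unfolding y w_def[symmetric] D_def by (simp add: field_simps w_def)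
  have 2: "real_of_int d * y + real_of_int (-b) = real_of_int D * x / w"
    using w unfolding y w_def[symmetric] D_def by (simp add: field_simps w_def)
  show "lam x \<le> lam y"
  proof (rule lam_moebius_le[of d a "-b" "-c"])
    show "\<bar>d * a - - b * - c\<bar> = 1" using det by (simp add: mult.commute)
    show "real_of_int (-c) * y + real_of_int a \<noteq> 0" unfolding 1 using D w by auto
    show "x = (real_of_int d * y + real_of_int (-b)) / (real_of_int (-c) * y + real_of_int a)"
      unfolding 1 2 using D w by auto
  qed
qed

lemma lam_inverse: "x \<noteq> 0 \<Longrightarrow> lam (1 / x) = lam x"
  by (rule lam_moebius[of 0 0 1 1]) auto

section \<open>The Stern--Brocot path of an irrational number\<close>

definition pirr :: "real \<Rightarrow> bool" where "pirr x \<longleftrightarrow> x > 0 \<and> x \<notin> \<rat>"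

text \<open>One step of the additive continued fraction algorithm, which strips the first
  Stern-Brocot letter. The boundary x = 1 does not occur among irrationals.\<close>

definition nx :: "real \<Rightarrow> real" where
  "nx x = (if x > 1 then x - 1 else x / (1 - x))"

lemma pirr_ne_1: "pirr x \<Longrightarrow> x \<noteq> 1"
  by (auto simp: pirr_def)

lemma nx_False: "pirr x \<Longrightarrow> \<not> x > 1 \<Longrightarrow> x = nx x / (1 + nx x)"
  using pirr_ne_1[of x] by (auto simp: nx_def pirr_def field_simps)

lemma pirr_nx: assumes "pirr x" shows "pirr (nx x)"
proof (cases "x > 1")
  case True
  then have "nx x = x - 1" by (simp add: nx_def)
  moreover have "x - 1 \<notin> \<rat>"
    using assms Rats_add[of "x - 1" 1] by (auto simp: pirr_def)
  ultimately show ?thesis using True by (auto simp: pirr_def)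
next
  case False
  then have x: "x < 1" "x > 0" using assms pirr_ne_1[OF assms] by (auto simp: pirr_def)
  have "nx x \<notin> \<rat>"
  proof
    assume "nx x \<in> \<rat>"
    then have "nx x / (1 + nx x) \<in> \<rat>" by simp
    then show False using nx_False[OF assms False] assms by (simp add: pirr_def)
  qed
  then show ?thesis using x False by (simp add: pirr_def nx_def)
qed

lemma pirr_funpow: "pirr x \<Longrightarrow> pirr ((nx ^^ n) x)"
  by (induction n) (auto intro: pirr_nx)

lemma lam_nx: assumes "pirr x" shows "lam (nx x) = lam x"
proof (cases "x > 1")
  case True
  then show ?thesis using lam_shift[of x "-1"] by (simp add: nx_def)
next
  case False
  then have "x < 1" using pirr_ne_1[OF assms] by auto
  then show ?thesis using False
    by (intro lam_moebius[of 1 1 0 "-1"]) (auto simp: nx_def)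
qed

lemma lam_funpow: "pirr x \<Longrightarrow> lam ((nx ^^ n) x) = lam x"
  by (induction n) (auto simp: lam_nx pirr_funpow simp del: One_nat_def)

lemma pirr_inverse: "pirr x \<Longrightarrow> pirr (1 / x)"
  using Rats_divide[OF Rats_1, of "1 / x"] by (auto simp: pirr_def)

lemma nx_inverse: assumes "pirr x" shows "nx (1 / x) = 1 / nx x"
  using assms pirr_ne_1[OF assms] by (auto simp: nx_def pirr_def field_simps)

lemma funpow_nx_inverse: "pirr x \<Longrightarrow> (nx ^^ n) (1 / x) = 1 / (nx ^^ n) x"
  by (induction n) (auto simp: nx_inverse pirr_funpow)

definition mob :: "int \<Rightarrow> int \<Rightarrow> int \<Rightarrow> int \<Rightarrow> real \<Rightarrow> real" where
  "mob a b c d x = (real_of_int a * x + real_of_int b) / (real_of_int c * x + real_of_int d)"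

text \<open>Right multiplication by the matrix of a letter, (1 1; 0 1) for \<open>True\<close> and
  (1 0; 1 1) for \<open>False\<close>. The columns of \<open>sb_path\<close> are thus the ends a / c
  > b / d of the Stern-Brocot interval, beginning with 1/0 and 0/1.\<close>

fun mstep :: "bool \<Rightarrow> int \<times> int \<times> int \<times> int \<Rightarrow> int \<times> int \<times> int \<times> int" where
  "mstep True (a, b, c, d) = (a, a + b, c, c + d)"
| "mstep False (a, b, c, d) = (a + b, b, c + d, d)"

primrec sb_path :: "real \<Rightarrow> nat \<Rightarrow> int \<times> int \<times> int \<times> int" where
  "sb_path x 0 = (1, 0, 0, 1)"
| "sb_path x (Suc n) = mstep ((nx ^^ n) x > 1) (sb_path x n)"

lemma mob_True: "x > 1 \<Longrightarrow> mob a (a + b) c (c + d) (nx x) = mob a b c d x"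
  by (simp add: mob_def nx_def algebra_simps)

lemma mob_False:
  assumes "pirr x" "\<not> x > 1"
  shows "mob (a + b) b (c + d) d (nx x) = mob a b c d x"
proof -
  have n: "nx x > 0" using pirr_nx[OF assms(1)] by (simp add: pirr_def)
  define y where "y = nx x"
  have y: "y > 0" "x = y / (1 + y)" using n nx_False[OF assms] y_def by auto
  have *: "(u * (y / (1 + y)) + v) = ((u + v) * y + v) / (1 + y)" for u v :: real
    using y(1) by (simp add: field_simps)
  show ?thesis unfolding mob_def y_def[symmetric] unfolding y(2) * using y(1) by simp
qed

lemma path_inv:
  assumes "pirr x" "sb_path x n = (a, b, c, d)"
  shows "a \<ge> 1" "d \<ge> 1" "b \<ge> 0" "c \<ge> 0" "a * d - b * c = 1" "mob a b c d ((nx ^^ n) x) = x"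
proof -
  have "\<forall>a b c d. sb_path x n = (a, b, c, d) \<longrightarrow> a \<ge> 1 \<and> d \<ge> 1 \<and> b \<ge> 0 \<and> c \<ge> 0 \<and> a * d - b * c = 1
          \<and> mob a b c d ((nx ^^ n) x) = x"
  proof (induction n)
    case 0 then show ?case by (simp add: mob_def)
  next
    case (Suc n)
    obtain a b c d where p: "sb_path x n = (a, b, c, d)" by (metis prod_cases4)
    from Suc[rule_format, OF p] have IH: "a \<ge> 1" "d \<ge> 1" "b \<ge> 0" "c \<ge> 0" "a * d - b * c = 1"
      "mob a b c d ((nx ^^ n) x) = x" by auto
    show ?case
    proof (cases "(nx ^^ n) x > 1")
      case True
      then show ?thesis using IH p mob_True[OF True, of a b c d] by (auto simp: algebra_simps)
    next
      case False
      then show ?thesis using IH p mob_False[OF pirr_funpow[OF assms(1)] False, of a b c d]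
        by (auto simp: algebra_simps)
    qed
  qed
  with assms(2) show "a \<ge> 1" "d \<ge> 1" "b \<ge> 0" "c \<ge> 0" "a * d - b * c = 1" "mob a b c d ((nx ^^ n) x) = x"
    by blast+
qed

text \<open>An expansion consisting of \<open>True\<close> only would subtract 1 forever, so some
  letter is \<open>False\<close> and makes the lower left entry positive. From then on every letter
  adds a positive entry to the sum of the bottom row.\<close>

lemma path_growth:
  assumes "pirr x"
  shows "\<exists>n0. \<forall>n a b c d. sb_path x (n0 + n) = (a, b, c, d) \<longrightarrow> c \<ge> 1 \<and> c + d \<ge> int n"
proof -
  have "\<exists>n a b c d. sb_path x n = (a, b, c, d) \<and> c \<ge> 1"
  proof (rule ccontr)
    assume "\<not> ?thesis"
    then have neg: "\<And>n a b c d. sb_path x n = (a, b, c, d) \<Longrightarrow> \<not> c \<ge> 1" by blast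
    have "(nx ^^ n) x > 1" for n
    proof (rule ccontr)
      assume *: "\<not> (nx ^^ n) x > 1"
      obtain a b c d where p: "sb_path x n = (a, b, c, d)" by (metis prod_cases4)
      then have "sb_path x (Suc n) = (a + b, b, c + d, d)" using * by simp
      with neg have "\<not> c + d \<ge> 1" by blast
      with path_inv[OF assms p] show False by linarith
    qed
    then have step: "nx ((nx ^^ n) x) = (nx ^^ n) x - 1" for n
      by (simp add: nx_def)
    have "(nx ^^ n) x = x - real n" for n
    proof (induction n)
      case (Suc n)
      have "(nx ^^ Suc n) x = (nx ^^ n) x - 1" using step[of n] by simp
      then show ?case using Suc by simp
    qed simp
    moreover obtain n where "real n > x" using reals_Archimedean2 by blast
    moreover have "(nx ^^ n) x > 0" using pirr_funpow[OF assms] by (simp add: pirr_def)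
    ultimately show False by auto
  qed
  then obtain n0 a0 b0 c0 d0 where n0: "sb_path x n0 = (a0, b0, c0, d0)" "c0 \<ge> 1" by blast
  have "\<forall>a b c d. sb_path x (n0 + n) = (a, b, c, d) \<longrightarrow> c \<ge> 1 \<and> c + d \<ge> int n" for n
  proof (induction n)
    case 0
    then show ?case using n0 path_inv[OF assms n0(1)] by auto
  next
    case (Suc n)
    obtain a b c d where p: "sb_path x (n0 + n) = (a, b, c, d)" by (metis prod_cases4)
    with Suc have "c \<ge> 1" "c + d \<ge> int n" by auto
    with path_inv[OF assms p] p show ?case
      by (cases "(nx ^^ (n0 + n)) x > 1") auto
  qed
  then show ?thesis by blast
qed

text \<open>The past of the expansion, as the tail \<open>(nx ^^ n) x\<close> is its future: the
  analogue of a quotient of consecutive denominators of convergents. While c = 0, division by zero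
  makes it 0, hence the recurring condition \<open>theta x n > 0\<close>.\<close>

definition theta :: "real \<Rightarrow> nat \<Rightarrow> real" where
  "theta x n = (case sb_path x n of (a, b, c, d) \<Rightarrow> real_of_int d / real_of_int c)"

text \<open>Perron's formula in Stern-Brocot form: one end of the current interval approximates with
  quality future plus past, the other with the sum of the reciprocals. Both follow from the
  determinant, which makes the differences to the ends 1 / (C w) and e / (D w).\<close>

lemma apx_path:
  fixes a b c d :: int
  assumes e: "e > 0" and det: "a * d - b * c = 1" and pos: "a \<ge> 1" "b \<ge> 0" "c \<ge> 1" "d \<ge> 1"
  shows "apx (mob a b c d e) a c = e + real_of_int d / real_of_int c"
    "apx (mob a b c d e) b d = 1 / e + real_of_int c / real_of_int d"
    "\<bar>real_of_int a / real_of_int c - mob a b c d e\<bar> < 1 / (real_of_int c * real_of_int d)"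
    "\<bar>real_of_int b / real_of_int d - mob a b c d e\<bar> < 1 / (real_of_int c * real_of_int d)"
    "real_of_int a / real_of_int c > mob a b c d e"
    "real_of_int b / real_of_int d < mob a b c d e"
proof -
  define A B C D where "A = real_of_int a" "B = real_of_int b" "C = real_of_int c" "D = real_of_int d"
  have A: "A \<ge> 1" "B \<ge> 0" "C \<ge> 1" "D \<ge> 1" using pos unfolding A_B_C_D_def by auto
  have dt: "A * D - B * C = 1" unfolding A_B_C_D_def using det
    by (metis of_int_1 of_int_diff of_int_mult)
  define w where "w = C * e + D"
  have w: "w > 0" "w > D" using A e w_def by (auto intro: add_nonneg_pos)
  have m: "mob a b c d e = (A * e + B) / w" by (simp add: mob_def A_B_C_D_def w_def)
  have "A * w - (A * e + B) * C = A * D - B * C" unfolding w_def by (simp add: algebra_simps)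
  then have 1: "A / C - (A * e + B) / w = 1 / (C * w)"
    using w A dt by (simp add: field_simps)
  have "(A * e + B) * D - B * w = e * (A * D - B * C)" unfolding w_def by (simp add: algebra_simps)
  then have 2: "(A * e + B) / w - B / D = e / (D * w)"
    using w A dt by (simp add: field_simps)
  have p1: "1 / (C * w) > 0" "e / (D * w) > 0" using w A e by auto
  show "apx (mob a b c d e) a c = e + real_of_int d / real_of_int c"
    unfolding apx_def m A_B_C_D_def[symmetric] 1 using p1 w A
    by (simp add: power2_eq_square w_def field_simps)
  have "\<bar>B / D - (A * e + B) / w\<bar> = e / (D * w)" using 2 p1 by linarith
  moreover have "1 / (D\<^sup>2 * (e / (D * w))) = w / (D * e)"
    using w A e by (simp add: power2_eq_square)
  moreover have "w / (D * e) = 1 / e + C / D"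
    using A e by (simp add: w_def field_simps)
  ultimately show "apx (mob a b c d e) b d = 1 / e + real_of_int c / real_of_int d"
    unfolding apx_def m A_B_C_D_def[symmetric] by simp
  show "\<bar>real_of_int a / real_of_int c - mob a b c d e\<bar> < 1 / (real_of_int c * real_of_int d)"
    unfolding m A_B_C_D_def[symmetric] 1 using p1 w A by (simp add: field_simps)
  have "e / w < 1 / C" using w(1) A e by (simp add: field_simps) (simp add: w_def)
  then have "e / w / D < 1 / C / D" using A by (intro divide_strict_right_mono) auto
  then have "e / (D * w) < 1 / (C * D)" by (simp add: mult.commute)
  then show "\<bar>real_of_int b / real_of_int d - mob a b c d e\<bar> < 1 / (real_of_int c * real_of_int d)"
    unfolding m A_B_C_D_def[symmetric] using 2 p1 by linarith
  show "real_of_int a / real_of_int c > mob a b c d e"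
    unfolding m A_B_C_D_def[symmetric] using 1 p1 by linarith
  show "real_of_int b / real_of_int d < mob a b c d e"
    unfolding m A_B_C_D_def[symmetric] using 2 p1 by linarith
qed

lemma path_close:
  assumes "pirr x" "e > 0"
  shows "\<exists>n0. \<forall>n\<ge>n0. \<forall>a b c d. sb_path x n = (a, b, c, d) \<longrightarrow> c \<ge> 1 \<and> 1 / (real_of_int c * real_of_int d) < e"
proof -
  obtain n0 where n0: "\<And>n a b c d. sb_path x (n0 + n) = (a, b, c, d) \<Longrightarrow> c \<ge> 1 \<and> c + d \<ge> int n"
    using path_growth[OF assms(1)] by blast
  obtain k where k: "real k > 1 / e" using reals_Archimedean2 by blast
  show ?thesis
  proof (intro exI[of _ "n0 + k + 1"] allI impI)
    fix n a b c d
    assume n: "n0 + k + 1 \<le> n" and p: "sb_path x n = (a, b, c, d)"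
    then have "sb_path x (n0 + (n - n0)) = (a, b, c, d)" by simp
    from n0[OF this] n have c: "c \<ge> 1" "c + d \<ge> int k + 1" by auto
    have d: "d \<ge> 1" using path_inv[OF assms(1) p] by simp
    have "(c - 1) * (d - 1) \<ge> 0" using c d by simp
    then have "c * d \<ge> int k" using c(2) by (simp add: algebra_simps)
    then have "real k \<le> real_of_int (c * d)" by linarith
    then have "real_of_int c * real_of_int d > 1 / e" using k by simp
    then show "c \<ge> 1 \<and> 1 / (real_of_int c * real_of_int d) < e"
      using assms(2) c d by (simp add: field_simps)
  qed
qed

lemma lam_less_path:
  assumes "pirr x" "lam x < ereal k"
  shows "\<exists>n0. \<forall>n\<ge>n0. theta x n > 0 \<and> (nx ^^ n) x + theta x n < k \<and> 1 / (nx ^^ n) x + 1 / theta x n < k"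
proof -
  obtain e where e: "e > 0" "\<And>s t. t > 0 \<Longrightarrow> real_of_int s / real_of_int t \<noteq> x \<Longrightarrow>
        \<bar>real_of_int s / real_of_int t - x\<bar> < e \<Longrightarrow> apx x s t < k"
    using lam_lessD[OF assms(2)] by blast
  obtain n0 where n0: "\<And>n a b c d. n \<ge> n0 \<Longrightarrow> sb_path x n = (a, b, c, d) \<Longrightarrow>
      c \<ge> 1 \<and> 1 / (real_of_int c * real_of_int d) < e"
    using path_close[OF assms(1) e(1)] by blast
  show ?thesis
  proof (intro exI[of _ n0] allI impI)
    fix n assume n: "n \<ge> n0"
    obtain a b c d where p: "sb_path x n = (a, b, c, d)" by (metis prod_cases4)
    note inv = path_inv[OF assms(1) p]
    have c: "c \<ge> 1" "1 / (real_of_int c * real_of_int d) < e" using n0[OF n p] by auto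
    have eta: "(nx ^^ n) x > 0" using pirr_funpow[OF assms(1)] by (simp add: pirr_def)
    note A = apx_path[OF eta inv(5) inv(1) inv(3) c(1) inv(2), unfolded inv(6)]
    have "apx x a c < k" using A(3,5) c inv by (intro e(2)) auto
    moreover have "apx x b d < k" using A(4,6) c inv by (intro e(2)) auto
    ultimately show "theta x n > 0 \<and> (nx ^^ n) x + theta x n < k \<and> 1 / (nx ^^ n) x + 1 / theta x n < k"
      using A(1,2) c inv by (simp add: theta_def p)
  qed
qed

text \<open>If both sums were below 1, the tail and its reciprocal would both be below 1. The crude
  constant suffices for its two uses: excluding minus infinity as a value, and providing
  approximations of quality above 1/2 arbitrarily close to x.\<close>

lemma lam_ge_1: assumes "pirr x" shows "lam x \<ge> 1"
proof (rule ccontr)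
  assume "\<not> ?thesis"
  then have "lam x < ereal 1" by (simp add: one_ereal_def)
  from lam_less_path[OF assms this] obtain n where
    n: "theta x n > 0" "(nx ^^ n) x + theta x n < 1" "1 / (nx ^^ n) x + 1 / theta x n < 1" by blast
  have p: "(nx ^^ n) x > 0" using pirr_funpow[OF assms] by (simp add: pirr_def)
  have "1 / (nx ^^ n) x < 1" using n p by (smt (verit) divide_pos_pos)
  then show False using n p by (simp add: field_simps)
qed

section \<open>Forbidden words\<close>

text \<open>A word lists Stern--Brocot letters; \<^term>\<open>True\<close> is the letter of \<open>x > 1\<close>.
  Read outwards from a position, the letters expand both the tail \<open>(nx ^^ n) x\<close> and,
  backwards, the quotient \<^term>\<open>theta x n\<close>.\<close>

primrec app :: "bool list \<Rightarrow> real \<Rightarrow> real" where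
  "app [] x = x"
| "app (l # w) x = (if l then 1 + app w x else app w x / (1 + app w x))"

definition lets :: "real \<Rightarrow> nat \<Rightarrow> nat \<Rightarrow> bool list" where
  "lets x n k = map (\<lambda>j. (nx ^^ j) x > 1) [n..<n + k]"

lemma length_lets[simp]: "length (lets x n k) = k"
  by (simp add: lets_def)

lemma lets_Suc: "lets x n (Suc k) = lets x n k @ [(nx ^^ (n + k)) x > 1]"
  by (simp add: lets_def)

lemma lets_Suc': "lets x n (Suc k) = ((nx ^^ n) x > 1) # lets x (Suc n) k"
  unfolding lets_def by (subst upt_conv_Cons) auto

lemma lets_add: "lets x n (k + m) = lets x n k @ lets x (n + k) m"
  unfolding lets_def by (simp add: upt_add_eq_append[of n "n+k" m] add.assoc[symmetric])

lemma lets_funpow: "lets ((nx ^^ m) x) n k = lets x (m + n) k"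
proof -
  have "(nx ^^ j) ((nx ^^ m) x) = (nx ^^ (m + j)) x" for j
    by (simp add: funpow_add add.commute)
  then show ?thesis by (induction k) (auto simp: lets_Suc lets_def add.assoc)
qed

lemma app_pos: "x > 0 \<Longrightarrow> app w x > 0"
  by (induction w) auto

lemma app_mono: "0 < x \<Longrightarrow> x \<le> y \<Longrightarrow> app w x \<le> app w y"
proof (induction w)
  case (Cons l w)
  have "0 < app w x" using Cons app_pos by auto
  with Cons show ?case by (auto simp: field_simps)
qed auto

lemma app_append: "app (v @ w) x = app v (app w x)"
  by (induction v) auto

lemma app_lets: "pirr x \<Longrightarrow> app (lets x n k) ((nx ^^ (n + k)) x) = (nx ^^ n) x"
proof (induction k)
  case (Suc k)
  let ?y = "(nx ^^ (n + k)) x"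
  have "pirr ?y" using Suc pirr_funpow by blast
  then have "app [?y > 1] (nx ?y) = ?y" using nx_False[of ?y] by (auto simp: nx_def)
  then show ?case using Suc by (simp add: lets_Suc app_append)
qed (auto simp: lets_def)

lemma theta_Suc:
  assumes "pirr x" "theta x n > 0"
  shows "theta x (Suc n) = app [(nx ^^ n) x > 1] (theta x n)"
proof -
  obtain a b c d where p: "sb_path x n = (a, b, c, d)" by (metis prod_cases4)
  with assms have c: "c \<noteq> 0" by (auto simp: theta_def)
  then have "c \<ge> 1" "d \<ge> 1" using path_inv[OF assms(1) p] by auto
  then show ?thesis using p by (cases "(nx ^^ n) x > 1") (auto simp: theta_def field_simps)
qed

lemma app_theta:
  assumes "pirr x" "\<And>m. m \<ge> n \<Longrightarrow> theta x m > 0"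
  shows "app (rev (lets x n k)) (theta x n) = theta x (n + k)"
proof (induction k)
  case (Suc k)
  then show ?case using theta_Suc[OF assms(1) assms(2), of "n + k"] by (simp add: lets_Suc)
qed (auto simp: lets_def)

text \<open>All tails will lie in \<open>[1/4, 4]\<close>, so this says that an occurrence of \<open>w\<close> forces an
  approximation of quality at least \<open>k\<close>.\<close>

definition win :: "real \<Rightarrow> bool list \<Rightarrow> bool" where
  "win k w \<longleftrightarrow> (\<exists>i\<le>length w.
      k \<le> app (rev (take i w)) (1/4) + app (drop i w) (1/4) \<or>
      k \<le> 1 / app (rev (take i w)) 4 + 1 / app (drop i w) 4)"

text \<open>The past of the position does not enter, since \<open>win\<close> replaces it by the
  ends of its range. The set therefore depends on x alone and is stable under \<open>nx\<close> and
  under inversion, and a search may start at any tail.\<close>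

definition adm :: "real \<Rightarrow> real set" where
  "adm k = {x. pirr x \<and> (\<forall>n. 1/4 < (nx ^^ n) x \<and> (nx ^^ n) x < 4) \<and>
               (\<forall>n m. \<not> win k (lets x n m))}"

lemma adm_pirr: "x \<in> adm k \<Longrightarrow> pirr x" by (simp add: adm_def)

lemma adm_funpow: "x \<in> adm k \<Longrightarrow> (nx ^^ m) x \<in> adm k"
proof -
  assume x: "x \<in> adm k"
  have "(nx ^^ n) ((nx ^^ m) x) = (nx ^^ (n + m)) x" for n by (simp add: funpow_add)
  with x show ?thesis by (auto simp: adm_def pirr_funpow lets_funpow)
qed

lemma adm_nx: "x \<in> adm k \<Longrightarrow> nx x \<in> adm k"
  using adm_funpow[of x k 1] by simp

lemma app_Not: "x > 0 \<Longrightarrow> app (map Not w) (1 / x) = 1 / app w x"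
proof (induction w)
  case (Cons l w)
  have IH: "app (map Not w) (1 / x) = 1 / app w x" using Cons by simp
  have "app w x > 0" using Cons app_pos by simp
  then show ?case by (cases l) (simp_all add: IH field_simps)
qed auto

text \<open>Inversion exchanges the two letters, the ends 1/4 and 4, and with them the two
  sums.\<close>

lemma win_Not: "win k (map Not w) = win k w"
proof -
  have *: "app (map Not u) (1/4) = 1 / app u 4" "1 / app (map Not u) 4 = app u (1/4)" for u
    using app_Not[of 4 u] app_Not[of "1/4" u] by auto
  show ?thesis unfolding win_def by (auto simp: take_map drop_map rev_map * simp del: times_divide_eq_right)
qed

lemma adm_inverse: assumes "x \<in> adm k" shows "1 / x \<in> adm k"
proof -
  have x: "pirr x" using assms by (simp add: adm_def)
  have "lets (1 / x) n m = map Not (lets x n m)" for n m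
  proof -
    have "(nx ^^ j) (1 / x) > 1 \<longleftrightarrow> \<not> (nx ^^ j) x > 1" for j
      using pirr_funpow[OF x, of j] pirr_ne_1[OF pirr_funpow[OF x, of j]]
      by (auto simp: funpow_nx_inverse[OF x] pirr_def field_simps)
    then show ?thesis by (simp add: lets_def)
  qed
  moreover have "1/4 < (nx ^^ n) (1 / x) \<and> (nx ^^ n) (1 / x) < 4" for n
  proof -
    have "1/4 < (nx ^^ n) x" "(nx ^^ n) x < 4" using assms by (auto simp: adm_def)
    then show ?thesis by (auto simp: funpow_nx_inverse[OF x] field_simps)
  qed
  ultimately show ?thesis using assms pirr_inverse[OF x] by (auto simp: adm_def win_Not)
qed

text \<open>Both Perron sums are below k <= 4 and have positive terms, so tail and
  \<open>theta\<close> lie in (1/4, 4). As \<open>app\<close> is increasing, replacing what lies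
  beyond the word by 1/4, or by 4 under a reciprocal, only lowers a sum; a winning word would
  therefore push a true sum to at least k.\<close>

lemma eventually_adm:
  assumes x: "pirr x" and l: "lam x < ereal k" and k: "k \<le> 4"
  shows "\<exists>n0. \<forall>n\<ge>n0. (nx ^^ n) x \<in> adm k"
proof -
  obtain n0 where n0: "\<And>n. n \<ge> n0 \<Longrightarrow> theta x n > 0"
    "\<And>n. n \<ge> n0 \<Longrightarrow> (nx ^^ n) x + theta x n < k"
    "\<And>n. n \<ge> n0 \<Longrightarrow> 1 / (nx ^^ n) x + 1 / theta x n < k"
    using lam_less_path[OF x l] by blast
  have eta0: "(nx ^^ n) x > 0" for n using pirr_funpow[OF x] by (simp add: pirr_def)
  have bnd: "1/4 < (nx ^^ n) x" "(nx ^^ n) x < 4" "1/4 < theta x n" "theta x n < 4" if "n \<ge> n0" for n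
  proof -
    have "1 / (nx ^^ n) x < 4" "1 / theta x n < 4" "(nx ^^ n) x < 4" "theta x n < 4"
      using n0[OF that] eta0[of n] k by (smt (verit) divide_pos_pos)+
    then show "1/4 < (nx ^^ n) x" "(nx ^^ n) x < 4" "1/4 < theta x n" "theta x n < 4"
      using eta0[of n] n0(1)[OF that] by (auto simp: field_simps)
  qed
  have nowin: "\<not> win k (lets x n m)" if n: "n \<ge> n0" for n m
  proof
    assume "win k (lets x n m)"
    then obtain i where i: "i \<le> m" and w: "k \<le> app (rev (take i (lets x n m))) (1/4) + app (drop i (lets x n m)) (1/4) \<or>
      k \<le> 1 / app (rev (take i (lets x n m))) 4 + 1 / app (drop i (lets x n m)) 4"
      unfolding win_def by auto
    have "lets x n m = lets x n i @ lets x (n + i) (m - i)" using i lets_add[of x n i "m - i"] by simp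
    then have td: "take i (lets x n m) = lets x n i" "drop i (lets x n m) = lets x (n + i) (m - i)" by auto
    have e: "app (lets x (n + i) (m - i)) ((nx ^^ (n + m)) x) = (nx ^^ (n + i)) x"
      using app_lets[OF x, of "n + i" "m - i"] i by simp
    have t: "app (rev (lets x n i)) (theta x n) = theta x (n + i)"
      using n0(1) n by (intro app_theta[OF x]) auto
    have nm: "n + m \<ge> n0" "n + i \<ge> n0" using n by auto
    have "app (lets x (n + i) (m - i)) (1/4) \<le> (nx ^^ (n + i)) x"
      unfolding e[symmetric] using bnd[OF nm(1)] by (intro app_mono) auto
    moreover have "app (rev (lets x n i)) (1/4) \<le> theta x (n + i)"
      unfolding t[symmetric] using bnd[OF n] by (intro app_mono) auto
    moreover have "(nx ^^ (n + i)) x \<le> app (lets x (n + i) (m - i)) 4"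
      unfolding e[symmetric] using bnd[OF nm(1)] eta0 by (intro app_mono) auto
    then have "1 / app (lets x (n + i) (m - i)) 4 \<le> 1 / (nx ^^ (n + i)) x"
      using eta0 by (intro divide_left_mono) (auto simp: app_pos)
    moreover have "theta x (n + i) \<le> app (rev (lets x n i)) 4"
      unfolding t[symmetric] using bnd[OF n] n0(1)[OF n] by (intro app_mono) auto
    then have "1 / app (rev (lets x n i)) 4 \<le> 1 / theta x (n + i)"
      using n0(1)[OF nm(2)] by (intro divide_left_mono) (auto simp: app_pos)
    ultimately show False using w n0(2,3)[OF nm(2)] unfolding td by linarith
  qed
  show ?thesis
  proof (intro exI[of _ n0] allI impI)
    fix n assume n: "n \<ge> n0"
    have *: "(nx ^^ m) ((nx ^^ n) x) = (nx ^^ (n + m)) x" for m by (simp add: funpow_add add.commute)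
    show "(nx ^^ n) x \<in> adm k"
      unfolding adm_def mem_Collect_eq lets_funpow *
      using n pirr_funpow[OF x] bnd nowin by auto
  qed
qed

section \<open>Quadratic irrationals\<close>

definition sqrt_rat :: "ereal \<Rightarrow> bool" where
  "sqrt_rat v \<longleftrightarrow> (\<exists>q\<in>\<rat>. v = ereal (sqrt q) \<and> sqrt q \<notin> \<rat>)"

definition qf :: "int \<Rightarrow> int \<Rightarrow> int \<Rightarrow> int \<Rightarrow> int \<Rightarrow> int" where
  "qf a b c s t = a * s\<^sup>2 + b * s * t + c * t\<^sup>2"

context
  fixes a b c :: int and x :: real
  assumes a0: "a \<noteq> 0" and irr: "x \<notin> \<rat>"
    and root: "real_of_int a * x\<^sup>2 + real_of_int b * x + real_of_int c = 0"
begin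

definition "conj_root = - real_of_int b / real_of_int a - x"
definition "dsc = b\<^sup>2 - 4 * a * c"

lemma dsc_eq: "real_of_int dsc = (real_of_int a * (x - conj_root))\<^sup>2"
proof -
  have "real_of_int a * (x - conj_root) = 2 * real_of_int a * x + real_of_int b"
    using a0 by (simp add: conj_root_def field_simps)
  moreover have c: "real_of_int c = - (real_of_int a * x\<^sup>2 + real_of_int b * x)" using root by linarith
  have "real_of_int dsc = (2 * real_of_int a * x + real_of_int b)\<^sup>2"
    unfolding dsc_def by (simp add: c power2_eq_square algebra_simps)
  ultimately show ?thesis by simp
qed

lemma conj_ne: "x \<noteq> conj_root"
proof
  assume "x = conj_root"
  then have "2 * x = - real_of_int b / real_of_int a" by (simp add: conj_root_def)
  then have "x = - real_of_int b / real_of_int a / 2" by simp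
  then show False using irr by (metis Rats_divide Rats_minus_iff Rats_number_of Rats_of_int)
qed

lemma sqrt_dsc: "sqrt (real_of_int dsc) = \<bar>real_of_int a * (x - conj_root)\<bar>"
  by (simp add: dsc_eq)

lemma sqrt_dsc_pos: "sqrt (real_of_int dsc) > 0"
  unfolding sqrt_dsc using a0 conj_ne by simp

lemma sqrt_dsc_irrat: "sqrt (real_of_int dsc) \<notin> \<rat>"
proof
  assume "sqrt (real_of_int dsc) \<in> \<rat>"
  then have "real_of_int a * (x - conj_root) \<in> \<rat>"
    unfolding sqrt_dsc by (cases "real_of_int a * (x - conj_root) \<ge> 0") auto
  moreover have "x = (real_of_int a * (x - conj_root) - real_of_int b) / (2 * real_of_int a)"
    using a0 by (simp add: conj_root_def field_simps)
  ultimately show False using irr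
    by (metis Rats_diff Rats_divide Rats_mult Rats_number_of Rats_of_int)
qed

text \<open>The form factors as t^2 a (s/t - x) (s/t - conj_root), and the quality cancels t^2 and
  the factor that vanishes at x. What remains tends to \<open>sqrt dsc\<close> in absolute
  value.\<close>

lemma apx_qf:
  assumes "t > 0" "real_of_int s / real_of_int t \<noteq> x"
  shows "apx x s t * \<bar>real_of_int (qf a b c s t)\<bar> = \<bar>real_of_int a * (real_of_int s / real_of_int t - conj_root)\<bar>"
proof -
  define r where "r = real_of_int s / real_of_int t"
  have s: "real_of_int s = r * real_of_int t" using assms by (simp add: r_def)
  have c: "real_of_int c = - (real_of_int a * x\<^sup>2 + real_of_int b * x)" using root by linarith
  have e: "real_of_int a * (r - conj_root) = real_of_int a * (r + x) + real_of_int b"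
    using a0 by (simp add: conj_root_def field_simps)
  have "real_of_int (qf a b c s t) = (real_of_int t)\<^sup>2 * (r - x) * (real_of_int a * (r - conj_root))"
    unfolding qf_def e by (simp add: s c power2_eq_square algebra_simps)
  then show ?thesis
    using assms unfolding apx_def r_def[symmetric] by (simp add: abs_mult)
qed

lemma eventually_near_dsc:
  assumes "e > 0"
  shows "\<forall>\<^sub>F y in rat_approach x. \<bar>\<bar>real_of_int a * (real_of_int (fst y) / real_of_int (snd y) - conj_root)\<bar>
            - sqrt (real_of_int dsc)\<bar> < e"
  unfolding eventually_rat_approach
proof (intro exI[of _ "e / \<bar>real_of_int a\<bar>"] conjI allI impI)
  show "e / \<bar>real_of_int a\<bar> > 0" using assms a0 by simp
  fix s t :: int
  assume l: "\<bar>real_of_int s / real_of_int t - x\<bar> < e / \<bar>real_of_int a\<bar>"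
  define r where "r = real_of_int s / real_of_int t"
  have "\<bar>\<bar>real_of_int a * (r - conj_root)\<bar> - \<bar>real_of_int a * (x - conj_root)\<bar>\<bar>
      \<le> \<bar>real_of_int a * (r - conj_root) - real_of_int a * (x - conj_root)\<bar>" by linarith
  also have "real_of_int a * (r - conj_root) - real_of_int a * (x - conj_root) = real_of_int a * (r - x)"
    by (simp add: algebra_simps)
  also have "\<bar>real_of_int a * (r - x)\<bar> = \<bar>real_of_int a\<bar> * \<bar>r - x\<bar>" by (simp add: abs_mult)
  also have "\<dots> < e" using l a0 by (simp add: r_def mult.commute pos_less_divide_eq)
  finally show "\<bar>\<bar>real_of_int a * (real_of_int (fst (s, t)) / real_of_int (snd (s, t)) - conj_root)\<bar>
            - sqrt (real_of_int dsc)\<bar> < e" unfolding sqrt_dsc r_def by simp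
qed

lemma eventually_valid: "\<forall>\<^sub>F y in rat_approach x. snd y > 0 \<and> real_of_int (fst y) / real_of_int (snd y) \<noteq> x"
  unfolding eventually_rat_approach by (intro exI[of _ 1]) auto

lemma lam_le_form:
  fixes m :: real
  assumes m: "m > 0" and ev: "\<forall>\<^sub>F y in rat_approach x. m \<le> \<bar>real_of_int (qf a b c (fst y) (snd y))\<bar>"
  shows "lam x \<le> ereal (sqrt (real_of_int dsc) / m)"
proof (rule ereal_le_by_reals)
  fix k l assume "ereal (sqrt (real_of_int dsc) / m) < ereal k" "k < l"
  then have l: "sqrt (real_of_int dsc) / m < l" by simp
  then have e: "l * m - sqrt (real_of_int dsc) > 0" using m by (simp add: field_simps)
  show "lam x \<le> ereal l"
    unfolding lam_alt
  proof (rule Limsup_bounded)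
    show "\<forall>\<^sub>F y in rat_approach x. (case y of (s, t) \<Rightarrow> ereal (apx x s t)) \<le> ereal l"
      using ev eventually_near_dsc[OF e] eventually_valid
    proof eventually_elim
      case (elim y)
      obtain s t where y: "y = (s, t)" by fastforce
      have "apx x s t * m \<le> apx x s t * \<bar>real_of_int (qf a b c s t)\<bar>"
        using elim y by (intro mult_left_mono) (auto simp: apx_def)
      also have "\<dots> = \<bar>real_of_int a * (real_of_int s / real_of_int t - conj_root)\<bar>"
        using elim y by (intro apx_qf) auto
      also have "\<dots> \<le> l * m" using elim y by auto
      finally have "apx x s t \<le> l" using m by simp
      then show ?case by (simp add: y)
    qed
  qed
qed

text \<open>The value is sqrt D / m, where m is the least absolute value that the form takes
  arbitrarily close to x: smaller values eventually disappear, while m itself recurs.\<close>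

lemma sqrt_rat_lam_aux:
  assumes "pirr x"
  shows "sqrt_rat (lam x)"
proof -
  define w where "w = sqrt (real_of_int dsc)"
  have w: "w > 0" using sqrt_dsc_pos w_def by simp
  define Fr where "Fr k \<longleftrightarrow> (\<exists>\<^sub>F y in rat_approach x. nat \<bar>qf a b c (fst y) (snd y)\<bar> = k)" for k
  have fr: "\<exists>\<^sub>F y in rat_approach x. apx x (fst y) (snd y) > 1/2"
  proof (rule ccontr)
    assume "\<not> ?thesis"
    then have "lam x \<le> ereal (1/2)"
      unfolding lam_alt frequently_def by (intro Limsup_bounded) (auto simp: case_prod_unfold not_less)
    with lam_ge_1[OF assms] have "ereal 1 \<le> ereal (1/2)" unfolding one_ereal_def by (rule order_trans)
    then show False by simp
  qed
  \<comment> \<open>Quality above 1/2 and a remaining factor of at most 2 w bound the form by 4 w,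
    so only finitely many values are in play and one of them recurs.\<close>
  define B where "B = nat \<lceil>4 * w\<rceil>"
  have "\<exists>\<^sub>F y in rat_approach x. \<exists>k\<in>{..B}. nat \<bar>qf a b c (fst y) (snd y)\<bar> = k"
    using fr
  proof (rule frequently_rev_mp)
    show "\<forall>\<^sub>F y in rat_approach x. apx x (fst y) (snd y) > 1/2 \<longrightarrow> (\<exists>k\<in>{..B}. nat \<bar>qf a b c (fst y) (snd y)\<bar> = k)"
      using eventually_near_dsc[OF w] eventually_valid
    proof eventually_elim
      case (elim y)
      show ?case
      proof
        assume h: "apx x (fst y) (snd y) > 1/2"
        have "1/2 * \<bar>real_of_int (qf a b c (fst y) (snd y))\<bar> \<le> apx x (fst y) (snd y) * \<bar>real_of_int (qf a b c (fst y) (snd y))\<bar>"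
          using h by (intro mult_right_mono) auto
        also have "\<dots> = \<bar>real_of_int a * (real_of_int (fst y) / real_of_int (snd y) - conj_root)\<bar>"
          using elim by (intro apx_qf) auto
        also have "\<dots> \<le> 2 * w" using elim unfolding w_def by linarith
        finally have "\<bar>real_of_int (qf a b c (fst y) (snd y))\<bar> \<le> 4 * w" by simp
        then have "nat \<bar>qf a b c (fst y) (snd y)\<bar> \<le> B" unfolding B_def by linarith
        then show "\<exists>k\<in>{..B}. nat \<bar>qf a b c (fst y) (snd y)\<bar> = k" by auto
      qed
    qed
  qed
  then have "\<exists>k. Fr k" unfolding Fr_def by (subst (asm) frequently_bex_finite_distrib) auto
  then have Frm: "Fr (LEAST k. Fr k)" by (metis LeastI)
  define m where "m = (LEAST k. Fr k)"
  have least: "\<not> Fr k" if "k < m" for k using that not_less_Least m_def by blast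
  have ev: "\<forall>\<^sub>F y in rat_approach x. real m \<le> \<bar>real_of_int (qf a b c (fst y) (snd y))\<bar>"
  proof -
    have "\<forall>\<^sub>F y in rat_approach x. \<forall>k\<in>{..<m}. nat \<bar>qf a b c (fst y) (snd y)\<bar> \<noteq> k"
      using least unfolding Fr_def frequently_def by (intro eventually_ball_finite) auto
    then show ?thesis
    proof eventually_elim
      case (elim y)
      then have "\<not> nat \<bar>qf a b c (fst y) (snd y)\<bar> < m" by auto
      then show ?case by linarith
    qed
  qed
  \<comment> \<open>A rational zero of the form near x would make the factor
    \<open>a * (s/t - conj_root)\<close> vanish, but near x its absolute value is close to w >
    0.\<close>
  have m0: "m > 0"
  proof (rule ccontr)
    assume "\<not> m > 0"
    with Frm have "\<exists>\<^sub>F y in rat_approach x. nat \<bar>qf a b c (fst y) (snd y)\<bar> = 0"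
      unfolding Fr_def m_def by simp
    from frequently_eventually_frequently[OF this eventually_conj[OF eventually_near_dsc[OF w] eventually_valid]]
    obtain y where y: "qf a b c (fst y) (snd y) = 0" "snd y > 0" "real_of_int (fst y) / real_of_int (snd y) \<noteq> x"
      "\<bar>\<bar>real_of_int a * (real_of_int (fst y) / real_of_int (snd y) - conj_root)\<bar> - sqrt (real_of_int dsc)\<bar> < w"
      by (auto dest!: frequently_ex)
    from apx_qf[OF y(2,3)] y(1)
    have "\<bar>real_of_int a * (real_of_int (fst y) / real_of_int (snd y) - conj_root)\<bar> = 0" by simp
    with y(4) w show False unfolding w_def by linarith
  qed
  have up: "lam x \<le> ereal (w / real m)"
    using lam_le_form[OF _ ev] m0 w_def by simp
  have "\<not> lam x < ereal (w / real m)"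
  proof
    assume "lam x < ereal (w / real m)"
    then obtain k where k: "lam x < ereal k" "k < w / real m"
      by (metis ereal_dense2 less_ereal.simps(1))
    have e: "w - k * real m > 0" using k(2) m0 by (simp add: field_simps)
    have "\<forall>\<^sub>F y in rat_approach x. apx x (fst y) (snd y) < k"
      using Limsup_lessD[OF k(1)[unfolded lam_alt]] by (simp add: case_prod_unfold)
    from frequently_eventually_frequently[OF Frm[unfolded Fr_def, folded m_def]
        eventually_conj[OF this eventually_conj[OF eventually_near_dsc[OF e] eventually_valid]]]
    obtain y where y: "nat \<bar>qf a b c (fst y) (snd y)\<bar> = m" "apx x (fst y) (snd y) < k"
      "snd y > 0" "real_of_int (fst y) / real_of_int (snd y) \<noteq> x"
      "\<bar>\<bar>real_of_int a * (real_of_int (fst y) / real_of_int (snd y) - conj_root)\<bar> - sqrt (real_of_int dsc)\<bar> < w - k * real m"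
      by (auto simp: m_def Fr_def dest!: frequently_ex)
    have q: "\<bar>real_of_int (qf a b c (fst y) (snd y))\<bar> = real m" using y(1) by linarith
    define v where "v = \<bar>real_of_int a * (real_of_int (fst y) / real_of_int (snd y) - conj_root)\<bar>"
    have "v > k * real m" using y(5) unfolding w_def v_def[symmetric] by linarith
    then have "apx x (fst y) (snd y) * real m > k * real m"
      using apx_qf[OF y(3,4)] unfolding q v_def by simp
    then show False using y(2) m0 by simp
  qed
  with up have lam: "lam x = ereal (w / real m)" by simp
  have "sqrt (real_of_int dsc / (real m)\<^sup>2) = w / real m" by (simp add: real_sqrt_divide w_def)
  moreover have "w / real m \<notin> \<rat>"
  proof
    assume "w / real m \<in> \<rat>"
    then have "w / real m * real m \<in> \<rat>" by (intro Rats_mult) auto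
    then show False using m0 sqrt_dsc_irrat by (simp add: w_def)
  qed
  ultimately show ?thesis
    unfolding sqrt_rat_def lam by (intro bexI[of _ "real_of_int dsc / (real m)\<^sup>2"]) auto
qed

end

definition quadratic :: "real \<Rightarrow> bool" where
  "quadratic x \<longleftrightarrow> (\<exists>a b c :: int. (a, b, c) \<noteq> (0, 0, 0) \<and>
     real_of_int a * x\<^sup>2 + real_of_int b * x + real_of_int c = 0)"

lemma quadratic_lead:
  assumes "x \<notin> \<rat>" "(a, b, c) \<noteq> (0, 0, 0)" "real_of_int a * x\<^sup>2 + real_of_int b * x + real_of_int c = 0"
  shows "a \<noteq> 0"
proof
  assume a: "a = 0"
  show False
  proof (cases "b = 0")
    case False
    then have "x = - real_of_int c / real_of_int b" using assms(3) a by (simp add: field_simps)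
    then show False using assms(1) by (metis Rats_divide Rats_minus_iff Rats_of_int)
  qed (use assms a in auto)
qed

lemma sqrt_rat_lam: "pirr x \<Longrightarrow> quadratic x \<Longrightarrow> sqrt_rat (lam x)"
  unfolding quadratic_def using sqrt_rat_lam_aux quadratic_lead by (metis pirr_def)

text \<open>The new coefficients come from substituting the adjugate matrix. This multiplies the
  discriminant by the square of the determinant, so it stays positive and the new form is not
  zero.\<close>

lemma quadratic_mob:
  assumes x: "pirr x" "quadratic x" and det: "p * s - q * r > 0" "p \<ge> 0" "q \<ge> 0" "r \<ge> 0" "s \<ge> 0"
  shows "quadratic (mob p q r s x)"
proof -
  obtain a b c :: int where abc: "(a, b, c) \<noteq> (0, 0, 0)"
    "real_of_int a * x\<^sup>2 + real_of_int b * x + real_of_int c = 0"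
    using x(2) quadratic_def by blast
  have a: "a \<noteq> 0" using quadratic_lead[OF _ abc] x(1) by (simp add: pirr_def)
  have irr: "x \<notin> \<rat>" using x(1) by (simp add: pirr_def)
  note ctx = a irr abc(2)
  have D: "b\<^sup>2 - 4 * a * c > 0"
    using sqrt_dsc_pos[OF ctx] unfolding real_sqrt_gt_0_iff of_int_0_less_iff dsc_def[OF ctx] .
  define A where "A = a * s\<^sup>2 - b * s * r + c * r\<^sup>2"
  define B where "B = - 2 * a * q * s + b * (p * s + q * r) - 2 * c * p * r"
  define C where "C = a * q\<^sup>2 - b * p * q + c * p\<^sup>2"
  have disc: "B\<^sup>2 - 4 * A * C = (p * s - q * r)\<^sup>2 * (b\<^sup>2 - 4 * a * c)"
    unfolding A_def B_def C_def by algebra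
  have "(A, B, C) \<noteq> (0, 0, 0)"
  proof
    assume "(A, B, C) = (0, 0, 0)"
    then have "(p * s - q * r)\<^sup>2 * (b\<^sup>2 - 4 * a * c) = 0" using disc by auto
    then show False using D det(1) by auto
  qed
  moreover have "real_of_int A * (mob p q r s x)\<^sup>2 + real_of_int B * mob p q r s x + real_of_int C = 0"
  proof -
    define P Q R S where "P = real_of_int p" "Q = real_of_int q" "R = real_of_int r" "S = real_of_int s"
    define w where "w = R * x + S"
    have "R \<noteq> 0 \<or> S \<noteq> 0" using det P_Q_R_S_def by auto
    moreover have "R \<ge> 0" "S \<ge> 0" "x > 0" using det x(1) P_Q_R_S_def by (auto simp: pirr_def)
    ultimately have w: "w > 0" unfolding w_def
      by (metis add_nonneg_pos add_pos_nonneg mult_nonneg_nonneg mult_pos_pos order_le_less)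
    have m: "mob p q r s x = (P * x + Q) / w" by (simp add: mob_def P_Q_R_S_def w_def)
    have "real_of_int A * (P * x + Q)\<^sup>2 + real_of_int B * (P * x + Q) * w + real_of_int C * w\<^sup>2
        = (P * S - Q * R)\<^sup>2 * (real_of_int a * x\<^sup>2 + real_of_int b * x + real_of_int c)"
      unfolding A_def B_def C_def w_def P_Q_R_S_def by (simp add: power2_eq_square algebra_simps)
    then have z: "real_of_int A * (P * x + Q)\<^sup>2 + real_of_int B * (P * x + Q) * w + real_of_int C * w\<^sup>2 = 0"
      using abc(2) by simp
    have "real_of_int A * ((P * x + Q) / w)\<^sup>2 + real_of_int B * ((P * x + Q) / w) + real_of_int C
       = (real_of_int A * (P * x + Q)\<^sup>2 + real_of_int B * (P * x + Q) * w + real_of_int C * w\<^sup>2) / w\<^sup>2"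
      using w by (simp add: field_simps power2_eq_square)
    then show ?thesis unfolding m z by simp
  qed
  ultimately show ?thesis unfolding quadratic_def by blast
qed

text \<open>A nonempty word acts by a matrix other than the identity, so its fixed points are quadratic.\<close>

primrec wmat :: "bool list \<Rightarrow> int \<times> int \<times> int \<times> int" where
  "wmat [] = (1, 0, 0, 1)"
| "wmat (l # w) = (case wmat w of (a, b, c, d) \<Rightarrow> if l then (a + c, b + d, c, d) else (a, b, a + c, b + d))"

lemma wmat:
  assumes "wmat w = (a, b, c, d)"
  shows "a \<ge> 0" "b \<ge> 0" "c \<ge> 0" "d \<ge> 0" "a * d - b * c = 1" "w \<noteq> [] \<Longrightarrow> b + c \<ge> 1"
    "x > 0 \<Longrightarrow> app w x = mob a b c d x"
proof -
  have "\<forall>a b c d. wmat w = (a, b, c, d) \<longrightarrow> a \<ge> 1 \<and> b \<ge> 0 \<and> c \<ge> 0 \<and> d \<ge> 1 \<and> a * d - b * c = 1 \<and>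
     (w \<noteq> [] \<longrightarrow> b + c \<ge> 1) \<and> (\<forall>x>0. app w x = mob a b c d x)"
  proof (induction w)
    case Nil then show ?case by (simp add: mob_def)
  next
    case (Cons l w)
    obtain a b c d where p: "wmat w = (a, b, c, d)" by (metis prod_cases4)
    with Cons have IH: "a \<ge> 1" "b \<ge> 0" "c \<ge> 0" "d \<ge> 1" "a * d - b * c = 1" "\<forall>x>0. app w x = mob a b c d x" by auto
    have "app (l # w) x = (if l then mob (a + c) (b + d) c d x else mob a b (a + c) (b + d) x)" if x: "x > 0" for x
    proof -
      have "real_of_int a * x > 0" "real_of_int c * x \<ge> 0" "real_of_int b \<ge> 0" "real_of_int d > 0" using IH x by auto
      then have pos: "real_of_int c * x + real_of_int d > 0" "real_of_int a * x + real_of_int b > 0" by linarith+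
      have 1: "1 + u / v = (u + v) / v" "u / v / (1 + u / v) = u / (u + v)" if "u > 0" "v > 0" for u v :: real
        using that by (simp_all add: field_simps)
      show ?thesis using IH(6) x 1[OF pos(2) pos(1)]
        by (auto simp: mob_def algebra_simps)
    qed
    then show ?case using IH p by (auto simp: algebra_simps)
  qed
  then show "a \<ge> 0" "b \<ge> 0" "c \<ge> 0" "d \<ge> 0" "a * d - b * c = 1" "w \<noteq> [] \<Longrightarrow> b + c \<ge> 1"
    "x > 0 \<Longrightarrow> app w x = mob a b c d x" using assms by fastforce+
qed

lemma quadratic_fixed:
  assumes "x > 0" "w \<noteq> []" "app w x = x"
  shows "quadratic x"
proof -
  obtain a b c d where p: "wmat w = (a, b, c, d)" by (metis prod_cases4)
  note m = wmat[OF p]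
  have eq: "mob a b c d x = x" using m(7)[OF assms(1)] assms(3) by simp
  have "c \<noteq> 0 \<or> d \<noteq> 0" using m by auto
  then have "real_of_int c * x + real_of_int d > 0" using m(3,4) assms(1)
    by (metis add_nonneg_pos add_pos_nonneg mult_nonneg_nonneg mult_pos_pos of_int_0_le_iff of_int_0_less_iff order_le_less)
  then have "real_of_int c * x\<^sup>2 + real_of_int (d - a) * x + real_of_int (- b) = 0"
    using eq by (simp add: mob_def field_simps power2_eq_square)
  moreover have "(c, d - a, - b) \<noteq> (0, 0, 0)" using m(6)[OF assms(2)] by auto
  ultimately show ?thesis unfolding quadratic_def by blast
qed

section \<open>Automata for the admissible words\<close>

text \<open>State \<open>0\<close> is dead and state \<open>i \<ge> 2\<close> is entry \<open>i - 2\<close> of the list: a label and the targets for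
  \<^term>\<open>True\<close> and \<^term>\<open>False\<close>. The label encodes, in binary after a leading 1, a suffix of the word read so far.\<close>

type_synonym autom = "(nat \<times> nat \<times> nat) list"

definition nxL :: "autom \<Rightarrow> nat \<Rightarrow> nat" where "nxL au i = fst (snd (au ! (i - 2)))"
definition nxR :: "autom \<Rightarrow> nat \<Rightarrow> nat" where "nxR au i = snd (snd (au ! (i - 2)))"

primrec bits :: "num \<Rightarrow> bool list" where
  "bits num.One = []"
| "bits (num.Bit0 n) = bits n @ [False]"
| "bits (num.Bit1 n) = bits n @ [True]"

definition lab :: "nat \<Rightarrow> bool list" where "lab n = bits (num_of_nat n)"

primrec appq :: "bool list \<Rightarrow> int \<times> int \<Rightarrow> int \<times> int" where
  "appq [] q = q"
| "appq (l # w) q = (case appq w q of (m, n) \<Rightarrow> if l then (m + n, n) else (m, m + n))"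

definition winq :: "int \<Rightarrow> int \<Rightarrow> bool list \<Rightarrow> bool" where
  "winq cn cd w = list_ex (\<lambda>i. let u = rev (take i w); v = drop i w in
     (case appq u (1, 4) of (m, n) \<Rightarrow> case appq v (1, 4) of (m', n') \<Rightarrow> cn * (n * n') \<le> cd * (m * n' + m' * n)) \<or>
     (case appq u (4, 1) of (m, n) \<Rightarrow> case appq v (4, 1) of (m', n') \<Rightarrow> cn * (m * m') \<le> cd * (m' * n + m * n')))
     [0..<Suc (length w)]"

text \<open>Look-ahead: a word that does not win itself is still impossible if each of its
  continuations wins within n further letters.\<close>

primrec forbid :: "int \<Rightarrow> int \<Rightarrow> nat \<Rightarrow> bool list \<Rightarrow> bool" where
  "forbid cn cd 0 w = winq cn cd w"
| "forbid cn cd (Suc n) w = (if winq cn cd w then True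
     else if forbid cn cd n (w @ [True]) then forbid cn cd n (w @ [False]) else False)"

text \<open>A transition may forget the beginning of what was read, so any list that passes
  describes a superset of the admissible expansions. The 8 is the look-ahead granted to a transition
  that is declared dead.\<close>

definition trans_ok :: "int \<Rightarrow> int \<Rightarrow> autom \<Rightarrow> bool list \<Rightarrow> nat \<Rightarrow> bool" where
  "trans_ok cn cd au w t = (if t = 0 then forbid cn cd 8 w
     else 2 \<le> t \<and> t - 2 < length au \<and>
       (let v = lab (fst (au ! (t - 2))) in length v \<le> length w \<and> drop (length w - length v) w = v))"

definition aut_ok :: "int \<Rightarrow> int \<Rightarrow> autom \<Rightarrow> bool" where
  "aut_ok cn cd au \<longleftrightarrow> cd > 0 \<and> au \<noteq> [] \<and> fst (hd au) = 1 \<and>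
     list_all (\<lambda>(n, l, r). trans_ok cn cd au (lab n @ [True]) l \<and> trans_ok cn cd au (lab n @ [False]) r) au"

lemma appq:
  assumes "m > 0" "n > 0" "appq w (m, n) = (m', n')"
  shows "m' > 0 \<and> n' > 0 \<and> app w (real_of_int m / real_of_int n) = real_of_int m' / real_of_int n'"
  using assms(3)
proof (induction w arbitrary: m' n')
  case Nil then show ?case using assms by simp
next
  case (Cons l w)
  obtain u v where uv: "appq w (m, n) = (u, v)" by fastforce
  with Cons.IH have IH: "u > 0" "v > 0" "app w (real_of_int m / real_of_int n) = real_of_int u / real_of_int v" by auto
  show ?case using Cons.prems IH(1,2) uv by (cases l) (auto simp: IH(3) field_simps)
qed

lemma winq_win:
  assumes "cd > 0" "winq cn cd w"
  shows "win (real_of_int cn / real_of_int cd) w"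
proof -
  obtain i where i0: "i \<in> set [0..<Suc (length w)]" and h:
     "(case appq (rev (take i w)) (1, 4) of (m, n) \<Rightarrow> case appq (drop i w) (1, 4) of (m', n') \<Rightarrow> cn * (n * n') \<le> cd * (m * n' + m' * n)) \<or>
     (case appq (rev (take i w)) (4, 1) of (m, n) \<Rightarrow> case appq (drop i w) (4, 1) of (m', n') \<Rightarrow> cn * (m * m') \<le> cd * (m' * n + m * n'))"
    using assms(2) unfolding winq_def list_ex_iff Let_def by (elim bexE)
  have i: "i < Suc (length w)" using i0 by (simp only: set_upt atLeastLessThan_iff)
  obtain m1 n1 m2 n2 m3 n3 m4 n4 where q: "appq (rev (take i w)) (1, 4) = (m1, n1)" "appq (drop i w) (1, 4) = (m2, n2)"
    "appq (rev (take i w)) (4, 1) = (m3, n3)" "appq (drop i w) (4, 1) = (m4, n4)" by fastforce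
  note a1 = appq[OF _ _ q(1)] and a2 = appq[OF _ _ q(2)] and a3 = appq[OF _ _ q(3)] and a4 = appq[OF _ _ q(4)]
  from h have "cn * (n1 * n2) \<le> cd * (m1 * n2 + m2 * n1) \<or> cn * (m3 * m4) \<le> cd * (m4 * n3 + m3 * n4)"
    by (simp add: q)
  then have "real_of_int cn / real_of_int cd \<le> real_of_int m1 / real_of_int n1 + real_of_int m2 / real_of_int n2 \<or>
     real_of_int cn / real_of_int cd \<le> 1 / (real_of_int m3 / real_of_int n3) + 1 / (real_of_int m4 / real_of_int n4)"
  proof
    assume "cn * (n1 * n2) \<le> cd * (m1 * n2 + m2 * n1)"
    then have "real_of_int cn * (real_of_int n1 * real_of_int n2) \<le> real_of_int cd * (real_of_int m1 * real_of_int n2 + real_of_int m2 * real_of_int n1)"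
      by (metis of_int_add of_int_le_iff of_int_mult)
    then show ?thesis using a1 a2 assms(1) by (intro disjI1) (simp add: field_simps)
  next
    assume "cn * (m3 * m4) \<le> cd * (m4 * n3 + m3 * n4)"
    then have "real_of_int cn * (real_of_int m3 * real_of_int m4) \<le> real_of_int cd * (real_of_int m4 * real_of_int n3 + real_of_int m3 * real_of_int n4)"
      by (metis of_int_add of_int_le_iff of_int_mult)
    then show ?thesis using a3 a4 assms(1) by (intro disjI2) (simp add: field_simps)
  qed
  then show ?thesis unfolding win_def using i a1 a2 a3 a4 by (intro exI[of _ i]) auto
qed

lemma forbid_adm:
  assumes "cd > 0" "x \<in> adm (real_of_int cn / real_of_int cd)"
  shows "forbid cn cd d w \<Longrightarrow> lets x n (length w) \<noteq> w"
proof (induction d arbitrary: w)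
  case 0
  then have "win (real_of_int cn / real_of_int cd) w" using winq_win[OF assms(1)] by simp
  then show ?case using assms(2) unfolding adm_def by auto metis
next
  case (Suc d)
  show ?case
  proof (cases "winq cn cd w")
    case True
    then have "win (real_of_int cn / real_of_int cd) w" using winq_win[OF assms(1)] by simp
    then show ?thesis using assms(2) unfolding adm_def by auto metis
  next
    case False
    then have "forbid cn cd d (w @ [True])" "forbid cn cd d (w @ [False])" using Suc.prems by (auto split: if_splits)
    from Suc.IH[OF this(1)] Suc.IH[OF this(2)]
    have "lets x n (Suc (length w)) \<noteq> w @ [b]" for b by (cases b) auto
    then show ?thesis using lets_Suc[of x n "length w"] by auto
  qed
qed

definition dl :: "autom \<Rightarrow> bool \<Rightarrow> nat \<Rightarrow> nat" where
  "dl au b i = (if b then nxL au i else nxR au i)"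

coinductive alive :: "autom \<Rightarrow> nat \<Rightarrow> real \<Rightarrow> bool" for au where
  "dl au (x > 1) i \<noteq> 0 \<Longrightarrow> alive au (dl au (x > 1) i) (nx x) \<Longrightarrow> alive au i x"

lemma aliveD: "alive au i x \<Longrightarrow> dl au (x > 1) i \<noteq> 0 \<and> alive au (dl au (x > 1) i) (nx x)"
  by (erule alive.cases) auto

text \<open>Coinduction with the invariant that the label of the current state is the block of
  letters just read. State 2 carries the empty label, so the invariant holds at the start.\<close>

lemma alive_adm:
  assumes ok: "aut_ok cn cd au" and x: "x \<in> adm (real_of_int cn / real_of_int cd)"
  shows "alive au 2 x"
proof -
  define St where "St i y \<longleftrightarrow> (\<exists>n. y = (nx ^^ n) x \<and> 2 \<le> i \<and> i - 2 < length au \<and>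
     (let w = lab (fst (au ! (i - 2))) in length w \<le> n \<and> lets x (n - length w) (length w) = w))" for i y
  have cd: "cd > 0" using ok by (simp add: aut_ok_def)
  have "lab 1 = []" by (simp add: lab_def num_of_nat.simps)
  then have "St 2 x" using ok unfolding St_def aut_ok_def by (intro exI[of _ 0]) (auto simp: hd_conv_nth lets_def)
  moreover have "dl au (y > 1) i \<noteq> 0 \<and> St (dl au (y > 1) i) (nx y)" if S: "St i y" for i y
  proof -
    define w where "w = lab (fst (au ! (i - 2)))"
    obtain n where n: "y = (nx ^^ n) x" "2 \<le> i" "i - 2 < length au" "length w \<le> n"
      "lets x (n - length w) (length w) = w"
      using S unfolding St_def Let_def w_def by blast
    define b where "b = (y > 1)"
    define t where "t = dl au b i"
    obtain m l r where e: "au ! (i - 2) = (m, l, r)" by (metis prod_cases3)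
    have "(m, l, r) \<in> set au" using n(3) e nth_mem by metis
    then have "trans_ok cn cd au (lab m @ [True]) l \<and> trans_ok cn cd au (lab m @ [False]) r"
      using ok unfolding aut_ok_def list_all_iff by auto
    then have tr: "trans_ok cn cd au (w @ [b]) t"
      unfolding t_def dl_def nxL_def nxR_def w_def e by (cases b) auto
    have wb: "lets x (n - length w) (Suc (length w)) = w @ [b]"
      using n by (simp add: lets_Suc b_def)
    have t0: "t \<noteq> 0"
    proof
      assume "t = 0"
      then have "forbid cn cd 8 (w @ [b])" using tr by (simp add: trans_ok_def)
      from forbid_adm[OF cd x this, of "n - length w"] wb show False by simp
    qed
    define v where "v = lab (fst (au ! (t - 2)))"
    have v: "2 \<le> t" "t - 2 < length au" "length v \<le> Suc (length w)" "drop (Suc (length w) - length v) (w @ [b]) = v"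
      using tr t0 unfolding trans_ok_def v_def Let_def by auto
    have "lets x (n - length w) (Suc (length w)) = lets x (n - length w) (Suc (length w) - length v)
        @ lets x (n - length w + (Suc (length w) - length v)) (length v)"
      using v(3) lets_add[of x "n - length w" "Suc (length w) - length v" "length v"] by simp
    then have "lets x (n - length w + (Suc (length w) - length v)) (length v) = drop (Suc (length w) - length v) (w @ [b])"
      unfolding wb by simp
    moreover have "n - length w + (Suc (length w) - length v) = Suc n - length v" using n(4) v(3) by simp
    ultimately have "lets x (Suc n - length v) (length v) = v" using v(4) by simp
    moreover have "length v \<le> Suc n" using v(3) n(4) by simp
    moreover have "nx y = (nx ^^ Suc n) x" using n(1) by simp
    ultimately have "St t (nx y)" using v(1,2) unfolding St_def Let_def v_def by blast
    then show ?thesis using t0 unfolding t_def b_def by simp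
  qed
  ultimately show ?thesis by (intro alive.coinduct[of St]) blast+
qed

section \<open>The transducer for multiplication by \<open>p\<close>\<close>

text \<open>A configuration is a nonnegative matrix with two automaton states: if \<open>x\<close> is a tail of
  \<open>\<xi>\<close>, its image under the matrix is the corresponding tail of \<open>p \<xi>\<close>. Letters of \<open>x\<close> are guessed and act
  on the right; a letter of the image is read off as soon as it is determined, and acts on the left.\<close>

lemma mob_pos:
  assumes "a * d - b * c > 0" "a \<ge> 0" "b \<ge> 0" "c \<ge> 0" "d \<ge> 0" "x > 0"
  shows "real_of_int c * x + real_of_int d > 0" "real_of_int a * x + real_of_int b > 0"
proof -
  have "c \<noteq> 0 \<or> d \<noteq> 0" "a \<noteq> 0 \<or> b \<noteq> 0" using assms by auto
  then have "c > 0 \<or> d > 0" "a > 0 \<or> b > 0" using assms by auto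
  then have "real_of_int c * x > 0 \<or> real_of_int d > 0" "real_of_int a * x > 0 \<or> real_of_int b > 0"
    using assms(6) by auto
  moreover have "real_of_int c * x \<ge> 0" "real_of_int a * x \<ge> 0" "real_of_int b \<ge> 0" "real_of_int d \<ge> 0"
    using assms by auto
  ultimately show "real_of_int c * x + real_of_int d > 0" "real_of_int a * x + real_of_int b > 0"
    by linarith+
qed

lemma mob_gt:
  assumes "a * d - b * c > 0" "b \<ge> 0" "c \<ge> 0" "c < a" "d \<le> b" "d \<ge> 0" "x > 0"
  shows "mob a b c d x > 1" "nx (mob a b c d x) = mob (a - c) (b - d) c d x"
proof -
  have p: "real_of_int c * x + real_of_int d > 0" using mob_pos[of a d b c x] assms by simp
  have "real_of_int c * x < real_of_int a * x" "real_of_int d \<le> real_of_int b" using assms by auto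
  then show g: "mob a b c d x > 1" unfolding mob_def using p by (simp add: less_divide_eq)
  then show "nx (mob a b c d x) = mob (a - c) (b - d) c d x"
    unfolding nx_def mob_def using p by (simp add: field_simps)
qed

text \<open>The comparison \<open>a \<le> c\<close> of the first column decides alone: a positive
  determinant then forces \<open>b < d\<close>, so the lower row dominates and the output letter is
  \<open>False\<close>.\<close>

lemma mob_lt:
  assumes "a * d - b * c > 0" "a \<ge> 0" "b \<ge> 0" "a \<le> c" "d \<ge> 0" "x > 0"
  shows "mob a b c d x < 1" "nx (mob a b c d x) = mob a b (c - a) (d - b) x" "b < d"
proof -
  have p: "real_of_int c * x + real_of_int d > 0" using mob_pos[of a d b c x] assms by simp
  have "b * a \<le> b * c" using assms by (intro mult_left_mono) auto
  then have "a * (d - b) > 0" using assms by (simp add: algebra_simps)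
  then show bd: "b < d" using assms by (simp add: zero_less_mult_iff)
  then have lt: "real_of_int a * x + real_of_int b < real_of_int c * x + real_of_int d"
    using assms by (intro add_le_less_mono mult_right_mono) auto
  then show l: "mob a b c d x < 1" unfolding mob_def using p by simp
  have "1 - u / v = (v - u) / v" "u / v / ((v - u) / v) = u / (v - u)" if "v > 0" for u v :: real
    using that by (simp_all add: field_simps)
  note * = this[OF p, of "real_of_int a * x + real_of_int b"]
  show "nx (mob a b c d x) = mob a b (c - a) (d - b) x"
    using l unfolding nx_def mob_def * by (simp add: algebra_simps)
qed

text \<open>Raney's doubly balanced matrices: no row dominates the other, so no output letter is
  determined, and no column dominates the other, so no input letter can be split off again. There
  are finitely many for each determinant.\<close>

definition DB :: "int \<Rightarrow> int \<Rightarrow> int \<Rightarrow> int \<Rightarrow> int \<Rightarrow> bool" where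
  "DB p a b c d \<longleftrightarrow> 0 \<le> b \<and> 0 \<le> c \<and> b < a \<and> c < a \<and> b < d \<and> c < d \<and> a * d - b * c = p"

type_synonym zpred = "int \<Rightarrow> int \<Rightarrow> int \<Rightarrow> int \<Rightarrow> nat \<Rightarrow> nat \<Rightarrow> bool"

definition stp :: "zpred \<Rightarrow> int \<Rightarrow> int \<Rightarrow> int \<Rightarrow> int \<Rightarrow> int \<Rightarrow> nat \<Rightarrow> nat \<Rightarrow> bool" where
  "stp z fn a b c d i j = (if b < a then if c < d then if a < fn then if d < fn then True
     else z a b c d i j else z a b c d i j else False else False)"

text \<open>Depth-first search: a branch ends at a dead state, at a doubly balanced matrix smaller than
  \<open>fn\<close>, or at a configuration satisfying \<open>z\<close>.\<close>

inductive em :: "autom \<Rightarrow> int \<Rightarrow> zpred \<Rightarrow> int \<Rightarrow> int \<Rightarrow> int \<Rightarrow> int \<Rightarrow> nat \<Rightarrow> nat \<Rightarrow> bool"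
  for au fn z where
  em_outL: "c < a \<Longrightarrow> d \<le> b \<Longrightarrow> nxL au j \<noteq> 0 \<longrightarrow> em au fn z (a - c) (b - d) c d i (nxL au j) \<Longrightarrow> em au fn z a b c d i j"
| em_outR: "a \<le> c \<Longrightarrow> nxR au j \<noteq> 0 \<longrightarrow> em au fn z a b (c - a) (d - b) i (nxR au j) \<Longrightarrow> em au fn z a b c d i j"
| em_stop: "c < a \<Longrightarrow> b < d \<Longrightarrow> stp z fn a b c d i j \<Longrightarrow> em au fn z a b c d i j"
| em_in: "c < a \<Longrightarrow> b < d \<Longrightarrow> nxL au i \<noteq> 0 \<longrightarrow> em au fn z a (a + b) c (c + d) (nxL au i) j \<Longrightarrow>
     nxR au i \<noteq> 0 \<longrightarrow> em au fn z (a + b) b (c + d) d (nxR au i) j \<Longrightarrow> em au fn z a b c d i j"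

text \<open>The rules as one equation. Nested conditionals take the place of connectives so that
  rewriting evaluates a branch only when it is reached.\<close>

lemma em_eq:
  "em au fn z a b c d i j = (if c < a then
      if d \<le> b then if nxL au j = 0 then True else em au fn z (a - c) (b - d) c d i (nxL au j)
      else if stp z fn a b c d i j then True
      else if (if nxL au i = 0 then True else em au fn z a (a + b) c (c + d) (nxL au i) j)
        then if nxR au i = 0 then True else em au fn z (a + b) b (c + d) d (nxR au i) j
      else False
    else if nxR au j = 0 then True else em au fn z a b (c - a) (d - b) i (nxR au j))"
  by (subst em.simps) auto

text \<open>In the application \<open>P x y\<close> says that the pair of values lies in a given
  set; S1 and S2 then express that stripping letters changes neither value. Induction over the
  finite search tree follows the branch selected by the letters of x and of its image.\<close>

lemma em_sound:
  assumes p: "p > 0"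
    and S1: "\<And>x y. pirr x \<Longrightarrow> P (nx x) y \<Longrightarrow> P x y"
    and S2: "\<And>x y. pirr y \<Longrightarrow> P x (nx y) \<Longrightarrow> P x y"
    and Z: "\<And>a b c d i j x. z a b c d i j \<Longrightarrow> DB p a b c d \<Longrightarrow> x \<in> adm k \<Longrightarrow> mob a b c d x \<in> adm k \<Longrightarrow>
       alive au i x \<Longrightarrow> alive au j (mob a b c d x) \<Longrightarrow> P x (mob a b c d x)"
    and D: "\<And>a b c d x. DB p a b c d \<Longrightarrow> a < fn \<Longrightarrow> d < fn \<Longrightarrow> x \<in> adm k \<Longrightarrow> mob a b c d x \<in> adm k \<Longrightarrow>
       P x (mob a b c d x)"
  shows "em au fn z a b c d i j \<Longrightarrow> a * d - b * c = p \<Longrightarrow> a \<ge> 0 \<Longrightarrow> b \<ge> 0 \<Longrightarrow> c \<ge> 0 \<Longrightarrow> d \<ge> 0 \<Longrightarrow>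
    x \<in> adm k \<Longrightarrow> mob a b c d x \<in> adm k \<Longrightarrow> alive au i x \<Longrightarrow> alive au j (mob a b c d x) \<Longrightarrow> P x (mob a b c d x)"
proof (induction a b c d i j arbitrary: x rule: em.induct)
  case (em_outL c a d b j i)
  have x: "x > 0" using em_outL.prems adm_pirr pirr_def by blast
  have det: "a * d - b * c > 0" using em_outL.prems p by simp
  note m = mob_gt[OF det em_outL.prems(3,4) em_outL.hyps(1,2) em_outL.prems(5) x]
  have al: "nxL au j \<noteq> 0" "alive au (nxL au j) (mob (a - c) (b - d) c d x)"
    using aliveD[OF em_outL.prems(9)] m by (auto simp: dl_def)
  have "P x (mob (a - c) (b - d) c d x)"
  proof (rule em_outL.IH[rule_format, THEN conjunct2, rule_format])
  qed (use em_outL.prems em_outL.hyps al adm_nx[OF em_outL.prems(7)] m in \<open>auto simp: algebra_simps\<close>)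
  then show ?case using S2[of "mob a b c d x" x] m em_outL.prems(7) adm_pirr by simp
next
  case (em_outR a c j b d i)
  have x: "x > 0" using em_outR.prems adm_pirr pirr_def by blast
  have det: "a * d - b * c > 0" using em_outR.prems p by simp
  note m = mob_lt[OF det em_outR.prems(2,3) em_outR.hyps(1) em_outR.prems(5) x]
  have al: "nxR au j \<noteq> 0" "alive au (nxR au j) (mob a b (c - a) (d - b) x)"
    using aliveD[OF em_outR.prems(9)] m by (auto simp: dl_def)
  have "P x (mob a b (c - a) (d - b) x)"
  proof (rule em_outR.IH[rule_format, THEN conjunct2, rule_format])
  qed (use em_outR.prems em_outR.hyps al adm_nx[OF em_outR.prems(7)] m in \<open>auto simp: algebra_simps\<close>)
  then show ?case using S2[of "mob a b c d x" x] m em_outR.prems(7) adm_pirr by simp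
next
  case (em_stop c a b d i j)
  then have "DB p a b c d" "z a b c d i j \<or> a < fn \<and> d < fn"
    by (auto simp: DB_def stp_def split: if_splits)
  then show ?case using Z D em_stop.prems by blast
next
  case (em_in c a b d i j)
  have x: "pirr x" using em_in.prems adm_pirr by blast
  note al = aliveD[OF em_in.prems(8)]
  show ?case
  proof (cases "x > 1")
    case True
    have m: "mob a (a + b) c (c + d) (nx x) = mob a b c d x" using mob_True[OF True] .
    have "P (nx x) (mob a (a + b) c (c + d) (nx x))"
    proof (rule em_in.IH(1)[rule_format, THEN conjunct2, rule_format])
    qed (use em_in.prems al True adm_nx[OF em_in.prems(6)] m in \<open>auto simp: dl_def algebra_simps\<close>)
    then show ?thesis using S1[OF x] m by simp
  next
    case False
    have m: "mob (a + b) b (c + d) d (nx x) = mob a b c d x" using mob_False[OF x False] .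
    have "P (nx x) (mob (a + b) b (c + d) d (nx x))"
    proof (rule em_in.IH(2)[rule_format, THEN conjunct2, rule_format])
    qed (use em_in.prems al False adm_nx[OF em_in.prems(6)] m in \<open>auto simp: dl_def algebra_simps\<close>)
    then show ?thesis using S1[OF x] m by simp
  qed
qed

section \<open>Isolated closed orbits\<close>

text \<open>The configuration reads the prescribed word and returns to \<open>cfg\<close>; every deviation from the word
  dies or reaches a configuration satisfying \<open>z\<close>.\<close>

type_synonym config = "int \<times> int \<times> int \<times> int \<times> nat \<times> nat"

definition here :: "config \<Rightarrow> int \<Rightarrow> int \<Rightarrow> int \<Rightarrow> int \<Rightarrow> nat \<Rightarrow> nat \<Rightarrow> bool" where
  "here cfg a b c d i j \<longleftrightarrow> cfg = (a, b, c, d, i, j)"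

inductive wk :: "autom \<Rightarrow> zpred \<Rightarrow> config \<Rightarrow> bool list \<Rightarrow> int \<Rightarrow> int \<Rightarrow> int \<Rightarrow> int \<Rightarrow> nat \<Rightarrow> nat \<Rightarrow> bool"
  for au z cfg where
  wk_outL: "c < a \<Longrightarrow> d \<le> b \<Longrightarrow> wk au z cfg w (a - c) (b - d) c d i (nxL au j) \<Longrightarrow> wk au z cfg w a b c d i j"
| wk_outR: "a \<le> c \<Longrightarrow> wk au z cfg w a b (c - a) (d - b) i (nxR au j) \<Longrightarrow> wk au z cfg w a b c d i j"
| wk_end: "c < a \<Longrightarrow> b < d \<Longrightarrow> here cfg a b c d i j \<Longrightarrow> wk au z cfg [] a b c d i j"
| wk_T: "c < a \<Longrightarrow> b < d \<Longrightarrow> nxR au i \<noteq> 0 \<longrightarrow> em au 0 z (a + b) b (c + d) d (nxR au i) j \<Longrightarrow>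
     wk au z cfg w a (a + b) c (c + d) (nxL au i) j \<Longrightarrow> wk au z cfg (True # w) a b c d i j"
| wk_F: "c < a \<Longrightarrow> b < d \<Longrightarrow> nxL au i \<noteq> 0 \<longrightarrow> em au 0 z a (a + b) c (c + d) (nxL au i) j \<Longrightarrow>
     wk au z cfg w (a + b) b (c + d) d (nxR au i) j \<Longrightarrow> wk au z cfg (False # w) a b c d i j"

lemma wk_eq:
  "wk au z cfg [] a b c d i j = (if c < a then
      if d \<le> b then wk au z cfg [] (a - c) (b - d) c d i (nxL au j)
      else here cfg a b c d i j
    else wk au z cfg [] a b (c - a) (d - b) i (nxR au j))"
  "wk au z cfg (True # w) a b c d i j = (if c < a then
      if d \<le> b then wk au z cfg (True # w) (a - c) (b - d) c d i (nxL au j)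
      else if (if nxR au i = 0 then True else em au 0 z (a + b) b (c + d) d (nxR au i) j)
        then wk au z cfg w a (a + b) c (c + d) (nxL au i) j else False
    else wk au z cfg (True # w) a b (c - a) (d - b) i (nxR au j))"
  "wk au z cfg (False # w) a b c d i j = (if c < a then
      if d \<le> b then wk au z cfg (False # w) (a - c) (b - d) c d i (nxL au j)
      else if (if nxL au i = 0 then True else em au 0 z a (a + b) c (c + d) (nxL au i) j)
        then wk au z cfg w (a + b) b (c + d) d (nxR au i) j else False
    else wk au z cfg (False # w) a b (c - a) (d - b) i (nxR au j))"
  by (subst wk.simps, simp add: not_less not_le)
     (subst wk.simps, force simp: not_less not_le)+

definition at_cfg :: "autom \<Rightarrow> real \<Rightarrow> config \<Rightarrow> real \<Rightarrow> bool" where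
  "at_cfg au k cfg x = (case cfg of (a, b, c, d, i, j) \<Rightarrow>
     x \<in> adm k \<and> mob a b c d x \<in> adm k \<and> alive au i x \<and> alive au j (mob a b c d x))"

definition img :: "config \<Rightarrow> real \<Rightarrow> real" where
  "img cfg x = (case cfg of (a, b, c, d, i, j) \<Rightarrow> mob a b c d x)"

text \<open>Either x deviates from w and the search started at the deviation settles P, or it
  completes a period. In the latter case P is carried back from the return point, so a failure of P
  at x persists at the return and can be followed for another period.\<close>

lemma wk_sound:
  assumes p: "p > 0"
    and S1: "\<And>x y. pirr x \<Longrightarrow> P (nx x) y \<Longrightarrow> P x y"
    and S2: "\<And>x y. pirr y \<Longrightarrow> P x (nx y) \<Longrightarrow> P x y"
    and Z: "\<And>a b c d i j x. z a b c d i j \<Longrightarrow> DB p a b c d \<Longrightarrow> x \<in> adm k \<Longrightarrow> mob a b c d x \<in> adm k \<Longrightarrow>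
       alive au i x \<Longrightarrow> alive au j (mob a b c d x) \<Longrightarrow> P x (mob a b c d x)"
  shows "wk au z cfg w a b c d i j \<Longrightarrow> a * d - b * c = p \<Longrightarrow> a \<ge> 0 \<Longrightarrow> b \<ge> 0 \<Longrightarrow> c \<ge> 0 \<Longrightarrow> d \<ge> 0 \<Longrightarrow>
    x \<in> adm k \<Longrightarrow> mob a b c d x \<in> adm k \<Longrightarrow> alive au i x \<Longrightarrow> alive au j (mob a b c d x) \<Longrightarrow>
    P x (mob a b c d x) \<or> (lets x 0 (length w) = w \<and> at_cfg au k cfg ((nx ^^ length w) x) \<and>
      (P ((nx ^^ length w) x) (img cfg ((nx ^^ length w) x)) \<longrightarrow> P x (mob a b c d x)))"
proof (induction w a b c d i j arbitrary: x rule: wk.induct)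
  case (wk_outL c a d b w i j)
  have x: "x > 0" using wk_outL.prems adm_pirr pirr_def by blast
  have det: "a * d - b * c > 0" using wk_outL.prems p by simp
  note m = mob_gt[OF det wk_outL.prems(3,4) wk_outL.hyps(1,2) wk_outL.prems(5) x]
  have al: "alive au (nxL au j) (mob (a - c) (b - d) c d x)"
    using aliveD[OF wk_outL.prems(9)] m by (auto simp: dl_def)
  have s: "P x (mob (a - c) (b - d) c d x) \<Longrightarrow> P x (mob a b c d x)"
    using S2[of "mob a b c d x" x] m wk_outL.prems(7) adm_pirr by simp
  have "P x (mob (a - c) (b - d) c d x) \<or> (lets x 0 (length w) = w \<and> at_cfg au k cfg ((nx ^^ length w) x) \<and>
      (P ((nx ^^ length w) x) (img cfg ((nx ^^ length w) x)) \<longrightarrow> P x (mob (a - c) (b - d) c d x)))"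
    by (rule wk_outL.IH) (use wk_outL.prems wk_outL.hyps al adm_nx[OF wk_outL.prems(7)] m in \<open>auto simp: algebra_simps\<close>)
  then show ?case using s by blast
next
  case (wk_outR a c w b d i j)
  have x: "x > 0" using wk_outR.prems adm_pirr pirr_def by blast
  have det: "a * d - b * c > 0" using wk_outR.prems p by simp
  note m = mob_lt[OF det wk_outR.prems(2,3) wk_outR.hyps(1) wk_outR.prems(5) x]
  have al: "alive au (nxR au j) (mob a b (c - a) (d - b) x)"
    using aliveD[OF wk_outR.prems(9)] m by (auto simp: dl_def)
  have s: "P x (mob a b (c - a) (d - b) x) \<Longrightarrow> P x (mob a b c d x)"
    using S2[of "mob a b c d x" x] m wk_outR.prems(7) adm_pirr by simp
  have "P x (mob a b (c - a) (d - b) x) \<or> (lets x 0 (length w) = w \<and> at_cfg au k cfg ((nx ^^ length w) x) \<and>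
      (P ((nx ^^ length w) x) (img cfg ((nx ^^ length w) x)) \<longrightarrow> P x (mob a b (c - a) (d - b) x)))"
    by (rule wk_outR.IH) (use wk_outR.prems wk_outR.hyps al adm_nx[OF wk_outR.prems(7)] m in \<open>auto simp: algebra_simps\<close>)
  then show ?case using s by blast
next
  case (wk_end c a b d i j)
  then show ?case by (auto simp: here_def at_cfg_def img_def lets_def)
next
  case (wk_T c a b d i j w)
  have x: "pirr x" using wk_T.prems adm_pirr by blast
  note al = aliveD[OF wk_T.prems(8)]
  show ?case
  proof (cases "x > 1")
    case True
    have m: "mob a (a + b) c (c + d) (nx x) = mob a b c d x" using mob_True[OF True] .
    have "P (nx x) (mob a (a + b) c (c + d) (nx x)) \<or> (lets (nx x) 0 (length w) = w \<and> at_cfg au k cfg ((nx ^^ length w) (nx x)) \<and>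
      (P ((nx ^^ length w) (nx x)) (img cfg ((nx ^^ length w) (nx x))) \<longrightarrow> P (nx x) (mob a (a + b) c (c + d) (nx x))))"
      by (rule wk_T.IH) (use wk_T.prems al True adm_nx[OF wk_T.prems(6)] m in \<open>auto simp: dl_def algebra_simps\<close>)
    moreover have "lets x 0 (Suc (length w)) = True # lets (nx x) 0 (length w)"
      using True lets_funpow[of 1 x 0 "length w"] by (simp add: lets_Suc')
    ultimately show ?thesis using S1[OF x] unfolding m by (auto simp: funpow_swap1)
  next
    case False
    have m: "mob (a + b) b (c + d) d (nx x) = mob a b c d x" using mob_False[OF x False] .
    have "P (nx x) (mob (a + b) b (c + d) d (nx x))"
    \<comment> \<open>With \<open>fn = 0\<close> no matrix counts as smaller, so a deviation can end
      only in dead states or at \<open>z\<close>.\<close>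
    proof (rule em_sound[where fn = 0 and z = z and p = p and au = au and k = k and i = "nxR au i" and j = j])
      fix a b c d y assume "DB p a b c d" "a < 0"
      then show "P y (mob a b c d y)" unfolding DB_def by auto
    qed (use p S1 S2 Z wk_T.hyps wk_T.prems al False adm_nx[OF wk_T.prems(6)] m in \<open>auto simp: dl_def algebra_simps\<close>)
    then show ?thesis using S1[OF x] m by simp
  qed
next
  case (wk_F c a b d i j w)
  have x: "pirr x" using wk_F.prems adm_pirr by blast
  note al = aliveD[OF wk_F.prems(8)]
  show ?case
  proof (cases "x > 1")
    case False
    have m: "mob (a + b) b (c + d) d (nx x) = mob a b c d x" using mob_False[OF x False] .
    have "P (nx x) (mob (a + b) b (c + d) d (nx x)) \<or> (lets (nx x) 0 (length w) = w \<and> at_cfg au k cfg ((nx ^^ length w) (nx x)) \<and>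
      (P ((nx ^^ length w) (nx x)) (img cfg ((nx ^^ length w) (nx x))) \<longrightarrow> P (nx x) (mob (a + b) b (c + d) d (nx x))))"
      by (rule wk_F.IH) (use wk_F.prems al False adm_nx[OF wk_F.prems(6)] m in \<open>auto simp: dl_def algebra_simps\<close>)
    moreover have "lets x 0 (Suc (length w)) = False # lets (nx x) 0 (length w)"
      using False lets_funpow[of 1 x 0 "length w"] by (simp add: lets_Suc')
    ultimately show ?thesis using S1[OF x] unfolding m by (auto simp: funpow_swap1)
  next
    case True
    have m: "mob a (a + b) c (c + d) (nx x) = mob a b c d x" using mob_True[OF True] .
    have "P (nx x) (mob a (a + b) c (c + d) (nx x))"
    proof (rule em_sound[where fn = 0 and z = z and p = p and au = au and k = k and i = "nxL au i" and j = j])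
      fix a b c d y assume "DB p a b c d" "a < 0"
      then show "P y (mob a b c d y)" unfolding DB_def by auto
    qed (use p S1 S2 Z wk_F.hyps wk_F.prems al True adm_nx[OF wk_F.prems(6)] m in \<open>auto simp: dl_def algebra_simps\<close>)
    then show ?thesis using S1[OF x] m by simp
  qed
qed

text \<open>Equal letters give equal paths, so both numbers are within 1 / (c d) of the same
  fraction, and this distance tends to 0.\<close>

lemma lets_inj:
  assumes "pirr x" "pirr y" "\<And>n. lets x 0 n = lets y 0 n"
  shows "x = y"
proof (rule ccontr)
  assume "x \<noteq> y"
  have same: "((nx ^^ n) x > 1) = ((nx ^^ n) y > 1)" for n
    using assms(3)[of "Suc n"] by (simp add: lets_Suc)
  have path: "sb_path x n = sb_path y n" for n by (induction n) (auto simp: same)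
  have "\<bar>x - y\<bar> / 2 > 0" using \<open>x \<noteq> y\<close> by simp
  from path_close[OF assms(1) this] obtain n where
    n: "\<forall>m\<ge>n. \<forall>a b c d. sb_path x m = (a, b, c, d) \<longrightarrow> c \<ge> 1 \<and> 1 / (real_of_int c * real_of_int d) < \<bar>x - y\<bar> / 2" ..
  obtain a b c d where p: "sb_path x n = (a, b, c, d)" by (metis prod_cases4)
  have c: "c \<ge> 1" "1 / (real_of_int c * real_of_int d) < \<bar>x - y\<bar> / 2" using n p by blast+
  have q: "sb_path y n = (a, b, c, d)" using p path by simp
  note i1 = path_inv[OF assms(1) p] and i2 = path_inv[OF assms(2) q]
  have "(nx ^^ n) x > 0" "(nx ^^ n) y > 0" using assms pirr_funpow by (auto simp: pirr_def)
  note e = apx_path(3)[OF this(1) i1(5,1,3) c(1) i1(2), unfolded i1(6)]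
    apx_path(3)[OF this(2) i2(5,1,3) c(1) i2(2), unfolded i2(6)] c(2)
  have "\<bar>u - x\<bar> < r \<Longrightarrow> \<bar>u - y\<bar> < r \<Longrightarrow> r < \<bar>x - y\<bar> / 2 \<Longrightarrow> False" for u r
    by (smt (verit) field_sum_of_halves)
  from this[OF e] show False .
qed

definition good :: "(ereal \<times> ereal) set \<Rightarrow> bool" where
  "good W \<longleftrightarrow> finite W \<and> (\<forall>(u, v)\<in>W. sqrt_rat u \<and> sqrt_rat v)"

text \<open>Two tails at \<open>cfg\<close> that never deviate have the same letters, hence coincide; comparing a tail with
  its own shift by the period shows that it is quadratic.\<close>

lemma orbit_values:
  assumes p: "p > 0" and W: "good W"
    and Z: "\<And>a b c d i j x. z a b c d i j \<Longrightarrow> at_cfg au k (a, b, c, d, i, j) x \<Longrightarrow> (lam x, lam (mob a b c d x)) \<in> W"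
    and db: "DB p a b c d" and w: "w \<noteq> []" and wk: "wk au z (a, b, c, d, i, j) w a b c d i j"
  shows "\<exists>W'. good W' \<and> W \<subseteq> W' \<and> (\<forall>x. at_cfg au k (a, b, c, d, i, j) x \<longrightarrow> (lam x, lam (mob a b c d x)) \<in> W')"
proof -
  let ?P = "\<lambda>x y. (lam x, lam y) \<in> W"
  define E where "E = {x. at_cfg au k (a, b, c, d, i, j) x \<and> \<not> ?P x (mob a b c d x)}"
  have pos: "a * d - b * c = p" "a \<ge> 0" "b \<ge> 0" "c \<ge> 0" "d \<ge> 0" using db by (auto simp: DB_def)
  have step: "lets x 0 (length w) = w \<and> (nx ^^ length w) x \<in> E" if "x \<in> E" for x
  proof -
    have at: "x \<in> adm k" "mob a b c d x \<in> adm k" "alive au i x" "alive au j (mob a b c d x)"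
      using that by (auto simp: E_def at_cfg_def)
    have "?P x (mob a b c d x) \<or> (lets x 0 (length w) = w \<and> at_cfg au k (a, b, c, d, i, j) ((nx ^^ length w) x) \<and>
      (?P ((nx ^^ length w) x) (img (a, b, c, d, i, j) ((nx ^^ length w) x)) \<longrightarrow> ?P x (mob a b c d x)))"
    proof (rule wk_sound[OF p, where P = ?P and k = k, OF _ _ _ wk pos at])
      fix a b c d i j x
      assume "z a b c d i j" "x \<in> adm k" "mob a b c d x \<in> adm k" "alive au i x" "alive au j (mob a b c d x)"
      then show "?P x (mob a b c d x)" by (intro Z) (simp_all add: at_cfg_def)
    qed (simp_all only: lam_nx)
    then show ?thesis using that unfolding E_def img_def by auto
  qed
  have pre: "lets x 0 (m * length w) = lets y 0 (m * length w)" if "x \<in> E" "y \<in> E" for x y m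
    using that
  proof (induction m arbitrary: x y)
    case (Suc m)
    have *: "lets u 0 (length w + m * length w) = w @ lets ((nx ^^ length w) u) 0 (m * length w)" if "u \<in> E" for u
      unfolding lets_add lets_funpow using step[OF that] by simp
    have "lets ((nx ^^ length w) x) 0 (m * length w) = lets ((nx ^^ length w) y) 0 (m * length w)"
      using step[OF Suc.prems(1)] step[OF Suc.prems(2)] by (intro Suc.IH) blast+
    then show ?case unfolding mult_Suc *[OF Suc.prems(1)] *[OF Suc.prems(2)] by (rule arg_cong)
  qed (simp add: lets_def)
  have uniq: "x = y" if "x \<in> E" "y \<in> E" for x y
  proof (rule lets_inj)
    show "pirr x" "pirr y" using that adm_pirr by (auto simp: E_def at_cfg_def)
    fix n
    have "n \<le> n * length w" using w by (cases w) auto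
    then have *: "lets u 0 n = take n (lets u 0 (n * length w))" for u
      using lets_add[of u 0 n "n * length w - n"] by simp
    show "lets x 0 n = lets y 0 n" by (subst (1 2) *) (simp only: pre[OF that])
  qed
  show ?thesis
  proof (cases "E = {}")
    case True
    then show ?thesis using W by (intro exI[of _ W]) (auto simp: E_def)
  next
    case False
    then obtain e where e: "e \<in> E" by blast
    have pe: "pirr e" "pirr (mob a b c d e)" using e adm_pirr by (auto simp: E_def at_cfg_def)
    have "(nx ^^ length w) e = e" using uniq[OF _ e] step[OF e] by blast
    then have "app w e = e" using app_lets[OF pe(1), of 0 "length w"] step[OF e] by simp
    then have q: "quadratic e" using quadratic_fixed w pe(1) by (simp add: pirr_def)
    then have "quadratic (mob a b c d e)" using quadratic_mob[OF pe(1) q] pos p by simp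
    then have "good (insert (lam e, lam (mob a b c d e)) W)"
      using W q pe sqrt_rat_lam by (auto simp: good_def simp del: One_nat_def)
    then show ?thesis
      using uniq[OF _ e] by (intro exI[of _ "insert (lam e, lam (mob a b c d e)) W"]) (auto simp: E_def)
  qed
qed

section \<open>Lists of closed orbits\<close>

type_synonym zlist = "(bool list \<times> config) list"

definition zmem :: "zlist \<Rightarrow> zpred" where
  "zmem zs a b c d i j \<longleftrightarrow> (a, b, c, d, i, j) \<in> snd ` set zs"

definition zchk :: "autom \<Rightarrow> int \<Rightarrow> zpred \<Rightarrow> zlist \<Rightarrow> bool" where
  "zchk au p z zs \<longleftrightarrow> list_all (\<lambda>(w, a, b, c, d, i, j). DB p a b c d \<and> w \<noteq> [] \<and>
     wk au z (a, b, c, d, i, j) w a b c d i j) zs"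

text \<open>The exits \<open>z\<close> are fixed in advance and already have their values in W, so
  checking an orbit never refers to the list it belongs to and no circularity arises. Each orbit
  adds at most one pair of values.\<close>

lemma zchk_values:
  assumes p: "p > 0" and W: "good W"
    and Z: "\<And>a b c d i j x. z a b c d i j \<Longrightarrow> at_cfg au k (a, b, c, d, i, j) x \<Longrightarrow> (lam x, lam (mob a b c d x)) \<in> W"
  shows "zchk au p z zs \<Longrightarrow> \<exists>W'. good W' \<and> W \<subseteq> W' \<and>
    (\<forall>a b c d i j x. zmem zs a b c d i j \<longrightarrow> at_cfg au k (a, b, c, d, i, j) x \<longrightarrow> (lam x, lam (mob a b c d x)) \<in> W')"
proof (induction zs)
  case Nil then show ?case using W by (auto simp: zmem_def)
next
  case (Cons e zs)
  obtain w a b c d i j where e: "e = (w, a, b, c, d, i, j)" by (metis prod_cases7)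
  from Cons obtain W1 where W1: "good W1" "W \<subseteq> W1"
    "\<And>a b c d i j x. zmem zs a b c d i j \<Longrightarrow> at_cfg au k (a, b, c, d, i, j) x \<Longrightarrow> (lam x, lam (mob a b c d x)) \<in> W1"
    unfolding zchk_def list.pred_inject by blast
  have "DB p a b c d" "w \<noteq> []" "wk au z (a, b, c, d, i, j) w a b c d i j"
    using Cons.prems e by (auto simp: zchk_def)
  note db = this
  have Z1: "(lam x, lam (mob a b c d x)) \<in> W1" if "z a b c d i j" "at_cfg au k (a, b, c, d, i, j) x" for a b c d i j x
    using Z[OF that] W1(2) by (rule rev_subsetD)
  have "\<exists>W'. good W' \<and> W1 \<subseteq> W' \<and>
      (\<forall>x. at_cfg au k (a, b, c, d, i, j) x \<longrightarrow> (lam x, lam (mob a b c d x)) \<in> W')"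
    by (rule orbit_values[OF p W1(1) _ db]) (rule Z1)
  then obtain W2 where W2: "good W2" "W1 \<subseteq> W2"
    "\<forall>x. at_cfg au k (a, b, c, d, i, j) x \<longrightarrow> (lam x, lam (mob a b c d x)) \<in> W2" by (elim exE conjE)
  show ?case
  proof (intro exI[of _ W2] conjI allI impI)
    show "good W2" "W \<subseteq> W2" using W1(2) W2 by auto
    fix a' b' c' d' i' j' x
    assume m: "zmem (e # zs) a' b' c' d' i' j'" and at: "at_cfg au k (a', b', c', d', i', j') x"
    show "(lam x, lam (mob a' b' c' d' x)) \<in> W2"
    proof (cases "zmem zs a' b' c' d' i' j'")
      case True
      then show ?thesis using W1(3)[OF True at] W2(2) by (intro subsetD[OF W2(2)])
    next
      case False
      then have "(a', b', c', d', i', j') = (a, b, c, d, i, j)" using m e by (simp add: zmem_def)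
      then show ?thesis using W2(3) at by simp
    qed
  qed
qed

section \<open>Doubly balanced matrices along a path\<close>

text \<open>The product of the inverse of the path matrix of p x, the matrix diag(p, 1) and the path
  matrix of x. Where its entries are nonnegative it takes the n-th tail of x to the m-th tail of p x
  (\<open>NN_mob\<close>); negative entries appear when more output has been read than the input
  determines.\<close>

definition NN :: "real \<Rightarrow> int \<Rightarrow> nat \<Rightarrow> nat \<Rightarrow> int \<times> int \<times> int \<times> int" where
  "NN x p n m = (case sb_path x n of (a, b, c, d) \<Rightarrow> case sb_path (real_of_int p * x) m of (a', b', c', d') \<Rightarrow>
     (d' * p * a - b' * c, d' * p * b - b' * d, a' * c - c' * p * a, a' * d - c' * p * b))"

fun nng :: "int \<times> int \<times> int \<times> int \<Rightarrow> bool" where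
  "nng (a, b, c, d) \<longleftrightarrow> a \<ge> 0 \<and> b \<ge> 0 \<and> c \<ge> 0 \<and> d \<ge> 0"

context
  fixes x :: real and p :: int
  assumes x: "pirr x" and p: "p > 0"
begin

lemma pirr_px: "pirr (real_of_int p * x)"
proof -
  have "real_of_int p * x \<notin> \<rat>"
  proof
    assume "real_of_int p * x \<in> \<rat>"
    then have "real_of_int p * x / real_of_int p \<in> \<rat>" by (intro Rats_divide) auto
    then show False using x p by (simp add: pirr_def)
  qed
  then show ?thesis using x p by (simp add: pirr_def)
qed

lemma NN_det: "NN x p n m = (a, b, c, d) \<Longrightarrow> a * d - b * c = p"
proof -
  assume N: "NN x p n m = (a, b, c, d)"
  obtain a1 b1 c1 d1 a2 b2 c2 d2 where q: "sb_path x n = (a1, b1, c1, d1)" "sb_path (real_of_int p * x) m = (a2, b2, c2, d2)"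
    by (metis prod_cases4)
  have "a1 * d1 - b1 * c1 = 1" "a2 * d2 - b2 * c2 = 1" using path_inv[OF x q(1)] path_inv[OF pirr_px q(2)] by auto
  moreover have e: "a = d2 * p * a1 - b2 * c1" "b = d2 * p * b1 - b2 * d1" "c = a2 * c1 - c2 * p * a1" "d = a2 * d1 - c2 * p * b1"
    using N unfolding NN_def q by auto
  have "a * d - b * c = p * ((a1 * d1 - b1 * c1) * (a2 * d2 - b2 * c2))"
    unfolding e by (simp add: algebra_simps)
  ultimately show ?thesis by simp
qed

lemma NN_bottom:
  assumes "NN x p n m = (a, b, c, d)" "sb_path x n = (a1, b1, c1, d1)" "sb_path (real_of_int p * x) m = (a2, b2, c2, d2)"
  shows "c1 = c2 * a + d2 * c" "d1 = c2 * b + d2 * d" "p * a1 = a2 * a + b2 * c" "p * b1 = a2 * b + b2 * d"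
proof -
  have d: "a2 * d2 - b2 * c2 = 1" using path_inv[OF pirr_px assms(3)] by auto
  have e: "a = d2 * p * a1 - b2 * c1" "b = d2 * p * b1 - b2 * d1" "c = a2 * c1 - c2 * p * a1" "d = a2 * d1 - c2 * p * b1"
    using assms unfolding NN_def by auto
  have "c2 * a + d2 * c = (a2 * d2 - b2 * c2) * c1" "c2 * b + d2 * d = (a2 * d2 - b2 * c2) * d1"
    "a2 * a + b2 * c = (a2 * d2 - b2 * c2) * (p * a1)" "a2 * b + b2 * d = (a2 * d2 - b2 * c2) * (p * b1)"
    unfolding e by (simp_all add: algebra_simps)
  then show "c1 = c2 * a + d2 * c" "d1 = c2 * b + d2 * d" "p * a1 = a2 * a + b2 * c" "p * b1 = a2 * b + b2 * d"
    using d by simp_all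
qed

text \<open>The tail v and the image r = V / W are both sent to p x by the second path matrix, which
  is injective because its determinant is 1.\<close>

lemma NN_mob:
  assumes N: "NN x p n m = (a, b, c, d)" and nn: "nng (a, b, c, d)"
  shows "(nx ^^ m) (real_of_int p * x) = mob a b c d ((nx ^^ n) x)"
proof -
  obtain a1 b1 c1 d1 a2 b2 c2 d2 where q: "sb_path x n = (a1, b1, c1, d1)" "sb_path (real_of_int p * x) m = (a2, b2, c2, d2)"
    by (metis prod_cases4)
  define u v where "u = (nx ^^ n) x" and "v = (nx ^^ m) (real_of_int p * x)"
  have u: "u > 0" "v > 0" using pirr_funpow x pirr_px by (auto simp: u_def v_def pirr_def)
  note i1 = path_inv[OF x q(1), folded u_def] and i2 = path_inv[OF pirr_px q(2), folded v_def]
  note bt = NN_bottom[OF N q]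
  have det: "a * d - b * c > 0" using NN_det[OF N] p by simp
  define W V where "W = real_of_int c * u + real_of_int d" and "V = real_of_int a * u + real_of_int b"
  have W: "W > 0" "V > 0" using mob_pos[OF det _ _ _ _ u(1)] nn by (auto simp: W_def V_def)
  have w1: "real_of_int c1 * u + real_of_int d1 = real_of_int c2 * V + real_of_int d2 * W"
    "real_of_int p * (real_of_int a1 * u + real_of_int b1) = real_of_int a2 * V + real_of_int b2 * W"
    using arg_cong[OF bt(1), of real_of_int] arg_cong[OF bt(2), of real_of_int]
      arg_cong[OF bt(3), of real_of_int] arg_cong[OF bt(4), of real_of_int]
    by (simp_all add: W_def V_def algebra_simps)
  define r where "r = V / W"
  have r: "r > 0" "V = r * W" using W by (auto simp: r_def)
  have den: "real_of_int c2 * r + real_of_int d2 > 0" "real_of_int c2 * v + real_of_int d2 > 0"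
    using i2(1-4) r(1) u(2) by (auto intro!: add_nonneg_pos)
  have "mob a2 b2 c2 d2 v = real_of_int p * mob a1 b1 c1 d1 u" using i1(6) i2(6) by simp
  also have "\<dots> = (real_of_int a2 * V + real_of_int b2 * W) / (real_of_int c2 * V + real_of_int d2 * W)"
    unfolding mob_def using w1 by simp
  also have "\<dots> = ((real_of_int a2 * r + real_of_int b2) * W) / ((real_of_int c2 * r + real_of_int d2) * W)"
    unfolding r(2) by (simp add: algebra_simps)
  also have "\<dots> = mob a2 b2 c2 d2 r" unfolding mob_def using W by simp
  finally have "(real_of_int a2 * v + real_of_int b2) * (real_of_int c2 * r + real_of_int d2)
       = (real_of_int a2 * r + real_of_int b2) * (real_of_int c2 * v + real_of_int d2)"
    unfolding mob_def using den by (simp add: frac_eq_eq)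
  then have "(real_of_int (a2 * d2 - b2 * c2)) * (v - r) = 0" by (simp add: algebra_simps)
  then have "v = r" using i2(5) by simp
  then show ?thesis by (simp add: r_def V_def W_def mob_def u_def v_def)
qed

lemma NN_Suc_in:
  assumes "NN x p n m = (a, b, c, d)"
  shows "NN x p (Suc n) m = (if (nx ^^ n) x > 1 then (a, a + b, c, c + d) else (a + b, b, c + d, d))"
proof -
  obtain a1 b1 c1 d1 a2 b2 c2 d2 where q: "sb_path x n = (a1, b1, c1, d1)" "sb_path (real_of_int p * x) m = (a2, b2, c2, d2)"
    by (metis prod_cases4)
  show ?thesis using assms q by (auto simp: NN_def algebra_simps)
qed

lemma NN_Suc_out:
  assumes "NN x p n m = (a, b, c, d)"
  shows "NN x p n (Suc m) = (if (nx ^^ m) (real_of_int p * x) > 1 then (a - c, b - d, c, d) else (a, b, c - a, d - b))"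
proof -
  obtain a1 b1 c1 d1 a2 b2 c2 d2 where q: "sb_path x n = (a1, b1, c1, d1)" "sb_path (real_of_int p * x) m = (a2, b2, c2, d2)"
    by (metis prod_cases4)
  show ?thesis using assms q by (auto simp: NN_def algebra_simps)
qed

text \<open>Undoing an output letter adds one row to the other.\<close>

lemma nng_out_mono:
  assumes "nng (NN x p n m')" "m \<le> m'" shows "nng (NN x p n m)"
  using assms(2,1)
proof (induction m' rule: dec_induct)
  case (step j)
  obtain a b c d where N: "NN x p n j = (a, b, c, d)" by (metis prod_cases4)
  have "nng (NN x p n (Suc j)) \<Longrightarrow> nng (NN x p n j)"
    using NN_Suc_out[OF N] N by (auto split: if_splits)
  then show ?case using step by blast
qed

text \<open>For fixed m the number p x lies strictly inside its Stern-Brocot interval. Once the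
  interval of x, scaled by p, fits inside as well, all four entries are positive.\<close>

lemma nng_ex: "\<exists>n. nng (NN x p n m)"
proof -
  obtain a2 b2 c2 d2 where q2: "sb_path (real_of_int p * x) m = (a2, b2, c2, d2)" by (metis prod_cases4)
  note i2 = path_inv[OF pirr_px q2]
  define v y where "v = (nx ^^ m) (real_of_int p * x)" and "y = real_of_int p * x"
  have v: "v > 0" using pirr_funpow[OF pirr_px] by (simp add: v_def pirr_def)
  have y: "y = (real_of_int a2 * v + real_of_int b2) / (real_of_int c2 * v + real_of_int d2)"
    using i2(6) by (simp add: mob_def v_def y_def)
  have den: "real_of_int c2 * v + real_of_int d2 > 0" using i2 v by (auto intro!: add_nonneg_pos)
  have detr: "real_of_int a2 * real_of_int d2 - real_of_int b2 * real_of_int c2 = 1"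
    using i2(5) by (metis of_int_1 of_int_diff of_int_mult)
  have "real_of_int d2 * y - real_of_int b2 = v * (real_of_int a2 * real_of_int d2 - real_of_int b2 * real_of_int c2) / (real_of_int c2 * v + real_of_int d2)"
    unfolding y using den by (simp add: field_simps)
  then have g1: "real_of_int d2 * y - real_of_int b2 > 0" using detr den v by simp
  have "real_of_int a2 - real_of_int c2 * y = (real_of_int a2 * real_of_int d2 - real_of_int b2 * real_of_int c2) / (real_of_int c2 * v + real_of_int d2)"
    unfolding y using den by (simp add: field_simps)
  then have g2: "real_of_int a2 - real_of_int c2 * y > 0" using detr den by simp
  \<comment> \<open>The smaller of the two margins, divided so that an error below e in x, scaled by
    p and by either denominator, stays within it.\<close>
  define e where "e = min (real_of_int d2 * y - real_of_int b2) (real_of_int a2 - real_of_int c2 * y) / (real_of_int p * (real_of_int c2 + real_of_int d2))"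
  have cd: "real_of_int p * (real_of_int c2 + real_of_int d2) > 0" using p i2 by (auto intro!: mult_pos_pos)
  have e: "e > 0" unfolding e_def using g1 g2 cd by simp
  obtain n where n: "\<forall>k\<ge>n. \<forall>a b c d. sb_path x k = (a, b, c, d) \<longrightarrow> c \<ge> 1 \<and> 1 / (real_of_int c * real_of_int d) < e"
    using path_close[OF x e] ..
  obtain a b c d where q: "sb_path x n = (a, b, c, d)" by (metis prod_cases4)
  have c: "c \<ge> 1" "1 / (real_of_int c * real_of_int d) < e" using n q by blast+
  note i1 = path_inv[OF x q]
  have u: "(nx ^^ n) x > 0" using pirr_funpow[OF x] by (simp add: pirr_def)
  note A = apx_path[OF u i1(5,1,3) c(1) i1(2), unfolded i1(6)]
  have key: "\<bar>real_of_int p * r - y\<bar> * real_of_int c2 < real_of_int a2 - real_of_int c2 * y"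
    "\<bar>real_of_int p * r - y\<bar> * real_of_int d2 < real_of_int d2 * y - real_of_int b2"
    if r: "\<bar>r - x\<bar> < e" for r
  proof -
    have "real_of_int p * r - y = real_of_int p * (r - x)" by (simp add: y_def algebra_simps)
    then have "\<bar>real_of_int p * r - y\<bar> = real_of_int p * \<bar>r - x\<bar>" using p by (simp add: abs_mult)
    then have "\<bar>real_of_int p * r - y\<bar> < real_of_int p * e" using r p by simp
    then have *: "\<bar>real_of_int p * r - y\<bar> * (real_of_int c2 + real_of_int d2) < real_of_int p * e * (real_of_int c2 + real_of_int d2)"
      using i2 by (intro mult_strict_right_mono) auto
    have "real_of_int p * e * (real_of_int c2 + real_of_int d2) = min (real_of_int d2 * y - real_of_int b2) (real_of_int a2 - real_of_int c2 * y)"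
      using cd unfolding e_def by (simp add: field_simps)
    moreover have "0 \<le> \<bar>real_of_int p * r - y\<bar> * real_of_int c2" "0 \<le> \<bar>real_of_int p * r - y\<bar> * real_of_int d2" using i2 by auto
    ultimately show "\<bar>real_of_int p * r - y\<bar> * real_of_int c2 < real_of_int a2 - real_of_int c2 * y"
      "\<bar>real_of_int p * r - y\<bar> * real_of_int d2 < real_of_int d2 * y - real_of_int b2"
      using * by (simp_all add: distrib_left)
  qed
  have pos2: "real_of_int d2 * (real_of_int p * r) - real_of_int b2 > 0" "real_of_int a2 - real_of_int c2 * (real_of_int p * r) > 0"
    if r: "\<bar>r - x\<bar> < e" for r
  proof -
    define h where "h = real_of_int p * r - y"
    have pr: "real_of_int p * r = y + h" by (simp add: h_def)
    have k: "\<bar>h\<bar> * real_of_int c2 < real_of_int a2 - real_of_int c2 * y" "\<bar>h\<bar> * real_of_int d2 < real_of_int d2 * y - real_of_int b2"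
      using key[OF r] by (auto simp: h_def)
    have "\<bar>h * real_of_int c2\<bar> = \<bar>h\<bar> * real_of_int c2" "\<bar>h * real_of_int d2\<bar> = \<bar>h\<bar> * real_of_int d2"
      using i2 by (auto simp: abs_mult)
    then have "h * real_of_int c2 \<le> \<bar>h\<bar> * real_of_int c2" "- (h * real_of_int d2) \<le> \<bar>h\<bar> * real_of_int d2" by linarith+
    then show "real_of_int d2 * (real_of_int p * r) - real_of_int b2 > 0" "real_of_int a2 - real_of_int c2 * (real_of_int p * r) > 0"
      unfolding pr using k by (simp_all add: algebra_simps)
  qed
  have r: "\<bar>real_of_int a / real_of_int c - x\<bar> < e" "\<bar>real_of_int b / real_of_int d - x\<bar> < e"
    using A(3,4) c(2) by linarith+
  have up: "u1 * real_of_int k > 0" if "u1 > 0" "k \<ge> 1" for u1 :: real and k :: int using that by simp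
  note R = up[OF pos2(1)[OF r(1)] c(1)] up[OF pos2(2)[OF r(1)] c(1)] up[OF pos2(1)[OF r(2)] i1(2)] up[OF pos2(2)[OF r(2)] i1(2)]
  have "real_of_int (d2 * p * a - b2 * c) > 0" "real_of_int (a2 * c - c2 * p * a) > 0"
    "real_of_int (d2 * p * b - b2 * d) > 0" "real_of_int (a2 * d - c2 * p * b) > 0"
    using R c(1) i1(2) by (simp_all add: field_simps)
  then show ?thesis
    unfolding of_int_0_less_iff by (intro exI[of _ n]) (simp add: NN_def q q2)
qed

text \<open>The bottom row of the first path matrix is that of the second one times
  \<open>NN\<close>, and both row sums of \<open>NN\<close> are at least 1. Output therefore cannot
  run ahead of a fixed input.\<close>

lemma nng_bound:
  assumes "nng (NN x p n m)" "sb_path x n = (a1, b1, c1, d1)" "sb_path (real_of_int p * x) m = (a2, b2, c2, d2)"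
  shows "c2 + d2 \<le> c1 + d1"
proof -
  obtain a b c d where N: "NN x p n m = (a, b, c, d)" by (metis prod_cases4)
  have nn: "a \<ge> 0" "b \<ge> 0" "c \<ge> 0" "d \<ge> 0" using assms(1) N by auto
  have det: "a * d - b * c = p" using NN_det[OF N] .
  have "a + b \<noteq> 0" "c + d \<noteq> 0" using nn det p by (auto simp: add_nonneg_eq_0_iff)
  then have ab: "a + b \<ge> 1" "c + d \<ge> 1" using nn by linarith+
  have c2: "c2 \<ge> 0" "d2 \<ge> 1" using path_inv[OF pirr_px assms(3)] by auto
  have "c1 + d1 = c2 * (a + b) + d2 * (c + d)" using NN_bottom[OF N assms(2,3)] by (simp add: algebra_simps)
  moreover have "c2 * 1 \<le> c2 * (a + b)" "d2 * 1 \<le> d2 * (c + d)" using ab c2 by (intro mult_left_mono; simp)+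
  ultimately show ?thesis by linarith
qed

lemma nng_finite: "\<exists>M. \<forall>m\<ge>M. \<not> nng (NN x p n m)"
proof -
  obtain a1 b1 c1 d1 where q: "sb_path x n = (a1, b1, c1, d1)" by (metis prod_cases4)
  obtain m0 where m0: "\<And>m a b c d. sb_path (real_of_int p * x) (m0 + m) = (a, b, c, d) \<Longrightarrow> c \<ge> 1 \<and> c + d \<ge> int m"
    using path_growth[OF pirr_px] by blast
  show ?thesis
  proof (intro exI[of _ "m0 + nat (c1 + d1 + 1)"] allI impI notI)
    fix m assume m: "m0 + nat (c1 + d1 + 1) \<le> m" and nn: "nng (NN x p n m)"
    obtain a2 b2 c2 d2 where q2: "sb_path (real_of_int p * x) m = (a2, b2, c2, d2)" by (metis prod_cases4)
    have "sb_path (real_of_int p * x) (m0 + (m - m0)) = (a2, b2, c2, d2)" using q2 m by simp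
    from m0[OF this] have "c2 + d2 \<ge> int (m - m0)" by simp
    with nng_bound[OF nn q q2] m show False by linarith
  qed
qed

text \<open>Take the first \<open>n\<close> for which the matrix for some \<open>m\<close> is nonnegative, and then the last such \<open>m\<close>.\<close>

lemma DB_path: "\<exists>n\<ge>n0. \<exists>m\<ge>n0. \<exists>a b c d. DB p a b c d \<and>
   (nx ^^ m) (real_of_int p * x) = mob a b c d ((nx ^^ n) x)"
proof -
  obtain M where M: "\<And>n m. m \<ge> M n \<Longrightarrow> \<not> nng (NN x p n m)"
    using nng_finite by metis
  \<comment> \<open>This lies beyond every output length compatible with at most n0 input letters,
    which forces the first n with a nonnegative matrix above n0.\<close>
  define m1 where "m1 = n0 + (\<Sum>n\<le>n0. M n)"
  have m1: "\<not> nng (NN x p n m1)" if "n \<le> n0" for n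
  proof (rule M)
    have "M n \<le> (\<Sum>n\<le>n0. M n)" using that by (intro member_le_sum) auto
    then show "M n \<le> m1" by (simp add: m1_def)
  qed
  define n where "n = (LEAST n. nng (NN x p n m1))"
  have n: "nng (NN x p n m1)" unfolding n_def using nng_ex by (rule LeastI_ex)
  have nl: "\<not> nng (NN x p k m1)" if "k < n" for k using that unfolding n_def by (rule not_less_Least)
  have nn0: "n > n0" using n m1 by (meson not_le)
  then obtain n1 where n1: "n = Suc n1" by (cases n) auto
  define m where "m = (GREATEST m. nng (NN x p n m))"
  have bd: "\<And>m. nng (NN x p n m) \<Longrightarrow> m \<le> M n" using M by (meson nat_le_linear)
  have m: "nng (NN x p n m)" unfolding m_def by (rule GreatestI_nat[where P = "\<lambda>m. nng (NN x p n m)", OF n bd])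
  have mg: "m1 \<le> m" unfolding m_def by (rule Greatest_le_nat[where P = "\<lambda>m. nng (NN x p n m)", OF n bd])
  have mS: "\<not> nng (NN x p n (Suc m))"
    using Greatest_le_nat[where P = "\<lambda>m. nng (NN x p n m)", OF _ bd, of "Suc m"] unfolding m_def by auto
  have nS: "\<not> nng (NN x p n1 m)" using nl[of n1] n1 nng_out_mono[OF _ mg] by auto
  obtain a b c d where N: "NN x p n m = (a, b, c, d)" by (metis prod_cases4)
  obtain a0 b0 c0 d0 where N0: "NN x p n1 m = (a0, b0, c0, d0)" by (metis prod_cases4)
  have nn: "a \<ge> 0" "b \<ge> 0" "c \<ge> 0" "d \<ge> 0" using m N by auto
  have det: "a * d - b * c = p" using NN_det[OF N] .
  have dp: "a * d - b * c > 0" using det p by simp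
  have mm: "(nx ^^ m) (real_of_int p * x) = mob a b c d ((nx ^^ n) x)" using NN_mob[OF N] m N by simp
  have u: "(nx ^^ n) x > 0" using pirr_funpow[OF x] by (simp add: pirr_def)
  \<comment> \<open>If a row dominated, the next output letter would be the one that keeps the
    matrix nonnegative, against the maximality of m.\<close>
  have row: "c < a" "b < d"
  proof -
    have "\<not> (c < a \<and> d \<le> b)"
    proof
      assume h: "c < a \<and> d \<le> b"
      then have "(nx ^^ m) (real_of_int p * x) > 1" using mob_gt[OF dp nn(2,3) _ _ nn(4) u] mm by simp
      then show False using mS NN_Suc_out[OF N] h nn by simp
    qed
    moreover have "\<not> a \<le> c"
    proof
      assume h: "a \<le> c"
      note l = mob_lt[OF dp nn(1,2) h nn(4) u]
      then show False using mS NN_Suc_out[OF N] h nn mm by simp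
    qed
    ultimately show "c < a" "b < d" by linarith+
  qed
  obtain a1 b1 c1 d1 a2 b2 c2 d2 where q: "sb_path x n1 = (a1, b1, c1, d1)" "sb_path (real_of_int p * x) m = (a2, b2, c2, d2)"
    by (metis prod_cases4)
  note i1 = path_inv[OF x q(1)] and i2 = path_inv[OF pirr_px q(2)]
  \<comment> \<open>By minimality of n there was a negative entry before the last input letter, so
    the column enlarged by that letter does not dominate. That the other column dominates
    contradicts the growth of the path entries through \<open>NN_bottom\<close>, and the mixed case
    contradicts the determinant.\<close>
  have col: "b < a" "c < d"
  proof -
    have noneg: "\<not> (a \<le> b \<and> d \<le> c)" 
    proof
      assume "a \<le> b \<and> d \<le> c"
      then have "a * d \<le> b * c" using nn by (intro mult_mono) auto
      then show False using dp by simp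
    qed
    have "b < a \<and> c < d"
    proof (cases "(nx ^^ n1) x > 1")
      case True
      have e: "a = a0" "b = a0 + b0" "c = c0" "d = c0 + d0" using NN_Suc_in[OF N0] N True n1 by auto
      have neg: "b0 < 0 \<or> d0 < 0" using nS N0 e nn by auto
      have "sb_path x n = (a1, a1 + b1, c1, c1 + d1)" using q True n1 by simp
      from NN_bottom[OF N this q(2)] have "c1 = c2 * a + d2 * c" "c1 + d1 = c2 * b + d2 * d" by auto
      moreover have "c2 * b + d2 * d \<le> c2 * a + d2 * c" if "b \<le> a" "d \<le> c"
        using that i2 by (intro add_mono mult_left_mono) auto
      ultimately have "\<not> (b \<le> a \<and> d \<le> c)" using i1 by linarith
      then show ?thesis using neg noneg e by linarith
    next
      case False
      have e: "a = a0 + b0" "b = b0" "c = c0 + d0" "d = d0" using NN_Suc_in[OF N0] N False n1 by auto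
      have neg: "a0 < 0 \<or> c0 < 0" using nS N0 e nn by auto
      have "sb_path x n = (a1 + b1, b1, c1 + d1, d1)" using q False n1 by simp
      from NN_bottom[OF N this q(2)] have "p * (a1 + b1) = a2 * a + b2 * c" "p * b1 = a2 * b + b2 * d" by auto
      moreover have "a2 * a + b2 * c \<le> a2 * b + b2 * d" if "a \<le> b" "c \<le> d"
        using that i2 by (intro add_mono mult_left_mono) auto
      moreover have "p * a1 > 0" using i1 p by simp
      ultimately have "\<not> (a \<le> b \<and> c \<le> d)" by (auto simp: distrib_left)
      then show ?thesis using neg noneg e by linarith
    qed
    then show "b < a" "c < d" by auto
  qed
  have "DB p a b c d" unfolding DB_def using nn row col det by simp
  moreover have "m \<ge> n0" using mg m1_def by simp
  ultimately show ?thesis using mm nn0 by (metis less_imp_le)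
qed

end

section \<open>Enumeration of the doubly balanced matrices\<close>

text \<open>Balance alone allows b c close to a d, as for a = d and b = c = a - 1, where a grows
  linearly with p. Admissibility of x and of the image keeps b c away from a d, so that p exceeds
  a^2 / 4 and the list of first columns stays short.\<close>

lemma DB_bound:
  assumes db: "DB p a b c d" and ad: "a \<le> d" and x: "x \<in> adm k" and y: "mob a b c d x \<in> adm k" and p: "p > 0"
  shows "a * a < 4 * p"
proof -
  define y where "y = mob a b c d x"
  have h: "0 \<le> b" "0 \<le> c" "b < a" "c < a" "b < d" "c < d" "a * d - b * c = p" using db by (auto simp: DB_def)
  have xb: "1/4 < x" "x < 4" using x unfolding adm_def by (auto dest!: spec[of _ "0::nat"])
  have yy: "1/4 < nx y \<and> nx y < 4" "pirr y" using y adm_nx[OF y] unfolding y_def adm_def by (auto dest!: spec[of _ "0::nat"])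
  have det: "a * d - b * c > 0" using h p by simp
  have pos: "real_of_int c * x + real_of_int d > 0" using mob_pos(1)[OF det, of x] h xb by auto
  \<comment> \<open>Since \<open>nx y\<close> lies in (1/4, 4) too, y is above 5/4 or below 4/5.
    Inserting the extreme arguments 4 and 1/4 for x gives the two linear inequalities.\<close>
  consider "5 * (c * 4 + d) \<le> 4 * (a * 4 + b)" | "5 * (a + 4 * b) \<le> 4 * (c + 4 * d)"
  proof (cases "y > 1")
    case True
    then have "y > 5/4" using yy by (simp add: nx_def)
    then have "5 * (real_of_int c * x + real_of_int d) < 4 * (real_of_int a * x + real_of_int b)"
      using pos unfolding y_def mob_def by (simp add: field_simps)
    then have lt: "(4 * real_of_int a - 5 * real_of_int c) * x > 5 * real_of_int d - 4 * real_of_int b"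
      by (simp add: algebra_simps)
    have "5 * real_of_int d - 4 * real_of_int b \<ge> 0" using h by simp
    then have "(4 * real_of_int a - 5 * real_of_int c) * x > 0" using lt by linarith
    then have "4 * real_of_int a - 5 * real_of_int c > 0" using xb by (simp add: zero_less_mult_iff)
    then have "(4 * real_of_int a - 5 * real_of_int c) * x \<le> (4 * real_of_int a - 5 * real_of_int c) * 4"
      using xb by (intro mult_left_mono) auto
    then have "real_of_int (5 * (c * 4 + d)) < real_of_int (4 * (a * 4 + b))"
      using lt by simp
    then show ?thesis using that(1) by linarith
  next
    case False
    then have y1: "y < 1" using pirr_ne_1[OF yy(2)] by simp
    have "y / (1 - y) < 4" using yy False by (simp add: nx_def)
    then have "y < 4/5" using y1 by (simp add: field_simps)
    then have "5 * (real_of_int a * x + real_of_int b) < 4 * (real_of_int c * x + real_of_int d)"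
      using pos unfolding y_def mob_def by (simp add: field_simps)
    then have lt: "(5 * real_of_int a - 4 * real_of_int c) * x < 4 * real_of_int d - 5 * real_of_int b"
      by (simp add: algebra_simps)
    have "(5 * real_of_int a - 4 * real_of_int c) * (1/4) \<le> (5 * real_of_int a - 4 * real_of_int c) * x"
      using xb h by (intro mult_left_mono) auto
    then have "real_of_int (5 * (a + 4 * b)) < real_of_int (4 * (c + 4 * d))" using lt by simp
    then show ?thesis using that(2) by linarith
  qed
  then show ?thesis
  proof cases
    case 1
    have "20 * c \<le> 15 * a" using 1 ad h(3) by (simp add: algebra_simps)
    then have c: "4 * c \<le> 3 * a" by linarith
    have "b * (4 * c) \<le> b * (3 * a)" using c h(1) by (intro mult_left_mono) auto
    then have 1: "4 * (b * c) \<le> 3 * (a * b)" by (simp add: algebra_simps)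
    have "a * b \<le> a * (a - 1)" using h(1,3) by (intro mult_left_mono) auto
    then have 2: "a * b \<le> a * a - a" by (simp add: algebra_simps)
    have 3: "a * a \<le> a * d" using h(1,3) ad by (intro mult_left_mono) auto
    have "a \<ge> 1" using h(1,3) by linarith
    with 1 2 3 h(7) show ?thesis by linarith
  next
    case 2
    have "20 * b \<le> 4 * c + 16 * d - 5 * a" using 2 by simp
    then have "20 * b \<le> 16 * d - a - 4" using h(4) by linarith
    then have "a * (20 * b) \<le> a * (16 * d - a - 4)" using h(1,3) by (intro mult_left_mono) auto
    then have 1: "20 * (a * b) \<le> 16 * (a * d) - a * a - 4 * a" by (simp add: algebra_simps)
    have "b * c \<le> b * (a - 1)" using h(1,4) by (intro mult_left_mono) auto
    then have 2: "b * c \<le> a * b - b" by (simp add: algebra_simps)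
    have 3: "a * a \<le> a * d" using h(1,3) ad by (intro mult_left_mono) auto
    have "a \<ge> 1" using h(1,3) by linarith
    with 1 2 3 h(1,7) show ?thesis by linarith
  qed
qed

text \<open>Inverting x and its image exchanges a with d and b with c, so only
  \<open>a \<le> d\<close> has to be searched. Then d is the largest entry, and with d as limit the
  smaller matrices are left to an induction.\<close>

definition seed :: "autom \<Rightarrow> zpred \<Rightarrow> int \<Rightarrow> int \<Rightarrow> int \<Rightarrow> int \<Rightarrow> bool" where
  "seed au z a b c d = (if d < a then True else if d \<le> b then True else em au d z a b c d 2 2)"

definition seed' :: "autom \<Rightarrow> zpred \<Rightarrow> int \<Rightarrow> int \<Rightarrow> int \<Rightarrow> int \<Rightarrow> int \<Rightarrow> bool" where
  "seed' au z a c u v t = seed au z a (u - t * a) c (v - t * c)"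

text \<open>The first columns \<open>(a, c)\<close> run through the Stern--Brocot tree. If \<open>(a', c')\<close> is the right parent of
  \<open>(a, c)\<close>, the second column is \<open>p (a', c')\<close> reduced modulo \<open>(a, c)\<close>.\<close>

inductive en :: "autom \<Rightarrow> zpred \<Rightarrow> int \<Rightarrow> int \<Rightarrow> int \<Rightarrow> int \<Rightarrow> int \<Rightarrow> bool" for au z p where
  en_stop: "4 * p \<le> (a1 + a2) * (a1 + a2) \<Longrightarrow> en au z p a1 c1 a2 c2"
| en_go: "seed' au z (a1 + a2) (c1 + c2) (p * a2) (p * c2) (p * a2 div (a1 + a2)) \<Longrightarrow>
    en au z p a1 c1 (a1 + a2) (c1 + c2) \<Longrightarrow> en au z p (a1 + a2) (c1 + c2) a2 c2 \<Longrightarrow> en au z p a1 c1 a2 c2"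

lemma en_eq:
  "en au z p a1 c1 a2 c2 = (if 4 * p \<le> (a1 + a2) * (a1 + a2) then True
     else if seed' au z (a1 + a2) (c1 + c2) (p * a2) (p * c2) (p * a2 div (a1 + a2))
       then if en au z p a1 c1 (a1 + a2) (c1 + c2) then en au z p (a1 + a2) (c1 + c2) a2 c2 else False
     else False)"
  by (subst en.simps) auto

text \<open>The coordinates u, v of (a, c) with respect to the two parents undergo the subtractive
  Euclidean algorithm on the way down and end at u = v = 1. There (b, d) and p (a2, c2) have the
  same determinant p with (a, c), so they differ by a multiple of this primitive column, and 0 <= b
  < a singles out the quotient.\<close>

lemma en_sound:
  assumes "en au z p a1 c1 a2 c2" "a1 \<ge> 1" "a2 \<ge> 1" "c1 \<ge> 0" "c2 \<ge> 0" "a1 * c2 - a2 * c1 = 1"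
    and "u \<ge> 1" "v \<ge> 1" "a = u * a1 + v * a2" "c = u * c1 + v * c2" "coprime a c"
    and "DB p a b c d" "a \<le> d" "a * a < 4 * p"
  shows "em au d z a b c d 2 2"
  using assms
proof (induction a1 c1 a2 c2 arbitrary: u v rule: en.induct)
  case (en_stop a1 a2 c1 c2)
  have "1 * a1 \<le> u * a1" "1 * a2 \<le> v * a2" using en_stop by (intro mult_right_mono; simp)+
  then have "a1 + a2 \<le> a" using en_stop.prems(8) by linarith
  then have "(a1 + a2) * (a1 + a2) \<le> a * a" using en_stop by (intro mult_mono) auto
  then show ?case using en_stop by simp
next
  case (en_go a1 a2 c1 c2)
  note pr = en_go.prems
  consider "u = v" | "u < v" | "v < u" by linarith
  then show ?case
  proof cases
    case 1
    have "v dvd a" "v dvd c" using pr 1 by (auto simp: distrib_left[symmetric])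
    then have "v = 1" using pr(10) pr(7) by (metis coprime_common_divisor zdvd1_eq abs_of_pos zero_less_one_class.zero_less_one less_le_trans)
    then have ac: "a = a1 + a2" "c = c1 + c2" using pr 1 by auto
    have h: "0 \<le> b" "0 \<le> c" "b < a" "c < a" "b < d" "c < d" "a * d - b * c = p" using pr(11) by (auto simp: DB_def)
    have e: "a * c2 - c * a2 = 1" using pr(5) ac by (simp add: algebra_simps)
    have "p * a2 = (a * d - b * c) * a2" using h(7) by simp
    also have "\<dots> = a * (d * a2) - b * (c * a2)" by (simp add: algebra_simps)
    also have "c * a2 = a * c2 - 1" using e by simp
    also have "a * (d * a2) - b * (a * c2 - 1) = b + (d * a2 - b * c2) * a" by (simp add: algebra_simps)
    finally have pa: "p * a2 = b + (d * a2 - b * c2) * a" .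
    then have t: "p * a2 div a = d * a2 - b * c2" using h(1,3) by (simp add: div_add1_eq)
    have b: "p * a2 - (p * a2 div a) * a = b" using pa t by simp
    have "a * (p * c2 - (p * a2 div a) * c) = a * d"
    proof -
      have "a * (p * c2 - (p * a2 div a) * c) = p * (a * c2) - ((p * a2 div a) * a) * c" by (simp add: algebra_simps)
      also have "(p * a2 div a) * a = p * a2 - b" using b by simp
      also have "p * (a * c2) - (p * a2 - b) * c = p * (a * c2 - c * a2) + b * c" by (simp add: algebra_simps)
      also have "\<dots> = a * d" using e h(7) by simp
      finally show ?thesis .
    qed
    then have d: "p * c2 - (p * a2 div a) * c = d" using h by auto
    have "seed au z a b c d" using en_go.hyps(1) unfolding seed'_def ac[symmetric] b d .
    then show ?thesis using h pr(12) by (simp add: seed_def)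
  next
    case 2
    show ?thesis
    proof (rule en_go.IH(2)[of u "v - u"])
      show "a = u * (a1 + a2) + (v - u) * a2" "c = u * (c1 + c2) + (v - u) * c2" using pr by (auto simp: algebra_simps)
    qed (use pr 2 in \<open>auto simp: algebra_simps\<close>)
  next
    case 3
    show ?thesis
    proof (rule en_go.IH(1)[of "u - v" v])
      show "a = (u - v) * a1 + v * (a1 + a2)" "c = (u - v) * c1 + v * (c1 + c2)" using pr by (auto simp: algebra_simps)
    qed (use pr 3 in \<open>auto simp: algebra_simps\<close>)
  qed
qed

text \<open>The tree below (1, 0) and (1, 1) contains only columns with 0 < c < a. For c = 0 and
  \<open>a \<le> d\<close> the one matrix left is diag(1, p), which is searched separately.\<close>

definition search_ok :: "autom \<Rightarrow> zpred \<Rightarrow> int \<Rightarrow> bool" where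
  "search_ok au z p \<longleftrightarrow> em au p z 1 0 0 p 2 2 \<and> en au z p 1 0 1 1"

text \<open>Induction on the larger diagonal entry, with inversion reducing a > d to the searched
  case. \<open>DB_path\<close> supplies a doubly balanced start at positions so late that both tails
  are already admissible.\<close>

lemma search_sound:
  assumes ok: "aut_ok cn cd au" and k: "cn \<le> 4 * cd" and p: "p = 1 \<or> prime p"
    and z1: "zchk au p (zmem []) zs1" and z2: "zchk au p (zmem zs1) zs2"
    and s: "search_ok au z p" and zz: "\<And>a b c d i j. z a b c d i j \<Longrightarrow> zmem (zs1 @ zs2) a b c d i j"
  shows "\<exists>W. good W \<and> (\<forall>x. pirr x \<longrightarrow> lam x < ereal (real_of_int cn / real_of_int cd) \<longrightarrow>
     lam (real_of_int p * x) < ereal (real_of_int cn / real_of_int cd) \<longrightarrow> (lam x, lam (real_of_int p * x)) \<in> W)"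
proof -
  define K where "K = real_of_int cn / real_of_int cd"
  have cd: "cd > 0" using ok by (simp add: aut_ok_def)
  have p0: "p > 0" using p prime_gt_0_int by auto
  have K4: "K \<le> 4" using k cd by (simp add: K_def field_simps flip: of_int_mult of_int_le_iff)
  obtain W1 where W1: "good W1"
    "\<forall>a b c d i j x. zmem zs1 a b c d i j \<longrightarrow> at_cfg au K (a, b, c, d, i, j) x \<longrightarrow> (lam x, lam (mob a b c d x)) \<in> W1"
    using zchk_values[OF p0 _ _ z1, of "{}" K] by (auto simp: good_def zmem_def)
  obtain W where W: "good W" "W1 \<subseteq> W"
    "\<forall>a b c d i j x. zmem zs2 a b c d i j \<longrightarrow> at_cfg au K (a, b, c, d, i, j) x \<longrightarrow> (lam x, lam (mob a b c d x)) \<in> W"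
    using zchk_values[OF p0 W1(1) _ z2, of K] W1(2) by blast
  let ?P = "\<lambda>x y. (lam x, lam y) \<in> W"
  have Z: "?P x (mob a b c d x)" if "z a b c d i j" "at_cfg au K (a, b, c, d, i, j) x" for a b c d i j x
  proof -
    have "zmem zs1 a b c d i j \<or> zmem zs2 a b c d i j" using zz[OF that(1)] by (auto simp: zmem_def)
    then show ?thesis using that(2) W1(2) W(2,3) by blast
  qed
  have S1: "?P x y" if "pirr x" "?P (nx x) y" for x y using that(2) unfolding lam_nx[OF that(1)] .
  have S2: "?P x y" if "pirr y" "?P x (nx y)" for x y using that(2) unfolding lam_nx[OF that(1)] .
  have claim: "?P x (mob a b c d x)" if "DB p a b c d" "x \<in> adm K" "mob a b c d x \<in> adm K" for a b c d x
    using that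
  proof (induction "nat (max a d)" arbitrary: a b c d x rule: less_induct)
    case less
    have main: "?P x' (mob a' b' c' d' x')"
      if db: "DB p a' b' c' d'" and mx: "max a' d' = max a d" and ad: "a' \<le> d'"
        and x: "x' \<in> adm K" and y: "mob a' b' c' d' x' \<in> adm K" for a' b' c' d' x'
    proof -
      have h: "0 \<le> b'" "0 \<le> c'" "b' < a'" "c' < a'" "b' < d'" "c' < d'" "a' * d' - b' * c' = p" using db by (auto simp: DB_def)
      have b4: "a' * a' < 4 * p" using DB_bound[OF db ad x y p0] .
      have em: "em au d' z a' b' c' d' 2 2"
      proof (cases "c' = 0")
        case True
        then have e: "a' * d' = p" using h by simp
        then have dv: "a' dvd p" by (metis dvd_triv_left)
        have "a' = 1 \<or> a' = p"
        proof (cases "p = 1")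
          case True
          then have "\<bar>a'\<bar> = 1" using dv by simp
          then show ?thesis using h(1,3) by linarith
        next
          case False
          then have "prime p" using p by simp
          then show ?thesis using dv h(1,3) unfolding prime_int_iff by simp
        qed
        moreover have "a' = 1" if "a' = p"
        proof -
          have "d' = 1" using e that p0 by simp
          then show ?thesis using ad h by linarith
        qed
        ultimately have "a' = 1" by auto
        then have "b' = 0" "d' = p" using h e by auto
        then show ?thesis using s \<open>a' = 1\<close> True by (simp add: search_ok_def)
      next
        case False
        have cop: "coprime a' c'"
        proof (rule coprimeI)
          fix g assume g: "g dvd a'" "g dvd c'"
          then have "g dvd p" unfolding h(7)[symmetric] by (intro dvd_diff) auto
          then have gp: "\<bar>g\<bar> dvd p" by simp
          have "\<bar>g\<bar> = 1 \<or> \<bar>g\<bar> = p"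
          proof (cases "p = 1")
            case True
            then show ?thesis using gp by simp
          next
            case False
            then have "prime p" using p by simp
            then show ?thesis using gp unfolding prime_int_iff by simp
          qed
          \<comment> \<open>If p divided both a and c, then 0 < c < a would give a >= 2 p, against
            a^2 < 4 p.\<close>
          moreover have "\<bar>g\<bar> \<noteq> p" if p1: "p \<noteq> 1"
          proof
            assume "\<bar>g\<bar> = p"
            then have "p dvd c'" "p dvd a'" using g by (metis abs_dvd_iff)+
            then obtain s t where st: "c' = p * s" "a' = p * t" by (auto elim!: dvdE)
            have "p * s > 0" using st(1) False h(2) by linarith
            then have "s \<ge> 1" using p0 by (simp add: zero_less_mult_iff)
            moreover have "t > s" using st h(4) p0 by simp
            ultimately have "t \<ge> 2" by simp
            then have "p * 2 \<le> a'" using st(2) p0 by simp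
            then have "(p * 2) * (p * 2) \<le> a' * a'" using p0 by (intro mult_mono) auto
            then have "p * p < p" using b4 by simp
            then show False using p0 by (simp add: mult_less_cancel_left1)
          qed
          ultimately have "\<bar>g\<bar> = 1" by blast
          then show "is_unit g" by simp
        qed
        have enr: "en au z p 1 0 1 1" using s by (simp add: search_ok_def)
        show ?thesis
          by (rule en_sound[OF enr, where u = "a' - c'" and v = c' and a = a' and c = c' and b = b' and d = d'])
             (use False h cop db ad b4 in auto)
      qed
      show ?thesis
      proof (rule em_sound[OF p0, where P = ?P and k = K, OF S1 S2 _ _ em h(7)])
        fix a'' b'' c'' d'' x''
        assume *: "DB p a'' b'' c'' d''" "a'' < d'" "d'' < d'" "x'' \<in> adm K" "mob a'' b'' c'' d'' x'' \<in> adm K"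
        have "nat (max a'' d'') < nat (max a d)" using *(1-3) mx ad h by (auto simp: DB_def)
        from less.hyps[OF this *(1,4,5)] show "?P x'' (mob a'' b'' c'' d'' x'')" .
      next
        fix a b c d i j x
        assume "z a b c d i j" "x \<in> adm K" "mob a b c d x \<in> adm K" "alive au i x" "alive au j (mob a b c d x)"
        then show "?P x (mob a b c d x)" by (intro Z) (simp_all add: at_cfg_def)
      next
        show "alive au 2 x'" "alive au 2 (mob a' b' c' d' x')" using alive_adm[OF ok] x y unfolding K_def by auto
      qed (use h x y in simp_all)
    qed
    show ?case
    proof (cases "a \<le> d")
      case True
      then show ?thesis using main[OF less.prems(1) refl _ less.prems(2,3)] by simp
    next
      case False
      have h: "0 \<le> b" "0 \<le> c" "b < a" "c < a" "b < d" "c < d" "a * d - b * c = p" using less.prems(1) by (auto simp: DB_def)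
      have x: "x > 0" using less.prems(2) adm_pirr pirr_def by blast
      have pos: "real_of_int c * x + real_of_int d > 0" "real_of_int a * x + real_of_int b > 0"
        using mob_pos[of a d b c x] h x p0 by auto
      have e: "mob d c b a (1 / x) = 1 / mob a b c d x"
      proof -
        have "mob d c b a (1 / x) = ((real_of_int d + real_of_int c * x) / x) / ((real_of_int b + real_of_int a * x) / x)"
          unfolding mob_def using x by (simp add: field_simps)
        also have "\<dots> = (real_of_int d + real_of_int c * x) / (real_of_int b + real_of_int a * x)" using x by simp
        finally show ?thesis by (simp add: mob_def add.commute)
      qed
      have "?P (1 / x) (mob d c b a (1 / x))"
        using less.prems False h adm_inverse by (intro main) (auto simp: DB_def e algebra_simps)
      moreover have "mob a b c d x \<noteq> 0" unfolding mob_def using pos by simp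
      ultimately show ?thesis using x unfolding e by (simp add: lam_inverse del: One_nat_def)
    qed
  qed
  show ?thesis
  proof (intro exI[of _ W] conjI allI impI)
    fix x assume x: "pirr x" "lam x < ereal (real_of_int cn / real_of_int cd)"
      "lam (real_of_int p * x) < ereal (real_of_int cn / real_of_int cd)"
    have px: "pirr (real_of_int p * x)" using pirr_px[OF x(1) p0] .
    obtain n1 where n1: "\<And>n. n \<ge> n1 \<Longrightarrow> (nx ^^ n) x \<in> adm K"
      using eventually_adm[OF x(1) _ K4] x(2) by (auto simp: K_def)
    obtain n2 where n2: "\<And>n. n \<ge> n2 \<Longrightarrow> (nx ^^ n) (real_of_int p * x) \<in> adm K"
      using eventually_adm[OF px _ K4] x(3) by (auto simp: K_def)
    obtain n m a b c d where nm: "n \<ge> max n1 n2" "m \<ge> max n1 n2" "DB p a b c d"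
      "(nx ^^ m) (real_of_int p * x) = mob a b c d ((nx ^^ n) x)"
      using DB_path[OF x(1) p0, of "max n1 n2"] by blast
    have "?P ((nx ^^ n) x) (mob a b c d ((nx ^^ n) x))"
      using n1[of n] n2[of m] nm by (intro claim[OF nm(3)]) auto
    then show "(lam x, lam (real_of_int p * x)) \<in> W"
      unfolding nm(4)[symmetric] lam_funpow[OF x(1)] lam_funpow[OF px] .
  qed (rule W(1))
qed

section \<open>Elements of the spectrum\<close>

lemma sqrt_int_irrational:
  fixes D r :: int
  assumes "r \<ge> 0" "r * r < D" "D < (r + 1) * (r + 1)"
  shows "sqrt (real_of_int D) \<notin> \<rat>"
proof
  assume "sqrt (real_of_int D) \<in> \<rat>"
  then obtain m n where mn: "n > 0" "coprime m n" "sqrt (real_of_int D) = real_of_int m / real_of_int n"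
    by (rule Rats_cases')
  have "D > 0" using assms by (smt (verit) mult_nonneg_nonneg)
  then have "real_of_int D = (real_of_int m / real_of_int n)\<^sup>2" using mn(3) by (metis of_int_0_le_iff order.strict_implies_order real_sqrt_pow2)
  then have "real_of_int (D * n\<^sup>2) = real_of_int (m\<^sup>2)" using mn(1) by (simp add: power_divide field_simps)
  then have e: "D * n\<^sup>2 = m\<^sup>2" using of_int_eq_iff by blast
  then have "n\<^sup>2 dvd m\<^sup>2" by (metis dvd_triv_right)
  then have "n dvd m" by simp
  then have "is_unit n" by (rule coprime_common_divisor[OF mn(2) _ dvd_refl])
  then have "n = 1" using mn(1) by simp
  then have D: "D = \<bar>m\<bar> * \<bar>m\<bar>" using e by (simp add: power2_eq_square)
  consider "\<bar>m\<bar> \<le> r" | "r + 1 \<le> \<bar>m\<bar>" by linarith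
  then show False
  proof cases
    case 1
    then have "\<bar>m\<bar> * \<bar>m\<bar> \<le> r * r" using assms(1) by (intro mult_mono) auto
    then show False using D assms by simp
  next
    case 2
    then have "(r + 1) * (r + 1) \<le> \<bar>m\<bar> * \<bar>m\<bar>" using assms(1) by (intro mult_mono) auto
    then show False using D assms by simp
  qed
qed

text \<open>The upper bounds give an element of the spectrum only if the value is a real number. An
  integer shift makes x positive, and \<open>lam_ge_1\<close> then excludes minus infinity.\<close>

lemma spectrum_ex:
  assumes p: "prime p" and x: "x \<notin> \<rat>" and l: "lam x \<le> ereal u" "lam (real p * x) \<le> ereal v"
    and K: "u < K" "v < K"
  shows "\<exists>y\<in>lagrange_spectrum p. y < K"
proof -
  have le: "lagrange_approx p x \<le> ereal (max u v)"
    unfolding lagrange_approx_prime[OF p]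
    by (intro max.boundedI order_trans[OF l(1)] order_trans[OF l(2)]) (simp_all del: ereal_max)
  define k where "k = - \<lfloor>x\<rfloor>"
  have "x + real_of_int k > 0"
  proof -
    have "real_of_int \<lfloor>x\<rfloor> \<noteq> x" using x by (metis Rats_of_int)
    moreover have "real_of_int \<lfloor>x\<rfloor> \<le> x" by simp
    ultimately show ?thesis unfolding k_def of_int_minus by linarith
  qed
  moreover have "x + real_of_int k \<notin> \<rat>" using x by (metis Rats_diff Rats_of_int add_diff_cancel_right')
  ultimately have "lam (x + real_of_int k) \<ge> 1" by (intro lam_ge_1) (simp add: pirr_def)
  then have "lagrange_approx p x \<ge> 1"
    unfolding lagrange_approx_prime[OF p] lam_shift by (rule max.coboundedI1)
  then obtain y where y: "lagrange_approx p x = ereal y"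
    using le by (cases "lagrange_approx p x") (auto simp del: ereal_max)
  then have "y \<in> lagrange_spectrum p" using x unfolding lagrange_spectrum_def by blast
  moreover have "y < K" using le K unfolding y by (simp del: ereal_max)
  ultimately show ?thesis by blast
qed

lemma lam_le_dsc:
  fixes a b c :: int
  assumes "a \<noteq> 0" "x \<notin> \<rat>" "real_of_int a * x\<^sup>2 + real_of_int b * x + real_of_int c = 0" "m > 0"
    "\<forall>\<^sub>F y in rat_approach x. m \<le> \<bar>real_of_int (qf a b c (fst y) (snd y))\<bar>"
  shows "lam x \<le> ereal (sqrt (real_of_int (b * b - 4 * a * c)) / m)"
  using lam_le_form[OF assms] unfolding dsc_def[OF assms(1-3)] by (simp add: power2_eq_square)

text \<open>Near x the integral form has no rational zero, so its absolute value is at least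
  1.\<close>

lemma lam_le_dsc_1:
  fixes a b c :: int
  assumes "a \<noteq> 0" "x \<notin> \<rat>" "real_of_int a * x\<^sup>2 + real_of_int b * x + real_of_int c = 0"
  shows "lam x \<le> ereal (sqrt (real_of_int (b * b - 4 * a * c)))"
proof -
  have "\<forall>\<^sub>F y in rat_approach x. 1 \<le> \<bar>real_of_int (qf a b c (fst y) (snd y))\<bar>"
    using eventually_near_dsc[OF assms, OF sqrt_dsc_pos[OF assms]] eventually_valid[OF assms]
  proof eventually_elim
    case (elim y)
    have "qf a b c (fst y) (snd y) \<noteq> 0"
    proof
      assume 0: "qf a b c (fst y) (snd y) = 0"
      show False using apx_qf[OF assms, of "snd y" "fst y"] elim 0 by auto
    qed
    then show ?case by linarith
  qed
  from lam_le_dsc[OF assms _ this] show ?thesis by simp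
qed

text \<open>If \<open>\<beta>\<^sup>2 \<equiv> D\<close> modulo \<open>4 p\<close>, both \<open>(\<beta> + \<surd>D) / (2 p)\<close> and its multiple by \<open>p\<close> are roots of integral forms
  of discriminant \<open>D\<close>.\<close>

lemma spectrum_square_root:
  fixes D r \<beta> q :: int
  assumes p: "prime p" and D: "r \<ge> 0" "r * r < D" "D < (r + 1) * (r + 1)"
    and b: "\<beta> * \<beta> - D = 4 * int p * q" and K: "sqrt (real_of_int D) < K"
  shows "\<exists>y\<in>lagrange_spectrum p. y < K"
proof -
  define w where "w = sqrt (real_of_int D)"
  have irr: "w \<notin> \<rat>" using sqrt_int_irrational[OF D] by (simp add: w_def)
  have "D > 0" using D by (smt (verit) mult_nonneg_nonneg)
  then have ww: "w * w = real_of_int D" by (simp add: w_def)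
  have p0: "p > 0" using p prime_gt_0_nat by blast
  define x where "x = (real_of_int \<beta> + w) / (2 * real p)"
  have px: "real p * x = (real_of_int \<beta> + w) / 2" using p0 by (simp add: x_def)
  have w: "w = 2 * (real p * x) - real_of_int \<beta>" unfolding px by (simp add: field_simps)
  have irrx: "x \<notin> \<rat>" using irr unfolding w by (metis Rats_diff Rats_mult Rats_of_int Rats_of_nat Rats_number_of)
  have irrpx: "real p * x \<notin> \<rat>" using irr unfolding w by (metis Rats_diff Rats_mult Rats_of_int Rats_number_of)
  have br: "real_of_int \<beta> * real_of_int \<beta> - real_of_int D = 4 * real p * real_of_int q"
    using arg_cong[OF b, of real_of_int] by simp
  have e: "(real_of_int \<beta> + w) * (real_of_int \<beta> + w) = 2 * real_of_int \<beta> * (real_of_int \<beta> + w) - 4 * real p * real_of_int q"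
    using br ww by (simp add: algebra_simps)
  have sq: "(2 * (real p * x)) * (2 * (real p * x)) = 2 * real_of_int \<beta> * (2 * (real p * x)) - 4 * real p * real_of_int q"
    using e unfolding w by simp
  have r2: "real_of_int 1 * (real p * x)\<^sup>2 + real_of_int (- \<beta>) * (real p * x) + real_of_int (int p * q) = 0"
    using sq by (simp add: power2_eq_square algebra_simps)
  have "real p * (real_of_int (int p) * x\<^sup>2 + real_of_int (- \<beta>) * x + real_of_int q) = 0"
    using r2 by (simp add: power2_eq_square algebra_simps)
  then have r1: "real_of_int (int p) * x\<^sup>2 + real_of_int (- \<beta>) * x + real_of_int q = 0" using p0 by simp
  have d: "- \<beta> * - \<beta> - 4 * int p * q = D" "- \<beta> * - \<beta> - 4 * 1 * (int p * q) = D" using b by auto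
  show ?thesis
    using lam_le_dsc_1[OF _ irrx r1, unfolded d] lam_le_dsc_1[OF _ irrpx r2, unfolded d] p0 K
    by (intro spectrum_ex[OF p irrx]) auto
qed

text \<open>For an indefinite form with \<open>a > 0 > c\<close> the following moves along its river, the cycle of pairs of adjacent
  values of opposite signs, until it comes back to \<open>(a0, b0, c0)\<close>.\<close>

definition same :: "int \<Rightarrow> int \<Rightarrow> int \<Rightarrow> int \<Rightarrow> int \<Rightarrow> int \<Rightarrow> bool" where
  "same a0 b0 c0 a b c = (if a = a0 then if c = c0 then b = b0 else False else False)"

inductive river :: "int \<Rightarrow> int \<Rightarrow> int \<Rightarrow> int \<Rightarrow> int \<Rightarrow> int \<Rightarrow> int \<Rightarrow> bool" for m a0 b0 c0 where
  "m \<le> a \<Longrightarrow> c \<le> - m \<Longrightarrow> a + b + c < 0 \<Longrightarrow>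
     \<not> same a0 b0 c0 a (2 * a + b) (a + b + c) \<longrightarrow> river m a0 b0 c0 a (2 * a + b) (a + b + c) \<Longrightarrow>
   river m a0 b0 c0 a b c"
| "m \<le> a \<Longrightarrow> c \<le> - m \<Longrightarrow> 0 \<le> a + b + c \<Longrightarrow>
     \<not> same a0 b0 c0 (a + b + c) (b + 2 * c) c \<longrightarrow> river m a0 b0 c0 (a + b + c) (b + 2 * c) c \<Longrightarrow>
   river m a0 b0 c0 a b c"

lemma river_eq:
  "river m a0 b0 c0 a b c = (if m \<le> a then if c \<le> - m then
     if a + b + c < 0 then if same a0 b0 c0 a (2 * a + b) (a + b + c) then True
         else river m a0 b0 c0 a (2 * a + b) (a + b + c)
     else if same a0 b0 c0 (a + b + c) (b + 2 * c) c then True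
         else river m a0 b0 c0 (a + b + c) (b + 2 * c) c
     else False else False)"
  by (subst river.simps) auto

lemma riverD:
  assumes "river m a0 b0 c0 a b c"
  shows "m \<le> a \<and> c \<le> - m \<and>
    (if a + b + c < 0 then same a0 b0 c0 a (2 * a + b) (a + b + c) \<or> river m a0 b0 c0 a (2 * a + b) (a + b + c)
     else same a0 b0 c0 (a + b + c) (b + 2 * c) c \<or> river m a0 b0 c0 (a + b + c) (b + 2 * c) c)"
  using assms by (cases rule: river.cases) auto

lemma same_eq: "same a0 b0 c0 a b c \<longleftrightarrow> a = a0 \<and> b = b0 \<and> c = c0"
  by (simp add: same_def)

text \<open>Conway's climbing argument. The subtractive Euclidean algorithm reduces (x, y),
  following the river as long as both take the same direction. At the first disagreement the form,
  in the coordinates of the other direction, has coefficients of one sign, so its value lies beyond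
  a or c.\<close>

lemma river_bound:
  assumes r0: "river m a0 b0 c0 a0 b0 c0" and m: "m > 0"
  shows "river m a0 b0 c0 a b c \<Longrightarrow> x \<ge> 0 \<Longrightarrow> y \<ge> 0 \<Longrightarrow> (x, y) \<noteq> (0, 0) \<Longrightarrow> m \<le> \<bar>qf a b c x y\<bar>"
proof (induction "nat (x + y)" arbitrary: a b c x y rule: less_induct)
  case less
  have sq: "u * u \<ge> 1" if "u \<ge> 1" for u :: int using mult_mono[of 1 u 1 u] that by simp
  have ac: "m \<le> a" "c \<le> - m" using riverD[OF less.prems(1)] by auto
  \<comment> \<open>A derivation of \<open>river\<close> stops on returning to the starting form;
    \<open>r0\<close> restarts it there, so the walk may go round as often as (x, y)
    requires.\<close>
  have st: "river m a0 b0 c0 a (2 * a + b) (a + b + c)" if "a + b + c < 0"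
    using riverD[OF less.prems(1)] that r0 by (auto simp: same_eq)
  have st': "river m a0 b0 c0 (a + b + c) (b + 2 * c) c" if "\<not> a + b + c < 0"
    using riverD[OF less.prems(1)] that r0 by (auto simp: same_eq)
  consider "x = 0" "y \<ge> 1" | "y = 0" "x \<ge> 1" | "x \<ge> 1" "y \<ge> 1" using less.prems by fastforce
  then show ?case
  proof cases
    case 1
    have "(- c) * 1 \<le> (- c) * (y * y)" using ac m sq[OF 1(2)] by (intro mult_left_mono) auto
    then show ?thesis using 1 ac by (simp add: qf_def power2_eq_square)
  next
    case 2
    have "a * 1 \<le> a * (x * x)" using ac m sq[OF 2(2)] by (intro mult_left_mono) auto
    then show ?thesis using 2 ac by (simp add: qf_def power2_eq_square)
  next
    case 3
    have q1: "qf a b c x y = qf a (2 * a + b) (a + b + c) (x - y) y"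
      by (simp add: qf_def power2_eq_square algebra_simps)
    have q2: "qf a b c x y = qf (a + b + c) (b + 2 * c) c x (y - x)"
      by (simp add: qf_def power2_eq_square algebra_simps)
    show ?thesis
    proof (cases "a + b + c < 0")
      case True
      show ?thesis
      proof (cases "y \<le> x")
        case le: True
        show ?thesis unfolding q1 using 3 le by (intro less.hyps st True) auto
      next
        case False
        have "(a + b + c) * (x * x) \<le> 0" using True by (intro mult_nonpos_nonneg) auto
        moreover have "(b + 2 * c) * (x * (y - x)) \<le> 0" using True ac m 3 False by (intro mult_nonpos_nonneg) auto
        moreover have "(- c) * 1 \<le> (- c) * ((y - x) * (y - x))" using ac m False by (intro mult_left_mono sq) auto
        ultimately have "qf a b c x y \<le> c" unfolding q2 by (simp add: qf_def power2_eq_square mult.assoc)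
        then show ?thesis using ac m by simp
      qed
    next
      case False
      show ?thesis
      proof (cases "x \<le> y")
        case le: True
        show ?thesis unfolding q2 using 3 le by (intro less.hyps st' False) auto
      next
        case xy: False
        have "(a + b + c) * (y * y) \<ge> 0" using False 3 by (intro mult_nonneg_nonneg) auto
        moreover have "(2 * a + b) * ((x - y) * y) \<ge> 0" using False ac m 3 xy by (intro mult_nonneg_nonneg) auto
        moreover have "a * 1 \<le> a * ((x - y) * (x - y))" using ac m xy by (intro mult_left_mono sq) auto
        ultimately have "qf a b c x y \<ge> a" unfolding q1 by (simp add: qf_def power2_eq_square mult.assoc)
        then show ?thesis using ac m by simp
      qed
    qed
  qed
qed

lemma lam_le_river:
  assumes r: "river m a b c a b c" and m: "m > 0" and x: "pirr x"
    and root: "real_of_int a * x\<^sup>2 + real_of_int b * x + real_of_int c = 0"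
  shows "lam x \<le> ereal (sqrt (real_of_int (b * b - 4 * a * c)) / real_of_int m)"
proof (rule lam_le_dsc)
  show "a \<noteq> 0" using riverD[OF r] m by auto
  show "x \<notin> \<rat>" using x by (simp add: pirr_def)
  show "\<forall>\<^sub>F y in rat_approach x. real_of_int m \<le> \<bar>real_of_int (qf a b c (fst y) (snd y))\<bar>"
    unfolding eventually_rat_approach
  \<comment> \<open>The radius x keeps s / t positive, so that only pairs with positive coordinates
    have to be bounded.\<close>
  proof (intro exI[of _ x] conjI allI impI)
    fix s t :: int
    assume t: "t > 0" and "\<bar>real_of_int s / real_of_int t - x\<bar> < x"
    then have "real_of_int s / real_of_int t > 0" by linarith
    then have "s > 0" using t by (simp add: zero_less_divide_iff)
    then have "m \<le> \<bar>qf a b c s t\<bar>" using t by (intro river_bound[OF r m r]) auto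
    then show "real_of_int m \<le> \<bar>real_of_int (qf a b c (fst (s, t)) (snd (s, t)))\<bar>" by simp
  qed (use x in \<open>simp add: pirr_def\<close>)
qed (use root m in auto)

text \<open>The fourth component of a form is a lower bound for its absolute values along the river,
  and r, the integer part of the root of the discriminant, certifies irrationality. Values are
  compared with cn / cd after squaring. The entries n1 to n4 form a matrix as in \<open>NN\<close>,
  and the three equations say that its adjugate carries g1 to k times g2; k equals p in all
  data.\<close>

definition wit :: "int \<Rightarrow> int \<Rightarrow> int \<Rightarrow> int \<times> int \<times> int \<times> int \<Rightarrow> int \<times> int \<times> int \<times> int \<Rightarrow>
    int \<times> int \<times> int \<times> int \<Rightarrow> int \<times> int \<times> int \<times> int \<Rightarrow> int \<Rightarrow> int \<Rightarrow> bool" where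
  "wit cn cd p M1 M2 g1 g2 k r = (case M1 of (a1, b1, c1, d1) \<Rightarrow> case M2 of (a2, b2, c2, d2) \<Rightarrow>
     case g1 of (a, b, c, m) \<Rightarrow> case g2 of (a', b', c', m') \<Rightarrow>
     a1 * d1 - b1 * c1 = 1 \<and> a2 * d2 - b2 * c2 = 1 \<and> 0 < m \<and> 0 < m' \<and> 0 < k \<and> 0 < cd \<and> 0 < cn \<and> 0 \<le> r \<and>
     r * r < b * b - 4 * a * c \<and> b * b - 4 * a * c < (r + 1) * (r + 1) \<and>
     (b * b - 4 * a * c) * (cd * cd) < m * m * (cn * cn) \<and>
     (b' * b' - 4 * a' * c') * (cd * cd) < m' * m' * (cn * cn) \<and>
     (let n1 = d2 * p * a1 - b2 * c1; n2 = d2 * p * b1 - b2 * d1; n3 = a2 * c1 - c2 * p * a1; n4 = a2 * d1 - c2 * p * b1 in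
       0 \<le> n1 \<and> 0 \<le> n2 \<and> 0 \<le> n3 \<and> 0 \<le> n4 \<and>
       a * n4 * n4 - b * n4 * n3 + c * n3 * n3 = k * a' \<and>
       - 2 * a * n2 * n4 + b * (n1 * n4 + n2 * n3) - 2 * c * n1 * n3 = k * b' \<and>
       a * n2 * n2 - b * n1 * n2 + c * n1 * n1 = k * c') \<and>
     river m a b c a b c \<and> river m' a' b' c' a' b' c')"

lemma moebius_denom: "pirr x \<Longrightarrow> (c, d) \<noteq> (0, 0) \<Longrightarrow> real_of_int c * x + real_of_int d \<noteq> 0"
proof
  assume x: "pirr x" "(c, d) \<noteq> (0, 0)" and e: "real_of_int c * x + real_of_int d = 0"
  then have "c \<noteq> 0" by auto
  then have "x = - real_of_int d / real_of_int c" using e by (simp add: field_simps)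
  then show False using x by (metis pirr_def Rats_divide Rats_minus_iff Rats_of_int)
qed

lemma sqrt_div_less:
  fixes D m cn cd :: int
  assumes "D * (cd * cd) < m * m * (cn * cn)" "m > 0" "cd > 0" "cn > 0"
  shows "sqrt (real_of_int D) / real_of_int m < real_of_int cn / real_of_int cd"
proof -
  have "real_of_int D * (real_of_int cd * real_of_int cd) < real_of_int m * real_of_int m * (real_of_int cn * real_of_int cn)"
    using assms(1) by (metis of_int_less_iff of_int_mult)
  then have "real_of_int D < (real_of_int m * real_of_int cn / real_of_int cd)\<^sup>2"
    using assms by (simp add: power2_eq_square field_simps)
  then have "sqrt (real_of_int D) < real_of_int m * real_of_int cn / real_of_int cd"
    using assms by (intro real_less_lsqrt) auto
  then show ?thesis using assms by (simp add: field_simps)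
qed

lemma form_compose:
  fixes a b c p q r s x :: real
  shows "(a * s * s - b * s * r + c * r * r) * (p * x + q)\<^sup>2
      + (- 2 * a * q * s + b * (p * s + q * r) - 2 * c * p * r) * (p * x + q) * (r * x + s)
      + (a * q * q - b * p * q + c * p * p) * (r * x + s)\<^sup>2
    = (p * s - q * r)\<^sup>2 * (a * x\<^sup>2 + b * x + c)"
  by algebra

text \<open>The point is \<open>M1 \<eta>\<close>, where \<open>\<eta>\<close> is the positive root of \<open>g1\<close>; its multiple by \<open>p\<close> is \<open>M2 (N \<eta>)\<close> with
  \<open>N = M2\<^sup>-\<^sup>1 diag(p, 1) M1\<close>, and \<open>N \<eta>\<close> is the positive root of \<open>g2\<close>.\<close>

lemma spectrum_wit:
  assumes p: "prime p" and w: "wit cn cd (int p) (a1, b1, c1, d1) (a2, b2, c2, d2) (a, b, c, m) (a', b', c', m') k r"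
  shows "\<exists>y\<in>lagrange_spectrum p. y < real_of_int cn / real_of_int cd"
proof -
  have p0: "int p > 0" using p prime_gt_0_nat by auto
  define n1 n2 n3 n4 where "n1 = d2 * int p * a1 - b2 * c1" and "n2 = d2 * int p * b1 - b2 * d1"
    and "n3 = a2 * c1 - c2 * int p * a1" and "n4 = a2 * d1 - c2 * int p * b1"
  have det: "a1 * d1 - b1 * c1 = 1" "a2 * d2 - b2 * c2 = 1" and m: "0 < m" "0 < m'" "0 < k" "0 < cd" "0 < cn"
    and D: "0 \<le> r" "r * r < b * b - 4 * a * c" "b * b - 4 * a * c < (r + 1) * (r + 1)"
    and l: "(b * b - 4 * a * c) * (cd * cd) < m * m * (cn * cn)" "(b' * b' - 4 * a' * c') * (cd * cd) < m' * m' * (cn * cn)"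
    and n: "0 \<le> n1" "0 \<le> n2" "0 \<le> n3" "0 \<le> n4"
    and g: "a * n4 * n4 - b * n4 * n3 + c * n3 * n3 = k * a'"
       "- 2 * a * n2 * n4 + b * (n1 * n4 + n2 * n3) - 2 * c * n1 * n3 = k * b'"
       "a * n2 * n2 - b * n1 * n2 + c * n1 * n1 = k * c'"
    and rv: "river m a b c a b c" "river m' a' b' c' a' b' c'"
    using w unfolding wit_def Let_def prod.case n1_def n2_def n3_def n4_def by blast+
  have ac: "a > 0" "c < 0" using riverD[OF rv(1)] m by auto
  define s where "s = sqrt (real_of_int (b * b - 4 * a * c))"
  have irr: "s \<notin> \<rat>" using sqrt_int_irrational[OF D] by (simp add: s_def)
  have "a * c < 0" using ac by (simp add: mult_less_0_iff)
  then have D0: "b * b - 4 * a * c > b * b" by simp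
  then have "real_of_int (b * b - 4 * a * c) > real_of_int (b * b)" by (rule iffD2[OF of_int_less_iff])
  then have "s > sqrt (real_of_int (b * b))" unfolding s_def by (rule real_sqrt_less_mono)
  then have sb: "s > \<bar>real_of_int b\<bar>" by simp
  have ss: "s * s = real_of_int b * real_of_int b - 4 * real_of_int a * real_of_int c"
  proof -
    have "b * b - 4 * a * c \<ge> 0" using D0 by (smt (verit) zero_le_square)
    then have "real_of_int (b * b - 4 * a * c) \<ge> 0" by (rule iffD2[OF of_int_0_le_iff])
    then have "s * s = real_of_int (b * b - 4 * a * c)" unfolding s_def real_sqrt_mult_self by (rule abs_of_nonneg)
    then show ?thesis by simp
  qed
  define x where "x = (s - real_of_int b) / (2 * real_of_int a)"
  have sx: "s = 2 * real_of_int a * x + real_of_int b" using ac by (simp add: x_def)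
  have "x \<notin> \<rat>" using irr unfolding sx by (metis Rats_add Rats_mult Rats_number_of Rats_of_int)
  moreover have "x > 0" unfolding x_def using sb ac by simp
  ultimately have x: "pirr x" by (simp add: pirr_def)
  have "4 * real_of_int a * (real_of_int a * x\<^sup>2 + real_of_int b * x + real_of_int c) = 0"
    using ss unfolding sx by (simp add: power2_eq_square algebra_simps)
  then have root: "real_of_int a * x\<^sup>2 + real_of_int b * x + real_of_int c = 0" using ac by simp
  have ndet: "n1 * n4 - n2 * n3 = int p"
  proof -
    have "n1 * n4 - n2 * n3 = int p * ((a1 * d1 - b1 * c1) * (a2 * d2 - b2 * c2))"
      unfolding n1_def n2_def n3_def n4_def by (simp add: algebra_simps)
    then show ?thesis using det by simp
  qed
  define y where "y = mob n1 n2 n3 n4 x"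
  define V W where "V = real_of_int n1 * x + real_of_int n2" and "W = real_of_int n3 * x + real_of_int n4"
  have VW: "W > 0" "V > 0" using mob_pos[of n1 n4 n2 n3 x] ndet p0 n \<open>x > 0\<close> by (auto simp: V_def W_def)
  have y: "y = V / W" by (simp add: y_def mob_def V_def W_def)
  let ?r = "real_of_int"
  have gr: "?r a * ?r n4 * ?r n4 - ?r b * ?r n4 * ?r n3 + ?r c * ?r n3 * ?r n3 = ?r k * ?r a'"
       "- 2 * ?r a * ?r n2 * ?r n4 + ?r b * (?r n1 * ?r n4 + ?r n2 * ?r n3) - 2 * ?r c * ?r n1 * ?r n3 = ?r k * ?r b'"
       "?r a * ?r n2 * ?r n2 - ?r b * ?r n1 * ?r n2 + ?r c * ?r n1 * ?r n1 = ?r k * ?r c'"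
    using arg_cong[OF g(1), of ?r] arg_cong[OF g(2), of ?r] arg_cong[OF g(3), of ?r] by simp_all
  have "?r k * ?r a' * V\<^sup>2 + ?r k * ?r b' * V * W + ?r k * ?r c' * W\<^sup>2
        = (?r n1 * ?r n4 - ?r n2 * ?r n3)\<^sup>2 * (?r a * x\<^sup>2 + ?r b * x + ?r c)"
    unfolding gr[symmetric] V_def W_def by (rule form_compose)
  also have "\<dots> = 0" unfolding root by simp
  finally have "?r k * (?r a' * V\<^sup>2 + ?r b' * V * W + ?r c' * W\<^sup>2) = 0" by (simp add: algebra_simps)
  then have "?r a' * V\<^sup>2 + ?r b' * V * W + ?r c' * W\<^sup>2 = 0" using m(3) by simp
  moreover have "?r a' * y\<^sup>2 + ?r b' * y + ?r c' = (?r a' * V\<^sup>2 + ?r b' * V * W + ?r c' * W\<^sup>2) / W\<^sup>2"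
    unfolding y using VW by (simp add: field_simps power2_eq_square)
  ultimately have rooty: "real_of_int a' * y\<^sup>2 + real_of_int b' * y + real_of_int c' = 0" by simp
  \<comment> \<open>The inverse matrix recovers x from y, so a rational y would make x
    rational.\<close>
  have xy: "x = (real_of_int n4 * y - real_of_int n2) / (real_of_int n1 - real_of_int n3 * y)"
  proof -
    have nd: "real_of_int n1 * real_of_int n4 - real_of_int n2 * real_of_int n3 = real p"
      using arg_cong[OF ndet, of real_of_int] by simp
    have "real_of_int n4 * V - real_of_int n2 * W = real p * x" "real_of_int n1 * W - real_of_int n3 * V = real p"
      unfolding V_def W_def nd[symmetric] by (simp_all add: algebra_simps)
    then have "real_of_int n4 * y - real_of_int n2 = real p * x / W" "real_of_int n1 - real_of_int n3 * y = real p / W"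
      unfolding y using VW by (simp_all add: field_simps)
    then show ?thesis using VW p0 by simp
  qed
  have "y \<notin> \<rat>"
  proof
    assume "y \<in> \<rat>"
    then have "x \<in> \<rat>" unfolding xy by (intro Rats_divide Rats_diff Rats_mult) auto
    then show False using x by (simp add: pirr_def)
  qed
  then have yp: "pirr y" using VW by (simp add: pirr_def y)
  have lx: "lam x \<le> ereal (s / m)" using lam_le_river[OF rv(1) m(1) x root] by (simp add: s_def)
  have ly: "lam y \<le> ereal (sqrt (real_of_int (b' * b' - 4 * a' * c')) / m')" using lam_le_river[OF rv(2) m(2) yp rooty] .
  define z where "z = (real_of_int a1 * x + real_of_int b1) / (real_of_int c1 * x + real_of_int d1)"
  have dz: "real_of_int c1 * x + real_of_int d1 \<noteq> 0" using det by (intro moebius_denom[OF x]) auto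
  have dy: "real_of_int c2 * y + real_of_int d2 \<noteq> 0" using det by (intro moebius_denom[OF yp]) auto
  have lz: "lam z = lam x" by (rule lam_moebius[OF _ dz z_def]) (use det in simp)
  have d2: "real_of_int a2 * real_of_int d2 - real_of_int b2 * real_of_int c2 = 1"
    using arg_cong[OF det(2), of real_of_int] by simp
  have "real_of_int a2 * V + real_of_int b2 * W = (real_of_int a2 * real_of_int d2 - real_of_int b2 * real_of_int c2) * (real p * (real_of_int a1 * x + real_of_int b1))"
    "real_of_int c2 * V + real_of_int d2 * W = (real_of_int a2 * real_of_int d2 - real_of_int b2 * real_of_int c2) * (real_of_int c1 * x + real_of_int d1)"
    unfolding V_def W_def n1_def n2_def n3_def n4_def by (simp_all add: algebra_simps)
  then have e: "real_of_int a2 * V + real_of_int b2 * W = real p * (real_of_int a1 * x + real_of_int b1)"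
    "real_of_int c2 * V + real_of_int d2 * W = real_of_int c1 * x + real_of_int d1" unfolding d2 by auto
  have "(real_of_int a2 * y + real_of_int b2) / (real_of_int c2 * y + real_of_int d2)
     = ((real_of_int a2 * V + real_of_int b2 * W) / W) / ((real_of_int c2 * V + real_of_int d2 * W) / W)"
    unfolding y using VW by (simp add: field_simps)
  also have "\<dots> = real p * z" unfolding e z_def using VW by simp
  finally have pz: "real p * z = (real_of_int a2 * y + real_of_int b2) / (real_of_int c2 * y + real_of_int d2)" ..
  have lpz: "lam (real p * z) = lam y" by (rule lam_moebius[OF _ dy pz]) (use det in simp)
  have "z \<notin> \<rat>"
  proof
    assume z: "z \<in> \<rat>"
    have "x * (real_of_int a1 - real_of_int c1 * z) = real_of_int d1 * z - real_of_int b1"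
      using dz unfolding z_def by (simp add: field_simps)
    moreover have "real_of_int a1 - real_of_int c1 * z \<noteq> 0"
    proof
      assume 0: "real_of_int a1 - real_of_int c1 * z = 0"
      have "real_of_int a1 * (real_of_int c1 * x + real_of_int d1) - real_of_int c1 * (real_of_int a1 * x + real_of_int b1) = 1"
        using arg_cong[OF det(1), of real_of_int] by (simp add: algebra_simps)
      moreover have "z * (real_of_int c1 * x + real_of_int d1) = real_of_int a1 * x + real_of_int b1" using dz by (simp add: z_def)
      moreover have "(real_of_int a1 - real_of_int c1 * z) * (real_of_int c1 * x + real_of_int d1)
        = real_of_int a1 * (real_of_int c1 * x + real_of_int d1) - real_of_int c1 * (z * (real_of_int c1 * x + real_of_int d1))"
        by (simp add: algebra_simps)
      ultimately have "(real_of_int a1 - real_of_int c1 * z) * (real_of_int c1 * x + real_of_int d1) = 1" by simp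
      then show False using 0 by simp
    qed
    ultimately have "x = (real_of_int d1 * z - real_of_int b1) / (real_of_int a1 - real_of_int c1 * z)" by (simp add: field_simps)
    then have "x \<in> \<rat>" using z by (metis Rats_diff Rats_divide Rats_mult Rats_of_int)
    then show False using x by (simp add: pirr_def)
  qed
  from spectrum_ex[OF p this lx[folded lz] ly[folded lpz] sqrt_div_less[OF l(1) m(1,4,5), folded s_def]
      sqrt_div_less[OF l(2) m(2,4,5)]] show ?thesis .
qed

section \<open>Finitely many values below a bound\<close>

definition fin_below :: "nat \<Rightarrow> real \<Rightarrow> bool" where
  "fin_below p K \<longleftrightarrow> (\<exists>V. finite V \<and> (\<forall>v\<in>V. sqrt_rat v) \<and>
     (\<forall>x. x \<notin> \<rat> \<longrightarrow> lam x < ereal K \<longrightarrow> lam (real p * x) < ereal K \<longrightarrow> max (lam x) (lam (real p * x)) \<in> V))"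

lemma fin_belowI:
  assumes W: "good W" and x: "\<And>x. pirr x \<Longrightarrow> lam x < ereal K \<Longrightarrow> lam (real p * x) < ereal K \<Longrightarrow> (lam x, lam (real p * x)) \<in> W"
  shows "fin_below p K"
  unfolding fin_below_def
proof (intro exI[of _ "(\<lambda>(u, v). max u v) ` W"] conjI allI impI)
  show "finite ((\<lambda>(u, v). max u v) ` W)" using W by (simp add: good_def)
  show "\<forall>v\<in>(\<lambda>(u, v). max u v) ` W. sqrt_rat v" using W by (auto simp: good_def max_def)
  fix x assume h: "x \<notin> \<rat>" "lam x < ereal K" "lam (real p * x) < ereal K"
  define k where "k = - \<lfloor>x\<rfloor>"
  have "real_of_int \<lfloor>x\<rfloor> \<noteq> x" using h(1) by (metis Rats_of_int)
  moreover have "real_of_int \<lfloor>x\<rfloor> \<le> x" by simp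
  ultimately have "x + real_of_int k > 0" unfolding k_def of_int_minus by linarith
  moreover have "x + real_of_int k \<notin> \<rat>" using h(1) by (metis Rats_diff Rats_of_int add_diff_cancel_right')
  ultimately have "pirr (x + real_of_int k)" by (simp add: pirr_def)
  moreover have "real p * (x + real_of_int k) = real p * x + real_of_int (int p * k)" by (simp add: algebra_simps)
  ultimately have "(lam (x + real_of_int k), lam (real p * x + real_of_int (int p * k))) \<in> W"
    using x[of "x + real_of_int k"] h by (metis lam_shift)
  then show "max (lam x) (lam (real p * x)) \<in> (\<lambda>(u, v). max u v) ` W"
    unfolding lam_shift by (rule rev_image_eqI) simp
qed

text \<open>With x also p x is irrational, so both values belong to the finite set for p = 1, and
  their maximum is one of them.\<close>

lemma fin_below_from_1:
  assumes "fin_below 1 K" "p > 0" shows "fin_below p K"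
proof -
  obtain V where V: "finite V" "\<forall>v\<in>V. sqrt_rat v"
    "\<And>x. x \<notin> \<rat> \<Longrightarrow> lam x < ereal K \<Longrightarrow> lam x \<in> V"
    using assms(1) unfolding fin_below_def by auto
  have "real p * x \<notin> \<rat>" if "x \<notin> \<rat>" for x
  proof
    assume "real p * x \<in> \<rat>"
    then have "real p * x / real p \<in> \<rat>" by (intro Rats_divide) auto
    then show False using that assms(2) by simp
  qed
  then show ?thesis unfolding fin_below_def using V
    by (intro exI[of _ V]) (auto simp: max_def simp del: One_nat_def)
qed

text \<open>Only finitely many spectrum points lie below K. Removing all but the least of them from
  the ray below K leaves an open set that meets the spectrum in that point alone.\<close>

lemma fin_below_min:
  assumes p: "prime p" and f: "fin_below p K" and e: "\<exists>y\<in>lagrange_spectrum p. y < K"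
  shows "\<exists>m. m \<in> lagrange_spectrum p \<and> (\<forall>x\<in>lagrange_spectrum p. m \<le> x)
           \<and> m isolated_in lagrange_spectrum p
           \<and> m \<notin> \<rat> \<and> (\<exists>q\<in>\<rat>. m = sqrt q)"
proof -
  define S where "S = {y \<in> lagrange_spectrum p. y < K}"
  obtain V where V: "finite V" "\<forall>v\<in>V. sqrt_rat v"
    "\<And>x. x \<notin> \<rat> \<Longrightarrow> lam x < ereal K \<Longrightarrow> lam (real p * x) < ereal K \<Longrightarrow> max (lam x) (lam (real p * x)) \<in> V"
    using f unfolding fin_below_def by auto
  have SV: "ereal y \<in> V" if yS: "y \<in> S" for y
  proof -
    obtain x where x: "x \<notin> \<rat>" "max (lam x) (lam (real p * x)) = ereal y"
      using yS unfolding S_def lagrange_spectrum_def lagrange_approx_prime[OF p] by blast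
    have "max (lam x) (lam (real p * x)) < ereal K" using x(2) yS S_def by simp
    then show ?thesis using V(3)[OF x(1)] x(2) by simp
  qed
  have fin: "finite S"
  proof (rule finite_imageD[of ereal])
    show "finite (ereal ` S)" using SV V(1) by (meson finite_subset image_subsetI)
  qed (simp add: inj_on_def)
  have ne: "S \<noteq> {}" using e S_def by auto
  define m where "m = Min S"
  have m: "m \<in> S" using fin ne m_def by simp
  have le: "\<forall>x\<in>lagrange_spectrum p. m \<le> x"
  proof
    fix x assume x: "x \<in> lagrange_spectrum p"
    show "m \<le> x"
    proof (cases "x < K")
      case True
      then show ?thesis using x fin unfolding m_def S_def by simp
    next
      case False
      then show ?thesis using m S_def by auto
    qed
  qed
  have iso: "m isolated_in lagrange_spectrum p"
  proof -
    have "open ({..<K} - (S - {m}))" using fin by (intro open_Diff finite_imp_closed) auto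
    moreover have "({..<K} - (S - {m})) \<inter> lagrange_spectrum p = {m}" using m unfolding S_def by auto
    moreover have "m \<in> lagrange_spectrum p" using m S_def by auto
    ultimately show ?thesis unfolding isolated_in_def by blast
  qed
  obtain q where "q \<in> \<rat>" "ereal m = ereal (sqrt q)" "sqrt q \<notin> \<rat>"
    using SV[OF m] V(2) unfolding sqrt_rat_def by blast
  then show ?thesis using m le iso S_def by (intro exI[of _ m]) auto
qed

section \<open>Evaluation of the certificates\<close>

definition alab :: "autom \<Rightarrow> nat \<Rightarrow> nat" where "alab au i = fst (au ! (i - 2))"

text \<open>Turns an automaton into one rewrite rule per state and direction, so that following a
  transition does not traverse the list.\<close>

primrec ntab :: "autom \<Rightarrow> nat \<Rightarrow> autom \<Rightarrow> bool" where
  "ntab au i [] = True"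
| "ntab au i (e # es) = (alab au i = fst e \<and> nxL au i = fst (snd e) \<and> nxR au i = snd (snd e) \<and> ntab au (i + 1) es)"

lemma ntab_drop: "es = drop (i - 2) au \<Longrightarrow> 2 \<le> i \<Longrightarrow> ntab au i es"
proof (induction es arbitrary: i)
  case (Cons e es)
  have "i - 2 < length au" using Cons.prems(1) by (metis drop_all leI list.distinct(1))
  then have "drop (i - 2) au = au ! (i - 2) # drop (Suc (i - 2)) au" by (rule Cons_nth_drop_Suc[symmetric])
  moreover have "Suc (i - 2) = i + 1 - 2" using Cons.prems(2) by simp
  ultimately have "drop (i - 2) au = au ! (i - 2) # drop (i + 1 - 2) au" by simp
  then have "e = au ! (i - 2)" "es = drop (i + 1 - 2) au" using Cons.prems(1) by auto
  then show ?case using Cons.IH[of "i + 1"] Cons.prems(2) by (simp add: alab_def nxL_def nxR_def)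
qed simp

lemma aut_rules: "au = es \<Longrightarrow> ntab au 2 es"
  by (simp add: ntab_drop)

section \<open>Checking an automaton\<close>

primrec suf :: "bool list \<Rightarrow> bool list \<Rightarrow> bool" where
  "suf v [] = (v = [])"
| "suf v (x # w) = (if v = x # w then True else suf v w)"

lemma suf_iff: "suf v w \<longleftrightarrow> length v \<le> length w \<and> drop (length w - length v) w = v"
proof (induction w)
  case (Cons x w)
  show ?case
  proof (cases "length v \<le> length w")
    case True
    then show ?thesis using Cons.IH by (auto simp: Suc_diff_le)
  next
    case False
    then show ?thesis using Cons.IH by (cases "length v = Suc (length w)") auto
  qed
qed auto

definition cut_ok :: "int \<Rightarrow> int \<Rightarrow> bool list \<Rightarrow> bool list \<Rightarrow> bool" where
  "cut_ok cn cd u v \<longleftrightarrow>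
     (case appq u (1, 4) of (m, n) \<Rightarrow> case appq v (1, 4) of (m', n') \<Rightarrow> cn * (n * n') \<le> cd * (m * n' + m' * n)) \<or>
     (case appq u (4, 1) of (m, n) \<Rightarrow> case appq v (4, 1) of (m', n') \<Rightarrow> cn * (m * m') \<le> cd * (m' * n + m * n'))"

text \<open>Moves the cut through the word one letter at a time, with the part before it kept
  reversed, as reading outwards from the cut requires.\<close>

primrec wins :: "int \<Rightarrow> int \<Rightarrow> bool list \<Rightarrow> bool list \<Rightarrow> bool" where
  "wins cn cd u [] = cut_ok cn cd u []"
| "wins cn cd u (x # v) = (if cut_ok cn cd u (x # v) then True else wins cn cd (x # u) v)"

lemma winq_cut: "winq cn cd w \<longleftrightarrow> (\<exists>i\<le>length w. cut_ok cn cd (rev (take i w)) (drop i w))"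
  by (simp add: winq_def list_ex_iff cut_ok_def Let_def Bex_def less_Suc_eq_le del: upt_Suc)

lemma wins_cut:
  "wins cn cd (rev u) v \<longleftrightarrow>
   (\<exists>i\<ge>length u. i \<le> length u + length v \<and> cut_ok cn cd (rev (take i (u @ v))) (drop i (u @ v)))"
proof (induction v arbitrary: u)
  case Nil
  then show ?case by (auto intro: exI[of _ "length u"])
next
  case (Cons x v)
  have e: "(\<exists>i\<ge>length u. i \<le> length u + length (x # v) \<and> P i) \<longleftrightarrow>
    P (length u) \<or> (\<exists>i\<ge>length (u @ [x]). i \<le> length (u @ [x]) + length v \<and> P i)" for P :: "nat \<Rightarrow> bool"
  proof
    assume "\<exists>i\<ge>length u. i \<le> length u + length (x # v) \<and> P i"
    then obtain i where "length u \<le> i" "i \<le> length u + length (x # v)" "P i" by blast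
    then show "P (length u) \<or> (\<exists>i\<ge>length (u @ [x]). i \<le> length (u @ [x]) + length v \<and> P i)"
      by (cases "i = length u") (auto intro!: exI[of _ i])
  next
    assume "P (length u) \<or> (\<exists>i\<ge>length (u @ [x]). i \<le> length (u @ [x]) + length v \<and> P i)"
    then show "\<exists>i\<ge>length u. i \<le> length u + length (x # v) \<and> P i"
    proof
      assume "P (length u)" then show ?thesis by (intro exI[of _ "length u"]) simp
    next
      assume "\<exists>i\<ge>length (u @ [x]). i \<le> length (u @ [x]) + length v \<and> P i"
      then obtain i where "length (u @ [x]) \<le> i" "i \<le> length (u @ [x]) + length v" "P i" by blast
      then show ?thesis by (intro exI[of _ i]) simp
    qed
  qed
  show ?case unfolding e using Cons.IH[of "u @ [x]"] by simp
qed

lemma forbid_rec: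
  "forbid cn cd 0 w = wins cn cd [] w"
  "forbid cn cd 1 w = (if wins cn cd [] w then True
     else if wins cn cd [] (w @ [True]) then wins cn cd [] (w @ [False]) else False)"
  "forbid cn cd (numeral n) w = (if wins cn cd [] w then True
     else if forbid cn cd (pred_numeral n) (w @ [True]) then forbid cn cd (pred_numeral n) (w @ [False]) else False)"
proof -
  have w: "wins cn cd [] v = winq cn cd v" for v
    using wins_cut[of cn cd "[]" v] by (simp add: winq_cut)
  show "forbid cn cd 0 w = wins cn cd [] w"
    "forbid cn cd 1 w = (if wins cn cd [] w then True
       else if wins cn cd [] (w @ [True]) then wins cn cd [] (w @ [False]) else False)"
    "forbid cn cd (numeral n) w = (if wins cn cd [] w then True
     else if forbid cn cd (pred_numeral n) (w @ [True]) then forbid cn cd (pred_numeral n) (w @ [False]) else False)"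
    by (simp_all add: w numeral_eq_Suc One_nat_def)
qed

lemma cut_ok_rec:
  "cut_ok cn cd u v =
     (case appq u (1, 4) of (m, n) \<Rightarrow> case appq v (1, 4) of (m', n') \<Rightarrow> if cn * (n * n') \<le> cd * (m * n' + m' * n) then True
      else case appq u (4, 1) of (m, n) \<Rightarrow> case appq v (4, 1) of (m', n') \<Rightarrow> cn * (m * m') \<le> cd * (m' * n + m * n'))"
  by (auto simp: cut_ok_def split: prod.splits)

definition step_ok :: "int \<Rightarrow> int \<Rightarrow> autom \<Rightarrow> nat \<Rightarrow> bool list \<Rightarrow> nat \<Rightarrow> bool" where
  "step_ok cn cd au n w t = (if t = 0 then forbid cn cd 8 w else if 2 \<le> t then if t < n
     then suf (lab (alab au t)) w else False else False)"

primrec steps_ok :: "int \<Rightarrow> int \<Rightarrow> autom \<Rightarrow> nat \<Rightarrow> autom \<Rightarrow> bool" where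
  "steps_ok cn cd au n [] = True"
| "steps_ok cn cd au n (e # es) = (if step_ok cn cd au n (lab (fst e) @ [True]) (fst (snd e)) then
     if step_ok cn cd au n (lab (fst e) @ [False]) (snd (snd e)) then steps_ok cn cd au n es else False else False)"

lemma aut_okI:
  assumes "au = es" "steps_ok cn cd au n es" "0 < cd" "es \<noteq> []" "fst (hd es) = 1" "n = length es + 2"
  shows "aut_ok cn cd au"
proof -
  have "trans_ok cn cd au w t" if "step_ok cn cd au n w t" for w t
    using that assms(1,6) by (auto simp: step_ok_def trans_ok_def alab_def suf_iff Let_def split: if_splits)
  moreover have "list_all (\<lambda>e. step_ok cn cd au n (lab (fst e) @ [True]) (fst (snd e)) \<and>
      step_ok cn cd au n (lab (fst e) @ [False]) (snd (snd e))) es"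
    using assms(2) by (induction es) (auto split: if_splits)
  ultimately show ?thesis using assms unfolding aut_ok_def list_all_iff by (auto simp: case_prod_beta)
qed

section \<open>Checking orbits and searches\<close>

lemma zmem_rec:
  "zmem [] a b c d i j = False"
  "zmem ((w, a', b', c', d', i', j') # zs) a b c d i j =
    (if (if a = a' then if b = b' then if c = c' then if d = d' then if i = i' then j = j'
      else False else False else False else False else False) then True else zmem zs a b c d i j)"
  by (auto simp: zmem_def)

lemma zchk_rec:
  "zchk au p z [] = True"
  "zchk au p z ((w, a, b, c, d, i, j) # zs) =
    (if DB p a b c d then if w = [] then False
       else if wk au z (a, b, c, d, i, j) w a b c d i j then zchk au p z zs else False else False)"
  by (auto simp: zchk_def)

lemma zlist_rule:
  assumes "zs = zs'"
  shows "zmem zs a b c d i j = zmem zs' a b c d i j" "zchk au p z zs = zchk au p z zs'"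
  using assms by auto

definition zor :: "zlist \<Rightarrow> zlist \<Rightarrow> zpred" where
  "zor zs1 zs2 a b c d i j = (if zmem zs1 a b c d i j then True else zmem zs2 a b c d i j)"

definition cert :: "autom \<Rightarrow> zlist \<Rightarrow> zlist \<Rightarrow> int \<Rightarrow> bool" where
  "cert au zs1 zs2 p \<longleftrightarrow> zchk au p (zmem []) zs1 \<and> zchk au p (zmem zs1) zs2 \<and> search_ok au (zor zs1 zs2) p"

lemma certI:
  "zchk au p (zmem []) zs1 \<Longrightarrow> zchk au p (zmem zs1) zs2 \<Longrightarrow> em au p (zor zs1 zs2) 1 0 0 p 2 2 \<Longrightarrow>
   en au (zor zs1 zs2) p 1 0 1 1 \<Longrightarrow> cert au zs1 zs2 p"
  by (simp add: cert_def search_ok_def)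

definition isolated_min :: "nat \<Rightarrow> bool" where
  "isolated_min p \<longleftrightarrow> (\<exists>m. m \<in> lagrange_spectrum p \<and> (\<forall>x\<in>lagrange_spectrum p. m \<le> x)
           \<and> m isolated_in lagrange_spectrum p \<and> m \<notin> \<rat> \<and> (\<exists>q\<in>\<rat>. m = sqrt q))"

lemma cert_fin_below:
  assumes "aut_ok cn cd au" "cn \<le> 4 * cd" "cert au zs1 zs2 (int p)" "int p = 1 \<or> prime p"
  shows "fin_below p (real_of_int cn / real_of_int cd)"
proof -
  have z: "zchk au (int p) (zmem []) zs1" "zchk au (int p) (zmem zs1) zs2" "search_ok au (zor zs1 zs2) (int p)"
    using assms(3) unfolding cert_def by blast+
  have pp: "int p = 1 \<or> prime (int p)" using assms(4) by (metis prime_nat_int_transfer)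
  have zz: "zor zs1 zs2 a b c d i j \<Longrightarrow> zmem (zs1 @ zs2) a b c d i j" for a b c d i j
    by (auto simp: zor_def zmem_def split: if_splits)
  obtain W where W: "good W" "\<forall>x. pirr x \<longrightarrow> lam x < ereal (real_of_int cn / real_of_int cd) \<longrightarrow>
     lam (real_of_int (int p) * x) < ereal (real_of_int cn / real_of_int cd) \<longrightarrow> (lam x, lam (real_of_int (int p) * x)) \<in> W"
    using search_sound[OF assms(1,2) pp z zz] by blast
  show ?thesis
    by (rule fin_belowI[OF W(1)]) (use W(2) in \<open>simp only: of_int_of_nat_eq\<close>)
qed

lemma isolated_minI:
  assumes "prime p" "int p = q" "aut_ok cn cd au" "cn \<le> 4 * cd" "cert au zs1 zs2 q"
    "wit cn cd q (a1, b1, c1, d1) (a2, b2, c2, d2) (a, b, c, m) (a', b', c', m') k r"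
  shows "isolated_min p"
  unfolding isolated_min_def
proof (rule fin_below_min[OF assms(1)])
  show "fin_below p (real_of_int cn / real_of_int cd)"
    using assms(1) by (intro cert_fin_below[OF assms(3,4) assms(5)[folded assms(2)]]) blast
  show "\<exists>y\<in>lagrange_spectrum p. y < real_of_int cn / real_of_int cd"
    by (rule spectrum_wit[OF assms(1) assms(6)[folded assms(2)]])
qed

lemma lab_numeral: "lab (numeral n) = bits n"
  by (simp add: lab_def)

lemma lab_1: "lab 1 = []"
  by (simp add: lab_def num_of_nat.simps)

text \<open>Under weak congruence for conditionals these rules evaluate a search: a condition first,
  by arithmetic on binary numerals, and then only the chosen branch.\<close>

lemmas compute_rules = em_eq stp_def seed_def seed'_def en_eq wk_eq here_def DB_def zor_def zmem_rec zchk_rec river_eq same_def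
  lab_numeral bits.simps append.simps list.distinct list.inject prod.inject if_True if_False arith_simps rel_simps arith_special
  simp_thms div_0 div_by_0 div_by_1 one_div_numeral numeral_div_numeral divmod_trivial divmod_cancel divmod_steps
  divmod_step_def fst_conv snd_conv case_prod_beta euclidean_size_int_less_eq_iff abs_numeral abs_zero abs_one
  numeral_One mult_1_left mult_1_right mult_zero_left mult_zero_right Let_def prod.case list.pred_inject
  forbid_rec pred_numeral_simps step_ok_def steps_ok.simps suf.simps wins.simps cut_ok_rec appq.simps minus_minus lab_1

text \<open>An automaton \<open>Ai\<close> rejects words whose occurrence forces a value above its bound. The lists \<open>Zp\<close> are the closed
  orbits on which the search for \<open>p\<close> ends; deviations from the orbits in \<open>Yp\<close> may run into those in \<open>Zp\<close>, which
  happens when heteroclinic paths stay below the bound.\<close>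

definition A1 :: autom where
  "A1 = [
    (1, 3, 4), (3, 5, 6), (2, 7, 8), (7, 0, 9), (6, 10, 11), (5, 12, 13), (4, 14, 0), (14, 15, 16), (13, 17, 18),
    (12, 19, 0), (11, 0, 20), (10, 21, 22), (9, 23, 24), (29, 0, 25), (28, 26, 0), (27, 0, 27), (26, 28, 22), (25,
    29, 30), (22, 31, 32), (21, 17, 33), (20, 34, 0), (19, 0, 35), (18, 36, 0), (58, 37, 38), (57, 39, 40), (54, 0,
    41), (53, 42, 43), (51, 0, 44), (50, 45, 0), (45, 0, 46), (44, 47, 0), (42, 48, 49), (41, 50, 0), (38, 51, 52),
    (37, 53, 54), (117, 0, 43), (116, 55, 0), (115, 0, 56), (114, 57, 0), (108, 58, 0), (107, 0, 59), (106, 60,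
    61), (102, 51, 62), (101, 53, 63), (90, 64, 38), (89, 65, 40), (85, 66, 67), (84, 68, 0), (83, 0, 69), (77, 0,
    70), (76, 71, 0), (75, 0, 72), (74, 48, 0), (233, 73, 0), (230, 74, 62), (229, 75, 63), (217, 76, 40), (214, 0,
    77), (213, 0, 67), (212, 78, 0), (204, 79, 0), (202, 80, 0), (181, 0, 81), (179, 0, 82), (171, 0, 83), (170,
    60, 0), (169, 84, 0), (166, 51, 85), (154, 64, 86), (153, 65, 87), (150, 0, 88), (467, 0, 89), (461, 0, 90),
    (459, 0, 91), (435, 0, 92), (428, 93, 0), (425, 94, 0), (409, 95, 87), (405, 96, 67), (362, 60, 97), (358, 74,
    98), (342, 0, 99), (339, 0, 100), (332, 101, 0), (308, 102, 0), (306, 103, 0), (300, 104, 0), (934, 105, 85),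
    (922, 0, 86), (918, 0, 106), (870, 0, 98), (857, 0, 40), (851, 0, 107), (819, 0, 108), (811, 0, 109), (724,
    110, 0), (716, 111, 0), (684, 112, 0), (678, 51, 0), (665, 95, 0), (617, 113, 0), (613, 75, 0), (601, 76, 114),
    (1869, 0, 115), (1836, 116, 0), (1702, 117, 0), (1638, 0, 98), (1622, 0, 118), (1449, 119, 0), (1433, 95, 0),
    (1369, 0, 120), (1235, 0, 121), (1202, 122, 0), (3738, 0, 86), (3673, 0, 114), (3405, 0, 123), (3244, 124, 0),
    (2899, 0, 125), (2738, 126, 0), (2470, 105, 0), (2405, 75, 0), (6810, 127, 86), (6489, 0, 128), (5798, 129, 0),
    (5477, 75, 130), (13621, 0, 131), (12978, 132, 0), (11597, 0, 133), (10954, 134, 0), (27242, 0, 97), (25957, 0,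
    130), (23194, 127, 0), (21909, 96, 0)]"

lemmas A1_simps = aut_rules[OF A1_def, simplified]

lemma A1_ok: "aut_ok 2997 1000 A1"
  by (rule aut_okI[OF A1_def, of _ _ 135], simp only: A1_simps compute_rules cong: if_weak_cong) simp_all

text \<open>For p = 1 the identity is the only doubly balanced matrix. The words have runs of
  lengths 1, of lengths 2, and of cyclic patterns 2, 2, 1, 1 and 2, 2, 1, 1, 1, 1: the continued
  fraction periods of the four Markov values below 2.997. The last two patterns occur also with the
  letters exchanged.\<close>

definition Z1 :: zlist where
  "Z1 = [(lab 5, 1, 0, 0, 1, 60, 60), (lab 75, 1, 0, 0, 1, 75, 75), (lab 299, 1, 0, 0, 1, 96, 96), (lab 19, 1, 0, 0, 1,
    95, 95), (lab 116, 1, 0, 0, 1, 86, 86), (lab 468, 1, 0, 0, 1, 97, 97)]"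

lemmas Z1_rule = zlist_rule[OF Z1_def, unfolded zmem_rec zchk_rec]

lemma cert_1: "cert A1 Z1 [] 1"
  by (rule certI; simp only: A1_simps Z1_rule compute_rules cong: if_weak_cong)

definition A2 :: autom where
  "A2 = [
    (1, 3, 4), (3, 5, 6), (2, 7, 8), (7, 0, 9), (6, 10, 8), (5, 5, 11), (4, 12, 0), (14, 13, 14), (13, 15, 16),
    (10, 17, 18), (9, 19, 20), (29, 0, 21), (28, 22, 0), (27, 0, 23), (26, 24, 18), (21, 15, 25), (20, 26, 0), (19,
    0, 27), (18, 28, 0), (58, 29, 18), (57, 30, 20), (54, 0, 14), (53, 31, 25), (42, 24, 32), (41, 19, 0), (38, 13,
    33), (37, 15, 34), (117, 0, 25), (115, 0, 35), (107, 0, 36), (84, 37, 0), (76, 38, 0), (74, 24, 0), (230, 39,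
    33), (214, 0, 40), (169, 41, 0), (153, 30, 42), (461, 0, 43), (428, 44, 0), (339, 0, 45), (306, 46, 0), (922,
    0, 18), (857, 0, 20), (678, 13, 0), (613, 15, 0)]"

lemmas A2_simps = aut_rules[OF A2_def, simplified]

lemma A2_ok: "aut_ok 3006 1000 A2"
  by (rule aut_okI[OF A2_def, of _ _ 47], simp only: A2_simps compute_rules cong: if_weak_cong) simp_all

definition Z1093 :: zlist where
  "Z1093 = [(lab 5858645, 32, 3, 9, 35, 24, 19), (lab 5059925, 32, 9, 3, 35, 24, 22)]"

lemmas Z1093_rule = zlist_rule[OF Z1093_def, unfolded zmem_rec zchk_rec]

lemma cert_1093: "cert A2 Z1093 [] 1093"
  by (rule certI; simp only: A2_simps Z1093_rule compute_rules cong: if_weak_cong)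

definition Z1787 :: zlist where
  "Z1787 = [(lab 22897972630, 43, 7, 15, 44, 23, 36), (lab 28360487626, 46, 13, 43, 51, 34, 25)]"

lemmas Z1787_rule = zlist_rule[OF Z1787_def, unfolded zmem_rec zchk_rec]

lemma cert_1787: "cert A2 Z1787 [] 1787"
  by (rule certI; simp only: A2_simps Z1787_rule compute_rules cong: if_weak_cong)

definition Z1987 :: zlist where
  "Z1987 = [(lab 6925002, 47, 12, 42, 53, 34, 25), (lab 5584217, 44, 13, 13, 49, 44, 24)]"

lemmas Z1987_rule = zlist_rule[OF Z1987_def, unfolded zmem_rec zchk_rec]

lemma cert_1987: "cert A2 Z1987 [] 1987"
  by (rule certI; simp only: A2_simps Z1987_rule compute_rules cong: if_weak_cong)

definition A3 :: autom where
  "A3 = [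
    (1, 3, 4), (3, 5, 6), (2, 7, 8), (7, 0, 9), (6, 10, 8), (5, 5, 11), (4, 12, 0), (14, 13, 8), (13, 14, 11), (10,
    10, 15), (9, 5, 16), (29, 0, 11), (27, 0, 17), (20, 18, 0), (18, 10, 0), (54, 0, 8), (41, 5, 0)]"

lemmas A3_simps = aut_rules[OF A3_def, simplified]

lemma A3_ok: "aut_ok 3060 1000 A3"
  by (rule aut_okI[OF A3_def, of _ _ 19], simp only: A3_simps compute_rules cong: if_weak_cong) simp_all

definition Z227 :: zlist where
  "Z227 = [(lab 2713, 15, 4, 7, 17, 12, 5), (lab 2902, 21, 2, 2, 11, 17, 18), (lab 3241, 11, 2, 2, 21, 18, 17),
    (lab 3690, 17, 4, 7, 15, 11, 11)]"

lemmas Z227_rule = zlist_rule[OF Z227_def, unfolded zmem_rec zchk_rec]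

lemma cert_227: "cert A3 Z227 [] 227"
  by (rule certI; simp only: A3_simps Z227_rule compute_rules cong: if_weak_cong)

definition Z277 :: zlist where
  "Z277 = [(lab 6712114, 16, 1, 11, 18, 16, 17), (lab 5557606, 19, 7, 12, 19, 9, 11)]"

lemmas Z277_rule = zlist_rule[OF Z277_def, unfolded zmem_rec zchk_rec]

lemma cert_277: "cert A3 Z277 [] 277"
  by (rule certI; simp only: A3_simps Z277_rule compute_rules cong: if_weak_cong)

definition Z283 :: zlist where
  "Z283 = [(lab 5876938, 17, 1, 6, 17, 11, 9), (lab 5852374, 17, 4, 10, 19, 17, 9)]"

lemmas Z283_rule = zlist_rule[OF Z283_def, unfolded zmem_rec zchk_rec]

lemma cert_283: "cert A3 Z283 [] 283"
  by (rule certI; simp only: A3_simps Z283_rule compute_rules cong: if_weak_cong)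

definition Z997 :: zlist where
  "Z997 = [(lab 30964081970, 27, 1, 2, 37, 16, 8), (lab 24265305302, 35, 13, 31, 40, 17, 9)]"

lemmas Z997_rule = zlist_rule[OF Z997_def, unfolded zmem_rec zchk_rec]

lemma cert_997: "cert A3 Z997 [] 997"
  by (rule certI; simp only: A3_simps Z997_rule compute_rules cong: if_weak_cong)

definition Z1213 :: zlist where
  "Z1213 = [(lab 5453209, 35, 18, 24, 47, 12, 5), (lab 2453, 32, 19, 17, 48, 10, 10), (lab 2765, 32, 17, 19, 48, 13, 5),
    (lab 2902, 38, 11, 21, 38, 17, 17), (lab 3241, 38, 21, 11, 38, 18, 18), (lab 5453209, 35, 11, 17, 40, 12, 5)]"

lemmas Z1213_rule = zlist_rule[OF Z1213_def, unfolded zmem_rec zchk_rec]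

lemma cert_1213: "cert A3 Z1213 [] 1213"
  by (rule certI; simp only: A3_simps Z1213_rule compute_rules cong: if_weak_cong)

definition Z1637 :: zlist where
  "Z1637 = [(lab 5870797, 39, 4, 10, 43, 13, 5), (lab 7025305, 33, 2, 23, 51, 12, 5)]"

lemmas Z1637_rule = zlist_rule[OF Z1637_def, unfolded zmem_rec zchk_rec]

lemma cert_1637: "cert A3 Z1637 [] 1637"
  by (rule certI; simp only: A3_simps Z1637_rule compute_rules cong: if_weak_cong)

definition Z1907 :: zlist where
  "Z1907 = [(lab 7547290, 36, 1, 1, 53, 11, 8), (lab 5852374, 53, 22, 41, 53, 17, 9)]"

lemmas Z1907_rule = zlist_rule[OF Z1907_def, unfolded zmem_rec zchk_rec]

lemma cert_1907: "cert A3 Z1907 [] 1907"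
  by (rule certI; simp only: A3_simps Z1907_rule compute_rules cong: if_weak_cong)

definition A4 :: autom where
  "A4 = [
    (1, 3, 4), (3, 5, 6), (2, 7, 8), (7, 0, 9), (6, 10, 8), (5, 5, 11), (4, 12, 0), (14, 13, 14), (13, 15, 11),
    (10, 10, 16), (9, 17, 18), (29, 19, 11), (28, 20, 0), (27, 0, 21), (20, 22, 0), (19, 0, 23), (18, 10, 24), (59,
    0, 25), (57, 26, 18), (54, 0, 14), (41, 17, 0), (38, 13, 27), (36, 28, 0), (118, 0, 29), (115, 0, 30), (76, 31,
    0), (73, 32, 0), (236, 33, 0), (230, 34, 27), (153, 26, 35), (147, 0, 36), (473, 0, 18), (461, 0, 11), (306,
    10, 0), (294, 13, 0)]"

lemmas A4_simps = aut_rules[OF A4_def, simplified]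

lemma A4_ok: "aut_ok 3100 1000 A4"
  by (rule aut_okI[OF A4_def, of _ _ 37], simp only: A4_simps compute_rules cong: if_weak_cong) simp_all

definition Z1123 :: zlist where
  "Z1123 = [(lab 1798515401, 36, 19, 11, 37, 28, 22), (lab 1722968729, 34, 27, 5, 37, 31, 36), (lab 1520880230, 36, 11,
    19, 37, 30, 11), (lab 1724560178, 34, 5, 27, 37, 35, 23)]"

lemmas Z1123_rule = zlist_rule[OF Z1123_def, unfolded zmem_rec zchk_rec]

lemma cert_1123: "cert A4 Z1123 [] 1123"
  by (rule certI; simp only: A4_simps Z1123_rule compute_rules cong: if_weak_cong)

definition A5 :: autom where
  "A5 = [
    (1, 3, 4), (3, 5, 6), (2, 7, 8), (7, 0, 6), (6, 9, 8), (5, 5, 10), (4, 7, 0), (13, 11, 10), (10, 9, 12), (27,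
    0, 13), (20, 14, 0), (54, 0, 8), (41, 5, 0)]"

lemmas A5_simps = aut_rules[OF A5_def, simplified]

lemma A5_ok: "aut_ok 3140 1000 A5"
  by (rule aut_okI[OF A5_def, of _ _ 15], simp only: A5_simps compute_rules cong: if_weak_cong) simp_all

definition Z547 :: zlist where
  "Z547 = [(lab 373542, 25, 6, 13, 25, 6, 13), (lab 421065, 19, 12, 13, 37, 14, 13)]"

lemmas Z547_rule = zlist_rule[OF Z547_def, unfolded zmem_rec zchk_rec]

lemma cert_547: "cert A5 Z547 [] 547"
  by (rule certI; simp only: A5_simps Z547_rule compute_rules cong: if_weak_cong)

definition Z557 :: zlist where
  "Z557 = [(lab 421065, 17, 2, 2, 33, 14, 6), (lab 367410, 25, 4, 17, 25, 10, 6)]"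

lemmas Z557_rule = zlist_rule[OF Z557_def, unfolded zmem_rec zchk_rec]

lemma cert_557: "cert A5 Z557 [] 557"
  by (rule certI; simp only: A5_simps Z557_rule compute_rules cong: if_weak_cong)

definition Z643 :: zlist where
  "Z643 = [(lab 468588, 25, 1, 7, 26, 8, 8), (lab 421065, 18, 7, 11, 40, 14, 6)]"

lemmas Z643_rule = zlist_rule[OF Z643_def, unfolded zmem_rec zchk_rec]

lemma cert_643: "cert A5 Z643 [] 643"
  by (rule certI; simp only: A5_simps Z643_rule compute_rules cong: if_weak_cong)

definition Z683 :: zlist where
  "Z683 = [(lab 314777, 29, 19, 19, 36, 7, 5), (lab 471654, 27, 10, 10, 29, 6, 8)]"

lemmas Z683_rule = zlist_rule[OF Z683_def, unfolded zmem_rec zchk_rec]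

lemma cert_683: "cert A5 Z683 [] 683"
  by (rule certI; simp only: A5_simps Z683_rule compute_rules cong: if_weak_cong)

definition Z853 :: zlist where
  "Z853 = [(lab 92966, 32, 9, 19, 32, 6, 13), (lab 103641, 32, 19, 9, 32, 7, 14), (lab 86838, 31, 9, 12, 31, 13, 10),
    (lab 109769, 31, 12, 9, 31, 14, 9)]"

lemmas Z853_rule = zlist_rule[OF Z853_def, unfolded zmem_rec zchk_rec]

lemma cert_853: "cert A5 Z853 [] 853"
  by (rule certI; simp only: A5_simps Z853_rule compute_rules cong: if_weak_cong)

definition Z1237 :: zlist where
  "Z1237 = [(lab 91347, 35, 31, 3, 38, 5, 9), (lab 85398, 35, 3, 31, 38, 13, 7)]"

lemmas Z1237_rule = zlist_rule[OF Z1237_def, unfolded zmem_rec zchk_rec]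

lemma cert_1237: "cert A5 Z1237 [] 1237"
  by (rule certI; simp only: A5_simps Z1237_rule compute_rules cong: if_weak_cong)

definition Z1747 :: zlist where
  "Z1747 = [(lab 349401, 43, 4, 4, 41, 7, 9), (lab 444842, 37, 2, 33, 49, 10, 13), (lab 437030, 41, 4, 4, 43, 6, 10),
    (lab 373418, 49, 2, 33, 37, 10, 9), (lab 419021, 35, 6, 18, 53, 9, 5), (lab 365366, 49, 19, 37, 50, 13, 13)]"

lemmas Z1747_rule = zlist_rule[OF Z1747_def, unfolded zmem_rec zchk_rec]

lemma cert_1747: "cert A5 Z1747 [] 1747"
  by (rule certI; simp only: A5_simps Z1747_rule compute_rules cong: if_weak_cong)

definition Z1997 :: zlist where
  "Z1997 = [(lab 374171338, 45, 2, 14, 45, 10, 6), (lab 382559434, 47, 9, 34, 49, 10, 6)]"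

lemmas Z1997_rule = zlist_rule[OF Z1997_def, unfolded zmem_rec zchk_rec]

lemma cert_1997: "cert A5 Z1997 [] 1997"
  by (rule certI; simp only: A5_simps Z1997_rule compute_rules cong: if_weak_cong)

definition A6 :: autom where
  "A6 = [
    (1, 3, 4), (3, 5, 6), (2, 7, 8), (7, 0, 6), (6, 9, 10), (5, 11, 12), (4, 7, 0), (13, 13, 12), (12, 14, 0), (11,
    0, 15), (10, 9, 16), (27, 0, 17), (25, 18, 12), (22, 9, 19), (20, 20, 0), (54, 0, 21), (51, 0, 22), (44, 23,
    0), (41, 24, 0), (108, 25, 0), (102, 26, 19), (89, 18, 27), (83, 0, 28), (217, 29, 27), (205, 30, 12), (178, 9,
    31), (166, 26, 32), (435, 0, 33), (411, 0, 34), (356, 35, 0), (332, 36, 0), (870, 37, 19), (822, 0, 38), (713,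
    39, 0), (665, 18, 40), (1741, 0, 12), (1644, 41, 0), (1427, 0, 42), (1330, 9, 0), (3289, 43, 27), (2854, 26,
    44), (6579, 0, 45), (5708, 46, 0), (13158, 0, 19), (11417, 18, 0)]"

lemmas A6_simps = aut_rules[OF A6_def, simplified]

lemma A6_ok: "aut_ok 3120 1000 A6"
  by (rule aut_okI[OF A6_def, of _ _ 47], simp only: A6_simps compute_rules cong: if_weak_cong) simp_all

definition Z397 :: zlist where
  "Z397 = [(lab 373542, 20, 1, 3, 20, 42, 34), (lab 471654, 17, 3, 15, 26, 22, 27)]"

lemmas Z397_rule = zlist_rule[OF Z397_def, unfolded zmem_rec zchk_rec]

lemma cert_397: "cert A6 Z397 [] 397"
  by (rule certI; simp only: A6_simps Z397_rule compute_rules cong: if_weak_cong)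

definition A7 :: autom where
  "A7 = [
    (1, 3, 4), (3, 5, 6), (2, 7, 8), (7, 0, 9), (6, 10, 8), (5, 5, 11), (4, 12, 0), (14, 13, 14), (13, 15, 16),
    (10, 17, 18), (9, 19, 20), (29, 21, 16), (28, 22, 0), (27, 0, 23), (26, 24, 18), (21, 15, 25), (20, 26, 0),
    (19, 0, 27), (18, 17, 28), (59, 0, 29), (57, 19, 30), (54, 31, 14), (53, 32, 25), (42, 24, 33), (41, 19, 34),
    (38, 35, 14), (36, 36, 0), (118, 0, 14), (114, 37, 28), (109, 0, 38), (107, 0, 39), (84, 40, 0), (82, 41, 0),
    (77, 21, 42), (73, 19, 0), (229, 43, 25), (218, 0, 18), (214, 0, 14), (169, 19, 0), (165, 15, 0), (154, 24,
    44), (459, 0, 45), (308, 46, 0), (918, 47, 14), (617, 19, 48), (1837, 0, 49), (1234, 50, 0), (3674, 0, 51),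
    (2469, 52, 0), (7348, 53, 0), (4939, 0, 54), (14697, 0, 34), (9878, 31, 0)]"

lemmas A7_simps = aut_rules[OF A7_def, simplified]

lemma A7_ok: "aut_ok 3168 1000 A7"
  by (rule aut_okI[OF A7_def, of _ _ 55], simp only: A7_simps compute_rules cong: if_weak_cong) simp_all

definition Z1597 :: zlist where
  "Z1597 = [(lab 25216587718354534, 42, 11, 19, 43, 27, 38), (lab 29671035958093417, 42, 19, 11, 43, 46, 22)]"

lemmas Z1597_rule = zlist_rule[OF Z1597_def, unfolded zmem_rec zchk_rec]

lemma cert_1597: "cert A7 Z1597 [] 1597"
  by (rule certI; simp only: A7_simps Z1597_rule compute_rules cong: if_weak_cong)

definition A8 :: autom where
  "A8 = [
    (1, 3, 4), (3, 5, 6), (2, 7, 8), (7, 0, 9), (6, 10, 8), (5, 5, 11), (4, 12, 0), (14, 13, 8), (13, 14, 15), (10,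
    16, 17), (9, 5, 18), (29, 19, 15), (27, 0, 20), (26, 21, 17), (21, 14, 22), (20, 23, 0), (18, 16, 24), (59, 0,
    25), (54, 26, 8), (53, 27, 22), (42, 21, 28), (41, 5, 29), (36, 30, 0), (118, 0, 8), (109, 0, 15), (107, 0,
    31), (84, 32, 0), (82, 16, 0), (73, 5, 0), (214, 33, 8), (169, 5, 34), (429, 0, 35), (338, 36, 0), (858, 0,
    17), (677, 14, 0)]"

lemmas A8_simps = aut_rules[OF A8_def, simplified]

lemma A8_ok: "aut_ok 3220 1000 A8"
  by (rule aut_okI[OF A8_def, of _ _ 37], simp only: A8_simps compute_rules cong: if_weak_cong) simp_all

definition Z317 :: zlist where
  "Z317 = [(lab 5680426, 19, 4, 11, 19, 22, 35), (lab 7645546, 18, 5, 5, 19, 22, 17)]"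

lemmas Z317_rule = zlist_rule[OF Z317_def, unfolded zmem_rec zchk_rec]

lemma cert_317: "cert A8 Z317 [] 317"
  by (rule certI; simp only: A8_simps Z317_rule compute_rules cong: if_weak_cong)

definition Z347 :: zlist where
  "Z347 = [(lab 693865, 19, 2, 7, 19, 23, 27), (lab 961842, 19, 2, 7, 19, 18, 22), (lab 710054, 21, 8, 17, 23, 9, 22),
    (lab 697754, 23, 8, 17, 21, 15, 35)]"

lemmas Z347_rule = zlist_rule[OF Z347_def, unfolded zmem_rec zchk_rec]

lemma cert_347: "cert A8 Z347 [] 347"
  by (rule certI; simp only: A8_simps Z347_rule compute_rules cong: if_weak_cong)

definition Z587 :: zlist where
  "Z587 = [(lab 1680790, 25, 2, 19, 25, 20, 12), (lab 6806, 25, 3, 21, 26, 20, 32), (lab 6506, 23, 4, 20, 29, 22, 22),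
    (lab 5481, 23, 8, 10, 29, 23, 16), (lab 1680790, 24, 7, 19, 30, 20, 15), (lab 6486, 26, 3, 21, 25, 31, 21)]"

lemmas Z587_rule = zlist_rule[OF Z587_def, unfolded zmem_rec zchk_rec]

lemma cert_587: "cert A8 Z587 [] 587"
  by (rule certI; simp only: A8_simps Z587_rule compute_rules cong: if_weak_cong)

definition Z773 :: zlist where
  "Z773 = [(lab 30763472538, 27, 2, 5, 29, 15, 29), (lab 22223958741, 29, 2, 5, 27, 21, 5)]"

lemmas Z773_rule = zlist_rule[OF Z773_def, unfolded zmem_rec zchk_rec]

lemma cert_773: "cert A8 Z773 [] 773"
  by (rule certI; simp only: A8_simps Z773_rule compute_rules cong: if_weak_cong)

definition Z1163 :: zlist where
  "Z1163 = [(lab 19283, 34, 9, 3, 35, 5, 14), (lab 21197, 39, 23, 2, 31, 13, 36), (lab 27954, 31, 2, 23, 39, 18, 35),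
    (lab 29898, 35, 9, 3, 34, 22, 17), (lab 26969, 31, 23, 2, 39, 12, 29), (lab 22182, 39, 2, 23, 31, 9, 26),
    (lab 19253, 34, 3, 9, 35, 21, 14), (lab 1685, 36, 19, 7, 36, 21, 36), (lab 29868, 35, 3, 9, 34, 8, 17),
    (lab 1685, 41, 37, 14, 41, 21, 36), (lab 1386, 36, 7, 19, 36, 22, 35), (lab 1386, 41, 14, 37, 41, 22, 35)]"

lemmas Z1163_rule = zlist_rule[OF Z1163_def, unfolded zmem_rec zchk_rec]

lemma cert_1163: "cert A8 Z1163 [] 1163"
  by (rule certI; simp only: A8_simps Z1163_rule compute_rules cong: if_weak_cong)

definition Z1693 :: zlist where
  "Z1693 = [(lab 1325, 40, 9, 3, 43, 26, 16), (lab 1385, 40, 3, 9, 43, 23, 26), (lab 1622, 35, 4, 23, 51, 31, 22),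
    (lab 1701, 35, 23, 4, 51, 36, 31)]"

lemmas Z1693_rule = zlist_rule[OF Z1693_def, unfolded zmem_rec zchk_rec]

lemma cert_1693: "cert A8 Z1693 [] 1693"
  by (rule certI; simp only: A8_simps Z1693_rule compute_rules cong: if_weak_cong)

definition Z1867 :: zlist where
  "Z1867 = [(lab 1205, 44, 17, 17, 49, 21, 14), (lab 1866, 45, 4, 17, 43, 22, 31), (lab 1866, 49, 17, 17, 44, 22, 17),
    (lab 1449, 43, 4, 17, 45, 32, 14)]"

lemmas Z1867_rule = zlist_rule[OF Z1867_def, unfolded zmem_rec zchk_rec]

lemma cert_1867: "cert A8 Z1867 [] 1867"
  by (rule certI; simp only: A8_simps Z1867_rule compute_rules cong: if_weak_cong)

definition A9 :: autom where
  "A9 = [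
    (1, 3, 4), (3, 5, 6), (2, 7, 8), (7, 0, 9), (6, 10, 11), (5, 12, 13), (4, 14, 0), (14, 15, 11), (13, 16, 17),
    (12, 18, 0), (11, 0, 19), (10, 20, 21), (9, 12, 22), (29, 23, 17), (27, 0, 24), (26, 25, 21), (25, 12, 26),
    (22, 27, 11), (21, 16, 28), (20, 29, 0), (18, 20, 30), (59, 0, 31), (54, 32, 11), (53, 33, 28), (50, 34, 30),
    (45, 23, 35), (42, 25, 36), (41, 12, 37), (36, 38, 0), (118, 0, 11), (109, 39, 35), (107, 0, 40), (101, 41,
    28), (90, 25, 42), (84, 43, 0), (82, 34, 44), (73, 12, 0), (219, 0, 45), (214, 46, 11), (203, 0, 47), (180, 48,
    0), (169, 12, 49), (164, 50, 0), (438, 0, 51), (429, 0, 35), (406, 52, 11), (361, 12, 53), (338, 34, 0), (329,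
    54, 0), (876, 55, 0), (813, 0, 35), (722, 34, 0), (659, 0, 56), (1753, 0, 26), (1318, 27, 0)]"

lemmas A9_simps = aut_rules[OF A9_def, simplified]

lemma A9_ok: "aut_ok 3260 1000 A9"
  by (rule aut_okI[OF A9_def, of _ _ 57], simp only: A9_simps compute_rules cong: if_weak_cong) simp_all

definition Z827 :: zlist where
  "Z827 = [(lab 40153304245, 29, 2, 7, 29, 25, 41), (lab 61583235434, 31, 6, 12, 29, 28, 28), (lab 45543171689, 29, 6,
    12, 31, 48, 12), (lab 62640466764, 29, 2, 7, 29, 11, 36)]"

lemmas Z827_rule = zlist_rule[OF Z827_def, unfolded zmem_rec zchk_rec]

lemma cert_827: "cert A9 Z827 [] 827"
  by (rule certI; simp only: A9_simps Z827_rule compute_rules cong: if_weak_cong)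

definition Z1933 :: zlist where
  "Z1933 = [(lab 1398057, 43, 5, 9, 46, 43, 25), (lab 1398453, 44, 7, 13, 46, 25, 33), (lab 1398453, 43, 9, 5, 46, 25,
    25), (lab 1223333, 44, 13, 7, 46, 34, 25)]"

lemmas Z1933_rule = zlist_rule[OF Z1933_def, unfolded zmem_rec zchk_rec]

lemma cert_1933: "cert A9 Z1933 [] 1933"
  by (rule certI; simp only: A9_simps Z1933_rule compute_rules cong: if_weak_cong)

definition A10 :: autom where
  "A10 = [
    (1, 3, 4), (3, 5, 6), (2, 7, 8), (7, 0, 9), (6, 10, 8), (5, 5, 11), (4, 12, 0), (14, 13, 8), (13, 14, 15), (10,
    16, 17), (9, 5, 18), (29, 19, 15), (27, 0, 20), (26, 21, 17), (21, 14, 22), (20, 23, 0), (18, 16, 24), (59, 0,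
    25), (54, 26, 8), (53, 27, 22), (42, 21, 28), (41, 5, 29), (36, 30, 0), (118, 31, 8), (109, 32, 15), (107, 0,
    33), (84, 34, 0), (82, 16, 35), (73, 5, 36), (237, 0, 37), (219, 0, 38), (214, 39, 8), (169, 5, 40), (164, 41,
    0), (146, 42, 0), (474, 0, 17), (438, 0, 8), (429, 0, 15), (338, 16, 0), (329, 5, 0), (293, 14, 0)]"

lemmas A10_simps = aut_rules[OF A10_def, simplified]

lemma A10_ok: "aut_ok 3290 1000 A10"
  by (rule aut_okI[OF A10_def, of _ _ 43], simp only: A10_simps compute_rules cong: if_weak_cong) simp_all

definition Z653 :: zlist where
  "Z653 = [(lab 4717, 25, 11, 2, 27, 31, 30), (lab 4825, 29, 21, 20, 37, 12, 5), (lab 5833, 25, 2, 11, 27, 30, 19),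
    (lab 4969, 29, 20, 21, 37, 23, 14)]"

lemmas Z653_rule = zlist_rule[OF Z653_def, unfolded zmem_rec zchk_rec]

lemma cert_653: "cert A10 Z653 [] 653"
  by (rule certI; simp only: A10_simps Z653_rule compute_rules cong: if_weak_cong)

definition Z907 :: zlist where
  "Z907 = [(lab 6445, 31, 18, 3, 31, 26, 41), (lab 5842, 31, 3, 18, 31, 29, 38), (lab 6949, 37, 33, 14, 37, 42, 13),
    (lab 5338, 37, 14, 33, 37, 37, 18)]"

lemmas Z907_rule = zlist_rule[OF Z907_def, unfolded zmem_rec zchk_rec]

lemma cert_907: "cert A10 Z907 [] 907"
  by (rule certI; simp only: A10_simps Z907_rule compute_rules cong: if_weak_cong)

definition Z1627 :: zlist where
  "Z1627 = [(lab 7547244, 39, 1, 11, 42, 8, 8), (lab 5033321, 42, 1, 11, 39, 23, 5), (lab 5983382, 40, 11, 23, 47, 20,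
    18), (lab 5844186, 45, 13, 41, 48, 37, 9), (lab 5870294, 41, 12, 25, 47, 33, 22), (lab 5557466, 47, 12, 25, 41,
    37, 9)]"

definition Y1627 :: zlist where
  "Y1627 = [(lab 7131749, 40, 23, 11, 47, 16, 41), (lab 6722349, 45, 41, 13, 48, 26, 12)]"

lemmas Z1627_rule = zlist_rule[OF Z1627_def, unfolded zmem_rec zchk_rec]
lemmas Y1627_rule = zlist_rule[OF Y1627_def, unfolded zmem_rec zchk_rec]

lemma cert_1627: "cert A10 Z1627 Y1627 1627"
  by (rule certI; simp only: A10_simps Z1627_rule Y1627_rule compute_rules cong: if_weak_cong)

definition A11 :: autom where
  "A11 = [
    (1, 3, 4), (3, 5, 6), (2, 7, 8), (7, 0, 9), (6, 10, 8), (5, 5, 11), (4, 12, 0), (14, 13, 8), (13, 14, 11), (10,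
    10, 15), (9, 5, 16), (29, 17, 18), (27, 0, 19), (20, 20, 0), (18, 21, 22), (59, 0, 23), (58, 24, 15), (54, 25,
    8), (41, 5, 26), (37, 14, 27), (36, 28, 0), (118, 29, 8), (117, 30, 11), (109, 31, 18), (82, 21, 32), (74, 10,
    33), (73, 5, 34), (237, 0, 18), (235, 0, 35), (219, 0, 36), (164, 37, 0), (148, 38, 0), (146, 21, 0), (470, 39,
    8), (438, 40, 8), (329, 5, 41), (297, 5, 42), (941, 43, 18), (877, 0, 44), (658, 45, 0), (594, 21, 46), (1883,
    0, 47), (1754, 48, 15), (1317, 14, 49), (1188, 50, 0), (3766, 0, 8), (3509, 0, 11), (2634, 10, 0), (2377, 5,
    0)]"

lemmas A11_simps = aut_rules[OF A11_def, simplified]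

lemma A11_ok: "aut_ok 3340 1000 A11"
  by (rule aut_okI[OF A11_def, of _ _ 51], simp only: A11_simps compute_rules cong: if_weak_cong) simp_all

definition Z293 :: zlist where
  "Z293 = [(lab 18853, 18, 7, 7, 19, 21, 17), (lab 23386, 17, 3, 10, 19, 18, 27), (lab 30298, 19, 7, 7, 18, 18, 22),
    (lab 22825, 17, 5, 6, 19, 38, 25), (lab 19033, 19, 5, 6, 17, 12, 14), (lab 29398, 24, 7, 13, 16, 35, 21),
    (lab 29914, 17, 5, 6, 19, 18, 33), (lab 26953, 16, 7, 13, 24, 50, 5)]"

lemmas Z293_rule = zlist_rule[OF Z293_def, unfolded zmem_rec zchk_rec]

lemma cert_293: "cert A11 Z293 [] 293"
  by (rule certI; simp only: A11_simps Z293_rule compute_rules cong: if_weak_cong)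

definition Z947 :: zlist where
  "Z947 = [(lab 7686486, 28, 1, 5, 34, 19, 44), (lab 415306, 31, 6, 23, 35, 27, 11), (lab 7039634, 27, 2, 26, 37, 41,
    11), (lab 371125, 35, 23, 6, 31, 24, 10)]"

definition Y947 :: zlist where
  "Y947 = [(lab 435529, 31, 23, 6, 35, 37, 19), (lab 350902, 35, 6, 23, 31, 36, 20)]"

lemmas Z947_rule = zlist_rule[OF Z947_def, unfolded zmem_rec zchk_rec]
lemmas Y947_rule = zlist_rule[OF Y947_def, unfolded zmem_rec zchk_rec]

lemma cert_947: "cert A11 Z947 Y947 947"
  by (rule certI; simp only: A11_simps Z947_rule Y947_rule compute_rules cong: if_weak_cong)

definition Z1493 :: zlist where
  "Z1493 = [(lab 22198, 37, 7, 14, 43, 47, 27), (lab 21139, 37, 6, 4, 41, 5, 14), (lab 5395893, 37, 16, 20, 49, 48, 31),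
    (lab 5418410, 39, 4, 7, 39, 11, 26), (lab 30130, 37, 2, 12, 41, 16, 26), (lab 26953, 43, 14, 7, 37, 50, 24)]"

definition Y1493 :: zlist where
  "Y1493 = [(lab 27061, 37, 6, 4, 41, 24, 21), (lab 27469, 37, 14, 7, 43, 13, 21), (lab 19237, 37, 4, 6, 41, 21, 39),
    (lab 21682, 43, 7, 14, 37, 16, 18)]"

lemmas Z1493_rule = zlist_rule[OF Z1493_def, unfolded zmem_rec zchk_rec]
lemmas Y1493_rule = zlist_rule[OF Y1493_def, unfolded zmem_rec zchk_rec]

lemma cert_1493: "cert A11 Z1493 Y1493 1493"
  by (rule certI; simp only: A11_simps Z1493_rule Y1493_rule compute_rules cong: if_weak_cong)

definition A12 :: autom where
  "A12 = [
    (1, 3, 4), (3, 5, 6), (2, 7, 8), (7, 0, 9), (6, 10, 8), (5, 5, 11), (4, 12, 0), (14, 13, 8), (13, 14, 15), (10,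
    16, 17), (9, 5, 18), (29, 19, 15), (27, 0, 20), (26, 21, 17), (21, 14, 22), (20, 23, 0), (18, 16, 24), (59, 0,
    25), (54, 26, 8), (53, 27, 22), (42, 21, 28), (41, 5, 29), (36, 30, 0), (118, 31, 8), (109, 32, 15), (107, 0,
    33), (84, 34, 0), (82, 16, 35), (73, 5, 36), (237, 0, 15), (219, 0, 37), (214, 38, 8), (169, 5, 39), (164, 40,
    0), (146, 16, 0), (438, 41, 8), (429, 42, 15), (338, 16, 43), (329, 5, 44), (877, 0, 45), (859, 0, 46), (676,
    47, 0), (658, 48, 0), (1754, 0, 17), (1718, 0, 8), (1353, 5, 0), (1317, 14, 0)]"

lemmas A12_simps = aut_rules[OF A12_def, simplified]

lemma A12_ok: "aut_ok 3325 1000 A12"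
  by (rule aut_okI[OF A12_def, of _ _ 49], simp only: A12_simps compute_rules cong: if_weak_cong) simp_all

definition Z1523 :: zlist where
  "Z1523 = [(lab 25237316252261067, 39, 37, 1, 40, 14, 13), (lab 6902938, 41, 5, 7, 38, 15, 22), (lab 5614297, 38, 5, 7,
    41, 12, 16), (lab 30764980972735337, 39, 38, 2, 41, 23, 8), (lab 32203787554475372, 39, 2, 38, 41, 8, 39),
    (lab 4891993, 43, 11, 14, 39, 12, 27), (lab 32179722854259308, 39, 1, 37, 40, 8, 45), (lab 7687594, 39, 11, 14,
    43, 22, 28)]"

lemmas Z1523_rule = zlist_rule[OF Z1523_def, unfolded zmem_rec zchk_rec]

lemma cert_1523: "cert A12 Z1523 [] 1523"
  by (rule certI; simp only: A12_simps Z1523_rule compute_rules cong: if_weak_cong)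

definition A13 :: autom where
  "A13 = [
    (1, 3, 4), (3, 5, 6), (2, 7, 8), (7, 0, 9), (6, 10, 8), (5, 5, 11), (4, 12, 0), (14, 13, 14), (13, 15, 16),
    (10, 17, 18), (9, 19, 20), (29, 21, 16), (28, 22, 0), (27, 0, 23), (26, 17, 24), (21, 25, 16), (20, 26, 0),
    (19, 0, 27), (18, 17, 28), (59, 0, 29), (57, 30, 20), (54, 31, 14), (52, 32, 0), (43, 0, 33), (41, 19, 34),
    (38, 13, 35), (36, 36, 0), (118, 37, 14), (115, 0, 38), (109, 39, 16), (105, 40, 34), (86, 31, 41), (82, 17,
    42), (76, 43, 0), (73, 19, 44), (237, 45, 16), (230, 46, 35), (219, 0, 47), (211, 0, 48), (172, 49, 0), (164,
    50, 0), (153, 30, 51), (146, 17, 52), (475, 0, 53), (461, 54, 16), (438, 55, 14), (422, 56, 35), (345, 30, 57),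
    (329, 19, 58), (306, 17, 59), (292, 60, 0), (950, 0, 14), (923, 0, 61), (877, 0, 16), (845, 62, 16), (690, 17,
    63), (658, 17, 0), (612, 64, 0), (585, 19, 0), (1846, 65, 14), (1691, 0, 66), (1380, 67, 0), (1225, 19, 68),
    (3693, 69, 16), (3382, 70, 14), (2761, 19, 71), (2450, 17, 72), (7387, 0, 73), (6765, 74, 16), (5522, 17, 75),
    (4900, 76, 0), (14774, 0, 77), (13531, 0, 78), (11044, 79, 0), (9801, 80, 0), (29548, 81, 0), (27062, 0, 82),
    (22089, 83, 0), (19603, 0, 84), (59097, 0, 85), (54124, 86, 0), (44179, 0, 87), (39206, 88, 0), (118194, 0,
    28), (108249, 0, 20), (88358, 13, 0), (78413, 21, 0)]"

lemmas A13_simps = aut_rules[OF A13_def, simplified]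

lemma A13_ok: "aut_ok 3410 1000 A13"
  by (rule aut_okI[OF A13_def, of _ _ 89], simp only: A13_simps compute_rules cong: if_weak_cong) simp_all

definition Z1013 :: zlist where
  "Z1013 = [(lab 308917849, 33, 13, 16, 37, 49, 83), (lab 383345818, 35, 11, 32, 39, 16, 57)]"

lemmas Z1013_rule = zlist_rule[OF Z1013_def, unfolded zmem_rec zchk_rec]

lemma cert_1013: "cert A13 Z1013 [] 1013"
  by (rule certI; simp only: A13_simps Z1013_rule compute_rules cong: if_weak_cong)

text \<open>Here only three equal letters in a row are excluded, that is, partial quotients above
  2.\<close>

definition A14 :: autom where
  "A14 = [
    (1, 3, 4), (3, 5, 4), (2, 3, 6), (7, 0, 4), (4, 3, 0)]"

lemmas A14_simps = aut_rules[OF A14_def, simplified]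

lemma A14_ok: "aut_ok 3500 1000 A14"
  by (rule aut_okI[OF A14_def, of _ _ 7], simp only: A14_simps compute_rules cong: if_weak_cong) simp_all

definition Z3 :: zlist where
  "Z3 = [(lab 14, 2, 1, 1, 2, 4, 6), (lab 9, 2, 1, 1, 2, 3, 5)]"

lemmas Z3_rule = zlist_rule[OF Z3_def, unfolded zmem_rec zchk_rec]

lemma cert_3: "cert A14 Z3 [] 3"
  by (rule certI; simp only: A14_simps Z3_rule compute_rules cong: if_weak_cong)

definition Z163 :: zlist where
  "Z163 = [(lab 4937, 11, 7, 5, 18, 3, 4), (lab 7478, 11, 2, 1, 15, 4, 6), (lab 6509, 11, 5, 7, 18, 3, 5), (lab 7314, 11,
    1, 2, 15, 4, 6)]"

lemmas Z163_rule = zlist_rule[OF Z163_def, unfolded zmem_rec zchk_rec]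

lemma cert_163: "cert A14 Z163 [] 163"
  by (rule certI; simp only: A14_simps Z163_rule compute_rules cong: if_weak_cong)

text \<open>The only automaton that lets three equal letters pass: the bound 3.68, used for p = 67,
  leaves room for the partial quotient 3.\<close>

definition A15 :: autom where
  "A15 = [
    (1, 3, 4), (3, 5, 6), (2, 7, 8), (7, 9, 10), (6, 11, 12), (5, 13, 14), (4, 15, 16), (15, 0, 17), (14, 11, 18),
    (13, 19, 20), (12, 21, 22), (11, 23, 24), (10, 25, 26), (9, 27, 14), (8, 28, 0), (30, 0, 29), (28, 30, 31),
    (27, 0, 24), (26, 25, 32), (25, 33, 14), (24, 34, 0), (23, 0, 35), (22, 11, 36), (21, 37, 20), (20, 21, 0),
    (19, 38, 39), (17, 40, 0), (60, 30, 41), (57, 42, 14), (56, 43, 0), (52, 44, 0), (51, 45, 39), (49, 46, 0),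
    (46, 0, 47), (44, 30, 48), (43, 0, 49), (39, 0, 50), (38, 11, 51), (35, 52, 39), (120, 53, 0), (115, 0, 39),
    (113, 54, 0), (105, 55, 14), (103, 0, 56), (99, 57, 39), (92, 30, 58), (88, 59, 0), (86, 11, 60), (78, 0, 61),
    (76, 30, 0), (71, 0, 62), (241, 63, 0), (227, 64, 39), (211, 65, 39), (206, 0, 66), (199, 0, 67), (184, 68, 0),
    (177, 69, 0), (172, 30, 70), (156, 30, 71), (142, 0, 72), (483, 73, 39), (455, 0, 74), (423, 0, 75), (412, 0,
    71), (398, 0, 76), (369, 77, 0), (355, 64, 0), (344, 78, 0), (312, 79, 0), (284, 30, 80), (967, 0, 81), (910,
    0, 82), (846, 0, 83), (796, 84, 80), (739, 73, 85), (689, 86, 0), (625, 87, 0), (568, 88, 0), (1934, 0, 89),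
    (1820, 90, 80), (1692, 0, 91), (1593, 92, 14), (1478, 11, 93), (1379, 94, 0), (1251, 73, 95), (1137, 96, 0),
    (3868, 97, 80), (3641, 0, 14), (3384, 98, 0), (3187, 0, 99), (2956, 100, 0), (2759, 0, 101), (2502, 11, 0),
    (2275, 73, 102), (7737, 0, 103), (6769, 104, 0), (6374, 0, 51), (5913, 42, 0), (5518, 0, 105), (4550, 106, 0),
    (15474, 0, 26), (13539, 0, 95), (11036, 90, 0), (9101, 19, 0)]"

lemmas A15_simps = aut_rules[OF A15_def, simplified]

lemma A15_ok: "aut_ok 3680 1000 A15"
  by (rule aut_okI[OF A15_def, of _ _ 107], simp only: A15_simps compute_rules cong: if_weak_cong) simp_all

definition Z67 :: zlist where
  "Z67 = [(lab 29361, 7, 3, 1, 10, 78, 95), (lab 25493, 9, 7, 2, 9, 25, 98), (lab 26394, 7, 1, 3, 10, 20, 60),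
    (lab 23658, 9, 2, 7, 9, 20, 101)]"

lemmas Z67_rule = zlist_rule[OF Z67_def, unfolded zmem_rec zchk_rec]

lemma cert_67: "cert A15 Z67 [] 67"
  by (rule certI; simp only: A15_simps Z67_rule compute_rules cong: if_weak_cong)

section \<open>The primes up to 2000\<close>

lemma wit_3: "wit 3500 1000 3 (0, -1, 1, 2) (1, -2, 0, 1) (1, -2, -2, 1) (2, -2, -1, 1) 3 3"
  by (simp add: wit_def river_eq same_def)

text \<open>Primality enters as an assumption here and in the lemmas of the same kind; the theorem
  supplies it for its own p.\<close>

lemma isolated_min_3: "prime (3 :: nat) \<Longrightarrow> isolated_min 3"
  by (rule isolated_minI[OF _ of_nat_numeral A14_ok _ cert_3 wit_3], assumption, simp (no_asm))

lemma wit_67: "wit 3680 1000 67 (0, -1, 1, -29) (2, -9, 1, -4) (29, 9, -61, 23) (29, -9, -61, 23) 67 84"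
  by (simp add: wit_def river_eq same_def)

lemma isolated_min_67: "prime (67 :: nat) \<Longrightarrow> isolated_min 67"
  by (rule isolated_minI[OF _ of_nat_numeral A15_ok _ cert_67 wit_67], assumption, simp (no_asm))

lemma wit_163: "wit 3500 1000 163 (0, -1, 1, -74) (2, -11, 1, -5) (71, -127, -97, 61) (119, -117, -63, 61) 163 208"
  by (simp add: wit_def river_eq same_def)

lemma isolated_min_163: "prime (163 :: nat) \<Longrightarrow> isolated_min 163"
  by (rule isolated_minI[OF _ of_nat_numeral A14_ok _ cert_163 wit_163], assumption, simp (no_asm))

lemma wit_227: "wit 3060 1000 227 (0, -1, 1, -108) (2, -21, 1, -10) (21, 0, -11, 10) (11, 0, -21, 10) 227 30"
  by (simp add: wit_def river_eq same_def)

lemma isolated_min_227: "prime (227 :: nat) \<Longrightarrow> isolated_min 227"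
  by (rule isolated_minI[OF _ of_nat_numeral A3_ok _ cert_227 wit_227], assumption, simp (no_asm))

lemma wit_277: "wit 3060 1000 277 (0, -1, 1, 52) (11, -16, -2, 3) (35, -29, -29, 23) (49, 1, -25, 23) 277 70"
  by (simp add: wit_def river_eq same_def)

lemma isolated_min_277: "prime (277 :: nat) \<Longrightarrow> isolated_min 277"
  by (rule isolated_minI[OF _ of_nat_numeral A3_ok _ cert_277 wit_277], assumption, simp (no_asm))

lemma wit_283: "wit 3060 1000 283 (0, -1, 1, -83) (10, -17, 3, -5) (49, 1, -25, 23) (53, 5, -23, 23) 283 70"
  by (simp add: wit_def river_eq same_def)

lemma isolated_min_283: "prime (283 :: nat) \<Longrightarrow> isolated_min 283"
  by (rule isolated_minI[OF _ of_nat_numeral A3_ok _ cert_283 wit_283], assumption, simp (no_asm))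

lemma wit_293: "wit 3340 1000 293 (0, -1, 1, -134) (13, -24, 6, -11) (89, -148, -154, 83) (94, 20, -203, 83) 293 276"
  by (simp add: wit_def river_eq same_def)

lemma isolated_min_293: "prime (293 :: nat) \<Longrightarrow> isolated_min 293"
  by (rule isolated_minI[OF _ of_nat_numeral A11_ok _ cert_293 wit_293], assumption, simp (no_asm))

lemma wit_317: "wit 3220 1000 317 (0, -1, 1, -123) (5, -18, 2, -7) (25, -49, -40, 25) (40, -49, -25, 25) 317 80"
  by (simp add: wit_def river_eq same_def)

lemma isolated_min_317: "prime (317 :: nat) \<Longrightarrow> isolated_min 317"
  by (rule isolated_minI[OF _ of_nat_numeral A8_ok _ cert_317 wit_317], assumption, simp (no_asm))

lemma wit_347: "wit 3220 1000 347 (0, -1, 1, -146) (7, -19, 3, -8) (58, -118, -89, 58) (93, -72, -79, 58) 347 185"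
  by (simp add: wit_def river_eq same_def)

lemma isolated_min_347: "prime (347 :: nat) \<Longrightarrow> isolated_min 347"
  by (rule isolated_minI[OF _ of_nat_numeral A8_ok _ cert_347 wit_347], assumption, simp (no_asm))

lemma wit_397: "wit 3120 1000 397 (0, -1, 1, 139) (3, -20, -1, 7) (37, -1, -19, 17) (37, 1, -19, 17) 397 53"
  by (simp add: wit_def river_eq same_def)

lemma isolated_min_397: "prime (397 :: nat) \<Longrightarrow> isolated_min 397"
  by (rule isolated_minI[OF _ of_nat_numeral A6_ok _ cert_397 wit_397], assumption, simp (no_asm))

lemma wit_547: "wit 3140 1000 547 (0, -1, 1, 44) (13, -25, -1, 2) (37, -1, -19, 17) (37, 1, -19, 17) 547 53"
  by (simp add: wit_def river_eq same_def)

lemma isolated_min_547: "prime (547 :: nat) \<Longrightarrow> isolated_min 547"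
  by (rule isolated_minI[OF _ of_nat_numeral A5_ok _ cert_547 wit_547], assumption, simp (no_asm))

lemma wit_557: "wit 3140 1000 557 (0, -1, 1, -262) (2, -17, 1, -8) (19, -1, -37, 17) (37, -1, -19, 17) 557 53"
  by (simp add: wit_def river_eq same_def)

lemma isolated_min_557: "prime (557 :: nat) \<Longrightarrow> isolated_min 557"
  by (rule isolated_minI[OF _ of_nat_numeral A5_ok _ cert_557 wit_557], assumption, simp (no_asm))

lemma wit_587: "wit 3220 1000 587 (0, -1, 1, -122) (19, -24, 4, -5) (43, -30, -44, 29) (68, -6, -31, 29) 587 92"
  by (simp add: wit_def river_eq same_def)

lemma isolated_min_587: "prime (587 :: nat) \<Longrightarrow> isolated_min 587"
  by (rule isolated_minI[OF _ of_nat_numeral A8_ok _ cert_587 wit_587], assumption, simp (no_asm))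

lemma wit_643: "wit 3140 1000 643 (0, -1, 1, -180) (7, -25, 2, -7) (19, -37, -19, 17) (29, -29, -17, 17) 643 53"
  by (simp add: wit_def river_eq same_def)

lemma isolated_min_643: "prime (643 :: nat) \<Longrightarrow> isolated_min 643"
  by (rule isolated_minI[OF _ of_nat_numeral A5_ok _ cert_643 wit_643], assumption, simp (no_asm))

lemma wit_653: "wit 3290 1000 653 (0, -1, 1, -313) (2, -25, 1, -12) (25, 34, -16, 16) (25, 16, -25, 16) 653 52"
  by (simp add: wit_def river_eq same_def)

lemma isolated_min_653: "prime (653 :: nat) \<Longrightarrow> isolated_min 653"
  by (rule isolated_minI[OF _ of_nat_numeral A10_ok _ cert_653 wit_653], assumption, simp (no_asm))

lemma wit_683: "wit 3140 1000 683 (0, -1, 1, -202) (10, -27, 3, -8) (17, -29, -29, 17) (29, -29, -17, 17) 683 53"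
  by (simp add: wit_def river_eq same_def)

lemma isolated_min_683: "prime (683 :: nat) \<Longrightarrow> isolated_min 683"
  by (rule isolated_minI[OF _ of_nat_numeral A5_ok _ cert_683 wit_683], assumption, simp (no_asm))

lemma wit_773: "wit 3220 1000 773 (0, -1, 1, 160) (5, -29, -1, 6) (30553, 31749, -28759, 20985) (22339, 39091, -33513, 20985) 773 67250"
  by (simp add: wit_def river_eq same_def)

lemma isolated_min_773: "prime (773 :: nat) \<Longrightarrow> isolated_min 773"
  by (rule isolated_minI[OF _ of_nat_numeral A8_ok _ cert_773 wit_773], assumption, simp (no_asm))

lemma wit_827: "wit 3260 1000 827 (0, -1, 1, -342) (12, -29, 5, -12) (4356443, 3368906, -3705730, 2701041) (2901673, 5114630, -4287638, 2701041) 827 8713479"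
  by (simp add: wit_def river_eq same_def)

lemma isolated_min_827: "prime (827 :: nat) \<Longrightarrow> isolated_min 827"
  by (rule isolated_minI[OF _ of_nat_numeral A9_ok _ cert_827 wit_827], assumption, simp (no_asm))

lemma wit_853: "wit 3140 1000 853 (0, -1, 1, -186) (9, -32, 2, -7) (455, 19, -893, 409) (455, -19, -893, 409) 853 1274"
  by (simp add: wit_def river_eq same_def)

lemma isolated_min_853: "prime (853 :: nat) \<Longrightarrow> isolated_min 853"
  by (rule isolated_minI[OF _ of_nat_numeral A5_ok _ cert_853 wit_853], assumption, simp (no_asm))

lemma wit_907: "wit 3290 1000 907 (0, -1, 1, -351) (18, -31, 7, -12) (40, -6, -17, 16) (40, 6, -17, 16) 907 52"
  by (simp add: wit_def river_eq same_def)

lemma isolated_min_907: "prime (907 :: nat) \<Longrightarrow> isolated_min 907"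
  by (rule isolated_minI[OF _ of_nat_numeral A10_ok _ cert_907 wit_907], assumption, simp (no_asm))

lemma wit_947: "wit 3340 1000 947 (0, -1, 1, -152) (6, -31, 1, -5) (318, -78, -701, 285) (402, -366, -475, 285) 947 947"
  by (simp add: wit_def river_eq same_def)

lemma isolated_min_947: "prime (947 :: nat) \<Longrightarrow> isolated_min 947"
  by (rule isolated_minI[OF _ of_nat_numeral A11_ok _ cert_947 wit_947], assumption, simp (no_asm))

lemma wit_997: "wit 3060 1000 997 (0, -1, 1, -480) (2, -27, 1, -13) (139, -255, -197, 137) (209, -245, -137, 137) 997 417"
  by (simp add: wit_def river_eq same_def)

lemma isolated_min_997: "prime (997 :: nat) \<Longrightarrow> isolated_min 997"
  by (rule isolated_minI[OF _ of_nat_numeral A3_ok _ cert_997 wit_997], assumption, simp (no_asm))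

lemma wit_1013: "wit 3410 1000 1013 (0, -1, 1, -347) (32, -35, 11, -12) (373, -38, -172, 149) (433, 0, -149, 149) 1013 508"
  by (simp add: wit_def river_eq same_def)

lemma isolated_min_1013: "prime (1013 :: nat) \<Longrightarrow> isolated_min 1013"
  by (rule isolated_minI[OF _ of_nat_numeral A13_ok _ cert_1013 wit_1013], assumption, simp (no_asm))

lemma wit_1093: "wit 3006 1000 1093 (0, -1, 1, -239) (9, -32, 2, -7) (2353, 2149, -2683, 1819) (1819, 3217, -2683, 1819) 1093 5465"
  by (simp add: wit_def river_eq same_def)

lemma isolated_min_1093: "prime (1093 :: nat) \<Longrightarrow> isolated_min 1093"
  by (rule isolated_minI[OF _ of_nat_numeral A2_ok _ cert_1093 wit_1093], assumption, simp (no_asm))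

lemma wit_1123: "wit 3100 1000 1123 (0, -1, 1, -530) (19, -36, 9, -17) (529937, -8763, -271099, 245645) (564361, -65903, -252673, 245645) 1123 758114"
  by (simp add: wit_def river_eq same_def)

lemma isolated_min_1123: "prime (1123 :: nat) \<Longrightarrow> isolated_min 1123"
  by (rule isolated_minI[OF _ of_nat_numeral A4_ok _ cert_1123 wit_1123], assumption, simp (no_asm))

lemma wit_1163: "wit 3220 1000 1163 (0, -1, 1, -549) (19, -36, 9, -17) (79, -1, -31, 31) (79, 1, -31, 31) 1163 98"
  by (simp add: wit_def river_eq same_def)

lemma isolated_min_1163: "prime (1163 :: nat) \<Longrightarrow> isolated_min 1163"
  by (rule isolated_minI[OF _ of_nat_numeral A8_ok _ cert_1163 wit_1163], assumption, simp (no_asm))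

lemma wit_1213: "wit 3060 1000 1213 (0, -1, 1, -568) (17, -32, 8, -15) (15, 18, -10, 10) (14, 14, -13, 10) 1213 30"
  by (simp add: wit_def river_eq same_def)

lemma isolated_min_1213: "prime (1213 :: nat) \<Longrightarrow> isolated_min 1213"
  by (rule isolated_minI[OF _ of_nat_numeral A3_ok _ cert_1213 wit_1213], assumption, simp (no_asm))

lemma wit_1237: "wit 3140 1000 1237 (0, -1, 1, -318) (31, -35, 8, -9) (947, 127, -401, 401) (673, 675, -401, 401) 1237 1238"
  by (simp add: wit_def river_eq same_def)

lemma isolated_min_1237: "prime (1237 :: nat) \<Longrightarrow> isolated_min 1237"
  by (rule isolated_minI[OF _ of_nat_numeral A5_ok _ cert_1237 wit_1237], assumption, simp (no_asm))

lemma wit_1493: "wit 3340 1000 1493 (0, -1, 1, -363) (4, -37, 1, -9) (86, 4, -223, 83) (94, 20, -203, 83) 1493 276"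
  by (simp add: wit_def river_eq same_def)

lemma isolated_min_1493: "prime (1493 :: nat) \<Longrightarrow> isolated_min 1493"
  by (rule isolated_minI[OF _ of_nat_numeral A11_ok _ cert_1493 wit_1493], assumption, simp (no_asm))

lemma wit_1523: "wit 3325 1000 1523 (0, -1, 1, -106) (14, -43, 1, -3) (7207, 7480, -3908, 3908) (4013, 8022, -6495, 3908) 1523 12984"
  by (simp add: wit_def river_eq same_def)

lemma isolated_min_1523: "prime (1523 :: nat) \<Longrightarrow> isolated_min 1523"
  by (rule isolated_minI[OF _ of_nat_numeral A12_ok _ cert_1523 wit_1523], assumption, simp (no_asm))

lemma wit_1597: "wit 3168 1000 1597 (0, -1, 1, -722) (11, -42, 5, -19) (2287984, -444814, -5016673, 2143720) (2400665, 338, -4801808, 2143720) 1597 6790444"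
  by (simp add: wit_def river_eq same_def)

lemma isolated_min_1597: "prime (1597 :: nat) \<Longrightarrow> isolated_min 1597"
  by (rule isolated_minI[OF _ of_nat_numeral A7_ok _ cert_1597 wit_1597], assumption, simp (no_asm))

lemma wit_1627: "wit 3290 1000 1627 (0, -1, 1, -736) (11, -42, 5, -19) (10451, 10173, -6007, 5729) (6641, 13221, -6769, 5729) 1627 18830"
  by (simp add: wit_def river_eq same_def)

lemma isolated_min_1627: "prime (1627 :: nat) \<Longrightarrow> isolated_min 1627"
  by (rule isolated_minI[OF _ of_nat_numeral A10_ok _ cert_1627 wit_1627], assumption, simp (no_asm))

lemma wit_1637: "wit 3060 1000 1637 (0, -1, 1, -496) (23, -33, 7, -10) (23, -5, -53, 23) (23, 41, -35, 23) 1637 70"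
  by (simp add: wit_def river_eq same_def)

lemma isolated_min_1637: "prime (1637 :: nat) \<Longrightarrow> isolated_min 1637"
  by (rule isolated_minI[OF _ of_nat_numeral A3_ok _ cert_1637 wit_1637], assumption, simp (no_asm))

lemma wit_1693: "wit 3220 1000 1693 (0, -1, 1, -550) (3, -40, 1, -13) (43, 49, -43, 31) (43, 37, -49, 31) 1693 98"
  by (simp add: wit_def river_eq same_def)

lemma isolated_min_1693: "prime (1693 :: nat) \<Longrightarrow> isolated_min 1693"
  by (rule isolated_minI[OF _ of_nat_numeral A8_ok _ cert_1693 wit_1693], assumption, simp (no_asm))

lemma wit_1747: "wit 3140 1000 1747 (0, -1, 1, -426) (4, -41, 1, -10) (565, -517, -643, 425) (643, -517, -565, 425) 1747 1311"
  by (simp add: wit_def river_eq same_def)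

lemma isolated_min_1747: "prime (1747 :: nat) \<Longrightarrow> isolated_min 1747"
  by (rule isolated_minI[OF _ of_nat_numeral A5_ok _ cert_1747 wit_1747], assumption, simp (no_asm))

lemma wit_1787: "wit 3006 1000 1787 (0, -1, 1, -831) (15, -43, 7, -20) (184, 19, -82, 82) (182, 17, -83, 82) 1787 246"
  by (simp add: wit_def river_eq same_def)

lemma isolated_min_1787: "prime (1787 :: nat) \<Longrightarrow> isolated_min 1787"
  by (rule isolated_minI[OF _ of_nat_numeral A2_ok _ cert_1787 wit_1787], assumption, simp (no_asm))

lemma wit_1867: "wit 3220 1000 1867 (0, -1, 1, -876) (17, -49, 8, -23) (31, -61, -49, 31) (49, -61, -31, 31) 1867 98"
  by (simp add: wit_def river_eq same_def)

lemma isolated_min_1867: "prime (1867 :: nat) \<Longrightarrow> isolated_min 1867"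
  by (rule isolated_minI[OF _ of_nat_numeral A8_ok _ cert_1867 wit_1867], assumption, simp (no_asm))

lemma wit_1907: "wit 3060 1000 1907 (0, -1, 1, 53) (1, -36, 0, 1) (23, -41, -35, 23) (35, -41, -23, 23) 1907 70"
  by (simp add: wit_def river_eq same_def)

lemma isolated_min_1907: "prime (1907 :: nat) \<Longrightarrow> isolated_min 1907"
  by (rule isolated_minI[OF _ of_nat_numeral A3_ok _ cert_1907 wit_1907], assumption, simp (no_asm))

lemma wit_1933: "wit 3260 1000 1933 (0, -1, 1, -854) (9, -43, 4, -19) (1209, 921, -1031, 743) (1083, 1089, -1073, 743) 1933 2415"
  by (simp add: wit_def river_eq same_def)

lemma isolated_min_1933: "prime (1933 :: nat) \<Longrightarrow> isolated_min 1933"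
  by (rule isolated_minI[OF _ of_nat_numeral A9_ok _ cert_1933 wit_1933], assumption, simp (no_asm))

lemma wit_1987: "wit 3006 1000 1987 (0, -1, 1, -803) (42, -47, 17, -19) (75, -73, -73, 55) (123, -13, -55, 55) 1987 165"
  by (simp add: wit_def river_eq same_def)

lemma isolated_min_1987: "prime (1987 :: nat) \<Longrightarrow> isolated_min 1987"
  by (rule isolated_minI[OF _ of_nat_numeral A2_ok _ cert_1987 wit_1987], assumption, simp (no_asm))

lemma wit_1997: "wit 3140 1000 1997 (0, -1, 1, -710) (14, -45, 5, -16) (401, -36, -173, 169) (401, 36, -173, 169) 1997 528"
  by (simp add: wit_def river_eq same_def)

lemma isolated_min_1997: "prime (1997 :: nat) \<Longrightarrow> isolated_min 1997"
  by (rule isolated_minI[OF _ of_nat_numeral A5_ok _ cert_1997 wit_1997], assumption, simp (no_asm))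

text \<open>All forms have discriminant 221 with bound 5 or discriminant 1517 with bound 13. The
  elements they provide are therefore at most the third or the fourth Markov value, sqrt 221 / 5 or
  sqrt 1517 / 13.\<close>

definition low_wits :: "(int \<times> (int \<times> int \<times> int \<times> int) \<times> (int \<times> int \<times> int \<times> int) \<times> (int \<times> int \<times> int \<times> int) \<times> (int \<times> int \<times> int \<times> int) \<times> int \<times> int) list" where
  "low_wits = [
    (13, (0, -1, 1, -3), (3, -4, 1, -1), (11, -1, -5, 5), (11, 1, -5, 5), 13, 14), (37, (0, -1, 1, -6), (5, -6, 1,
    -1), (17, -19, -17, 13), (29, -3, -13, 13), 37, 38), (43, (0, -1, 1, -18), (2, -7, 1, -3), (5, -1, -11, 5), (5,
    1, -11, 5), 43, 14), (53, (0, -1, 1, -21), (2, -5, 1, -2), (5, -1, -11, 5), (11, 1, -5, 5), 53, 14), (83, (0,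
    -1, 1, -31), (5, -8, 2, -3), (17, -15, -19, 13), (29, -3, -13, 13), 83, 38), (107, (0, -1, 1, -48), (2, -11, 1,
    -5), (13, 3, -29, 13), (13, -3, -29, 13), 107, 38), (157, (0, -1, 1, -48), (3, -13, 1, -4), (5, -1, -11, 5),
    (5, 1, -11, 5), 157, 14), (173, (0, -1, 1, -53), (3, -13, 1, -4), (19, 15, -17, 13), (17, 15, -19, 13), 173,
    38), (197, (0, -1, 1, -45), (4, -13, 1, -3), (17, 19, -17, 13), (17, 15, -19, 13), 197, 38), (307, (0, -1, 1,
    -18), (16, -17, 1, -1), (17, -15, -19, 13), (19, 15, -17, 13), 307, 38), (373, (0, -1, 1, -173), (15, -28, 7,
    -13), (5, -9, -7, 5), (5, 1, -11, 5), 373, 14), (443, (0, -1, 1, -22), (19, -20, 1, -1), (5, -9, -7, 5), (11,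
    -1, -5, 5), 443, 14), (467, (0, -1, 1, -222), (2, -21, 1, -10), (7, 9, -5, 5), (7, 5, -7, 5), 467, 14), (523,
    (0, -1, 1, -250), (2, -23, 1, -11), (11, 1, -5, 5), (11, -1, -5, 5), 523, 14), (563, (0, -1, 1, -229), (22,
    -27, 9, -11), (11, 1, -5, 5), (11, 1, -5, 5), 563, 14), (613, (0, -1, 1, -20), (29, -30, 1, -1), (29, 3, -13,
    13), (29, 3, -13, 13), 613, 38), (677, (0, -1, 1, -139), (29, -34, 6, -7), (29, -3, -13, 13), (29, -3, -13,
    13), 677, 38), (733, (0, -1, 1, -190), (23, -27, 6, -7), (29, 3, -13, 13), (19, 23, -13, 13), 733, 38), (757,
    (0, -1, 1, -158), (19, -43, 4, -9), (5, -9, -7, 5), (7, -9, -5, 5), 757, 14), (787, (0, -1, 1, -340), (30, -37,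
    13, -16), (29, 3, -13, 13), (17, 15, -19, 13), 787, 38), (797, (0, -1, 1, -277), (20, -23, 7, -8), (5, -1, -11,
    5), (5, 9, -7, 5), 797, 14), (877, (0, -1, 1, -414), (19, -36, 9, -17), (29, 3, -13, 13), (17, 15, -19, 13),
    877, 38), (883, (0, -1, 1, -157), (11, -28, 2, -5), (7, 9, -5, 5), (7, 5, -7, 5), 883, 14), (1117, (0, -1, 1,
    -440), (5, -33, 2, -13), (19, 15, -17, 13), (17, 19, -17, 13), 1117, 38), (1187, (0, -1, 1, -267), (31, -40, 7,
    -9), (29, -3, -13, 13), (17, 19, -17, 13), 1187, 38), (1277, (0, -1, 1, -519), (27, -59, 11, -24), (5, -9, -7,
    5), (7, -9, -5, 5), 1277, 14), (1283, (0, -1, 1, -519), (37, -42, 15, -17), (11, -1, -5, 5), (11, 1, -5, 5),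
    1283, 14), (1307, (0, -1, 1, -635), (2, -37, 1, -18), (19, 15, -17, 13), (19, -15, -17, 13), 1307, 38), (1373,
    (0, -1, 1, -445), (3, -37, 1, -12), (17, -15, -19, 13), (19, -23, -13, 13), 1373, 38), (1427, (0, -1, 1, -294),
    (29, -63, 6, -13), (5, -9, -7, 5), (7, -9, -5, 5), 1427, 14), (1453, (0, -1, 1, -452), (16, -45, 5, -14), (11,
    1, -5, 5), (7, 5, -7, 5), 1453, 14), (1483, (0, -1, 1, -448), (33, -43, 10, -13), (11, 1, -5, 5), (11, 1, -5,
    5), 1483, 14), (1613, (0, -1, 1, -472), (17, -41, 5, -12), (11, -1, -5, 5), (11, 1, -5, 5), 1613, 14), (1667,
    (0, -1, 1, -754), (11, -42, 5, -19), (11, -1, -5, 5), (11, -1, -5, 5), 1667, 14), (1723, (0, -1, 1, -419), (4,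
    -37, 1, -9), (13, -23, -19, 13), (19, -23, -13, 13), 1723, 38), (1733, (0, -1, 1, -405), (17, -47, 4, -11), (5,
    -1, -11, 5), (5, 1, -11, 5), 1733, 14), (1877, (0, -1, 1, -775), (29, -46, 12, -19), (29, 3, -13, 13), (29, 3,
    -13, 13), 1877, 38), (1973, (0, -1, 1, -892), (11, -42, 5, -19), (7, 9, -5, 5), (7, 5, -7, 5), 1973, 14)]"

text \<open>A prime is paired with a square root of 5 or 8 modulo \<open>4 p\<close> if there is one, with \<open>-1\<close> if it occurs in
  \<open>low_wits\<close>, and with \<open>-2\<close> if it has a certificate of its own.\<close>

definition prime_cases :: "(int \<times> int) list" where
  "prime_cases = [
    (2, 0), (3, -2), (5, 5), (7, 6), (11, 7), (13, -1), (17, 12), (19, 9), (23, 10), (29, 11), (31, 25), (37, -1),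
    (41, 13), (43, -1), (47, 14), (53, -1), (59, 51), (61, 35), (67, -2), (71, 17), (73, 64), (79, 59), (83, -1),
    (89, 19), (97, 28), (101, 45), (103, 76), (107, -1), (109, 21), (113, 102), (127, 32), (131, 23), (137, 62),
    (139, 127), (149, 81), (151, 55), (157, -1), (163, -2), (167, 26), (173, -1), (179, 149), (181, 27), (191,
    177), (193, 104), (197, -1), (199, 123), (211, 65), (223, 30), (227, -2), (229, 163), (233, 170), (239, 31),
    (241, 103), (251, 235), (257, 120), (263, 220), (269, 143), (271, 33), (277, -2), (281, 75), (283, -2), (293,
    -2), (307, -1), (311, 117), (313, 240), (317, -2), (331, 233), (337, 52), (347, -2), (349, 287), (353, 334),
    (359, 211), (367, 158), (373, -1), (379, 39), (383, 274), (389, 303), (397, -2), (401, 223), (409, 259), (419,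
    41), (421, 221), (431, 181), (433, 412), (439, 139), (443, -1), (449, 331), (457, 160), (461, 43), (463, 406),
    (467, -1), (479, 457), (487, 182), (491, 147), (499, 449), (503, 314), (509, 243), (521, 199), (523, -1), (541,
    345), (547, -2), (557, -2), (563, -1), (569, 465), (571, 547), (577, 68), (587, -2), (593, 284), (599, 49),
    (601, 273), (607, 388), (613, -1), (617, 592), (619, 485), (631, 219), (641, 557), (643, -2), (647, 72), (653,
    -2), (659, 401), (661, 115), (673, 566), (677, -1), (683, -2), (691, 443), (701, 53), (709, 341), (719, 659),
    (727, 54), (733, -1), (739, 237), (743, 204), (751, 421), (757, -1), (761, 183), (769, 677), (773, -2), (787,
    -1), (797, -1), (809, 685), (811, 57), (821, 425), (823, 568), (827, -2), (829, 191), (839, 683), (853, -2),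
    (857, 326), (859, 553), (863, 502), (877, -1), (881, 653), (883, -1), (887, 404), (907, -2), (911, 135), (919,
    633), (929, 61), (937, 162), (941, 455), (947, -2), (953, 922), (967, 88), (971, 347), (977, 424), (983, 900),
    (991, 63), (997, -2), (1009, 765), (1013, -2), (1019, 987), (1021, 915), (1031, 213), (1033, 808), (1039, 573),
    (1049, 651), (1051, 145), (1061, 919), (1063, 244), (1069, 551), (1087, 66), (1091, 423), (1093, -2), (1097,
    814), (1103, 644), (1109, 813), (1117, -1), (1123, -2), (1129, 655), (1151, 1117), (1153, 396), (1163, -2),
    (1171, 227), (1181, 1067), (1187, -1), (1193, 614), (1201, 155), (1213, -2), (1217, 1182), (1223, 70), (1229,
    969), (1231, 539), (1237, -2), (1249, 809), (1259, 71), (1277, -1), (1279, 1199), (1283, -1), (1289, 313),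
    (1291, 1255), (1297, 420), (1301, 535), (1303, 1102), (1307, -1), (1319, 799), (1321, 905), (1327, 510), (1361,
    165), (1367, 74), (1373, -1), (1381, 1219), (1399, 479), (1409, 249), (1423, 802), (1427, -1), (1429, 1093),
    (1433, 1168), (1439, 1401), (1447, 516), (1451, 565), (1453, -1), (1459, 333), (1471, 955), (1481, 77), (1483,
    -1), (1487, 318), (1489, 1361), (1493, -2), (1499, 417), (1511, 691), (1523, -2), (1531, 175), (1543, 1212),
    (1549, 1059), (1553, 378), (1559, 79), (1567, 112), (1571, 1135), (1579, 1365), (1583, 464), (1597, -2), (1601,
    1211), (1607, 300), (1609, 1271), (1613, -1), (1619, 1529), (1621, 351), (1627, -2), (1637, -2), (1657, 686),
    (1663, 1136), (1667, -1), (1669, 271), (1693, -2), (1697, 218), (1699, 459), (1709, 1201), (1721, 83), (1723,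
    -1), (1733, -1), (1741, 641), (1747, -2), (1753, 1358), (1759, 1717), (1777, 578), (1783, 316), (1787, -2),
    (1789, 471), (1801, 853), (1811, 371), (1823, 1710), (1831, 1557), (1847, 86), (1861, 727), (1867, -2), (1871,
    1343), (1873, 1088), (1877, -1), (1879, 845), (1889, 1647), (1901, 195), (1907, -2), (1913, 1234), (1931,
    1887), (1933, -2), (1949, 1577), (1951, 293), (1973, -1), (1979, 89), (1987, -2), (1993, 974), (1997, -2),
    (1999, 1899)]"

lemma low_wits: "list_all (\<lambda>(p, M1, M2, g1, g2, k, r). wit 2997 1000 p M1 M2 g1 g2 k r) low_wits"
  by (simp add: low_wits_def wit_def river_eq same_def)

lemma square_roots:
  "list_all (\<lambda>(p, b). if b < 0 then True else if (b * b - 5) mod (4 * p) = 0 then True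
     else (b * b - 8) mod (4 * p) = 0) prime_cases"
  by (simp add: prime_cases_def)

lemma prime_cases_neg: "list_all (\<lambda>(p, b). b = - 1 \<or> b = - 2 \<or> 0 \<le> b) prime_cases"
  by (simp add: prime_cases_def)

lemma map_fst_low_wits: "map fst low_wits = map fst (filter (\<lambda>(p, b). b = - 1) prime_cases)"
  by (simp add: low_wits_def prime_cases_def)

text \<open>Below \<open>2.997\<close> the spectrum for \<open>p = 1\<close> is finite, which settles every prime whose minimum is smaller.\<close>

lemma isolated_min_small:
  assumes "prime p" "\<exists>y\<in>lagrange_spectrum p. y < real_of_int 2997 / real_of_int 1000"
  shows "isolated_min p"
proof -
  have "fin_below 1 (real_of_int 2997 / real_of_int 1000)"
    using cert_1 by (intro cert_fin_below[OF A1_ok, of Z1 "[]"]) simp_all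
  then have "fin_below p (real_of_int 2997 / real_of_int 1000)"
    by (rule fin_below_from_1) (rule prime_gt_0_nat[OF assms(1)])
  then show ?thesis unfolding isolated_min_def by (rule fin_below_min[OF assms(1) _ assms(2)])
qed

lemma isolated_min_square_root:
  fixes D r b :: int
  assumes "prime p" "(b * b - D) mod (4 * int p) = 0" "r \<ge> 0" "r * r < D" "D < (r + 1) * (r + 1)" "D \<le> 8"
  shows "isolated_min p"
proof (rule isolated_min_small[OF assms(1)])
  have lt: "sqrt (real_of_int D) < real_of_int 2997 / real_of_int 1000"
    using assms(6) by (intro real_less_lsqrt) (auto simp: power2_eq_square)
  have "4 * int p dvd b * b - D" using assms(2) by (simp only: mod_eq_0_iff_dvd)
  then obtain q where q: "b * b - D = 4 * int p * q" by (rule dvdE)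
  show "\<exists>y\<in>lagrange_spectrum p. y < real_of_int 2997 / real_of_int 1000"
    by (rule spectrum_square_root[OF assms(1,3-5) q lt])
qed

lemma high_primes:
  "map (nat \<circ> fst) (filter (\<lambda>(p, b). b = - 2) prime_cases) = [
    3, 67, 163, 227, 277, 283, 293, 317, 347, 397, 547, 557, 587, 643, 653, 683, 773, 827, 853, 907, 947, 997,
    1013, 1093, 1123, 1163, 1213, 1237, 1493, 1523, 1597, 1627, 1637, 1693, 1747, 1787, 1867, 1907, 1933, 1987,
    1997]"
  by (simp add: prime_cases_def)

lemma isolated_min_high:
  "list_all (\<lambda>p. prime p \<longrightarrow> isolated_min p) (map (nat \<circ> fst) (filter (\<lambda>(p, b). b = - 2) prime_cases))"
  unfolding high_primes list.pred_inject
  by (intro conjI impI list.pred_inject(1) isolated_min_3 isolated_min_67 isolated_min_163 isolated_min_227 isolated_min_277 isolated_min_283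
    isolated_min_293 isolated_min_317 isolated_min_347 isolated_min_397 isolated_min_547 isolated_min_557
    isolated_min_587 isolated_min_643 isolated_min_653 isolated_min_683 isolated_min_773 isolated_min_827
    isolated_min_853 isolated_min_907 isolated_min_947 isolated_min_997 isolated_min_1013 isolated_min_1093
    isolated_min_1123 isolated_min_1163 isolated_min_1213 isolated_min_1237 isolated_min_1493
    isolated_min_1523 isolated_min_1597 isolated_min_1627 isolated_min_1637 isolated_min_1693
    isolated_min_1747 isolated_min_1787 isolated_min_1867 isolated_min_1907 isolated_min_1933
    isolated_min_1987 isolated_min_1997)

section \<open>Completeness of the list of primes\<close>

primrec has_factor :: "int list \<Rightarrow> int \<Rightarrow> bool" where
  "has_factor [] n = False"
| "has_factor (q # qs) n = (if n mod q = 0 then 1 < q \<and> q < n else has_factor qs n)"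

lemma has_factor_not_prime: "has_factor qs n \<Longrightarrow> \<not> prime n"
proof (induction qs)
  case (Cons q qs)
  show ?case
  proof (cases "n mod q = 0")
    case True
    then have q: "q dvd n" "1 < q" "q < n" using Cons.prems by auto
    show ?thesis
    proof
      assume "prime n"
      then have "\<forall>m. m \<ge> 0 \<and> m dvd n \<longrightarrow> m = 1 \<or> m = n" unfolding prime_int_iff by (rule conjunct2)
      then have "0 \<le> q \<and> q dvd n \<longrightarrow> q = 1 \<or> q = n" by (rule spec)
      then show False using q by simp
    qed
  next
    case False
    then show ?thesis using Cons by simp
  qed
qed simp

text \<open>Since 2000 < 47^2, every composite number below 2000 has a prime factor of at most
  43.\<close>

primrec gap :: "nat \<Rightarrow> int \<Rightarrow> bool" where
  "gap 0 n = True"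
| "gap (Suc k) n = (if has_factor [2, 3, 5, 7, 11, 13, 17, 19, 23, 29, 31, 37, 41, 43] n then gap k (n + 1) else False)"

lemma gapD: "gap k n \<Longrightarrow> n \<le> m \<Longrightarrow> m < n + int k \<Longrightarrow> \<not> prime m"
proof (induction k arbitrary: n)
  case (Suc k)
  have f: "has_factor [2, 3, 5, 7, 11, 13, 17, 19, 23, 29, 31, 37, 41, 43] n" and g: "gap k (n + 1)"
    using Suc.prems(1) unfolding gap.simps by argo+
  show ?case
  proof (cases "m = n")
    case True
    then show ?thesis using has_factor_not_prime[OF f] by blast
  next
    case False
    then show ?thesis using Suc.prems(2,3) by (intro Suc.IH[OF g]) linarith+
  qed
qed simp

lemma gap_numeral:
  "gap (numeral k) n =
     (if has_factor [2, 3, 5, 7, 11, 13, 17, 19, 23, 29, 31, 37, 41, 43] n then gap (pred_numeral k) (n + 1) else False)"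
  by (simp only: numeral_eq_Suc gap.simps)

text \<open>The list is increasing, so completeness amounts to the compositeness of all numbers
  strictly between neighbouring entries.\<close>

primrec covers :: "int \<Rightarrow> (int \<times> int) list \<Rightarrow> int \<Rightarrow> bool" where
  "covers n [] m = gap (nat (m - n)) n"
| "covers n (e # es) m = (if n \<le> fst e then if gap (nat (fst e - n)) n then covers (fst e + 1) es m else False else False)"

lemma coversD: "covers n es m \<Longrightarrow> n \<le> q \<Longrightarrow> q < m \<Longrightarrow> prime q \<Longrightarrow> q \<in> fst ` set es"
proof (induction es arbitrary: n)
  case Nil
  have "q < n + int (nat (m - n))" using Nil.prems(2,3) by linarith
  then show ?case using gapD[of "nat (m - n)" n q] Nil.prems(1,2,4) unfolding covers.simps by blast
next
  case (Cons e es)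
  have g: "gap (nat (fst e - n)) n" "covers (fst e + 1) es m" using Cons.prems(1) unfolding covers.simps by argo+
  have "\<not> q < fst e"
  proof
    assume "q < fst e"
    then have "q < n + int (nat (fst e - n))" using Cons.prems(2) by linarith
    then show False using gapD[OF g(1) Cons.prems(2)] Cons.prems(4) by blast
  qed
  then consider "q = fst e" | "fst e + 1 \<le> q" by linarith
  then show ?case
  proof cases
    case 1
    then show ?thesis by simp
  next
    case 2
    then show ?thesis using Cons.IH[OF g(2) 2 Cons.prems(3,4)] by simp
  qed
qed

lemma primes_below_2000: "covers 2 prime_cases 2000"
  by (simp add: prime_cases_def gap_numeral)

theorem theorem1p2:
  fixes p :: nat
  assumes "prime p" and "p < 2000"
  shows "\<exists>m. m \<in> lagrange_spectrum p \<and> (\<forall>x\<in>lagrange_spectrum p. m \<le> x)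
           \<and> m isolated_in lagrange_spectrum p
           \<and> m \<notin> \<rat> \<and> (\<exists>q\<in>\<rat>. m = sqrt q)"
proof -
  have "int p \<in> fst ` set prime_cases"
    using assms prime_ge_2_nat[OF assms(1)] by (intro coversD[OF primes_below_2000]) auto
  then obtain b where b: "(int p, b) \<in> set prime_cases" by auto
  then have "(if b < 0 then True else if (b * b - 5) mod (4 * int p) = 0 then True else (b * b - 8) mod (4 * int p) = 0)"
    using square_roots unfolding list_all_iff by fast
  then consider "b < 0" | "(b * b - 5) mod (4 * int p) = 0" | "(b * b - 8) mod (4 * int p) = 0" by argo
  then have "isolated_min p"
  proof cases
    case 1
    then have "b = - 1 \<or> b = - 2" using b prime_cases_neg unfolding list_all_iff by fastforce
    then show ?thesis
    proof
      assume "b = - 1"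
      then have "int p \<in> set (map fst low_wits)" using b unfolding map_fst_low_wits by force
      then obtain a1 b1 c1 d1 a2 b2 c2 d2 a b c m a' b' c' m' k r where
        "(int p, (a1, b1, c1, d1), (a2, b2, c2, d2), (a, b, c, m), (a', b', c', m'), k, r) \<in> set low_wits"
        by auto
      then have "wit 2997 1000 (int p) (a1, b1, c1, d1) (a2, b2, c2, d2) (a, b, c, m) (a', b', c', m') k r"
        using low_wits unfolding list_all_iff by blast
      then have "\<exists>y\<in>lagrange_spectrum p. y < real_of_int 2997 / real_of_int 1000"
        by (rule spectrum_wit[OF assms(1)])
      then show ?thesis by (rule isolated_min_small[OF assms(1)])
    next
      assume "b = - 2"
      then have "p \<in> set (map (nat \<circ> fst) (filter (\<lambda>(p, b). b = - 2) prime_cases))" using b by force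
      then show ?thesis using isolated_min_high assms(1) unfolding list_all_iff by blast
    qed
  next
    case 2
    \<comment> \<open>Both 5 and 8 lie strictly between 2^2 and 3^2, hence \<open>r = 2\<close> here
      and in the next case.\<close>
    then show ?thesis by (rule isolated_min_square_root[OF assms(1), where r = 2]) simp_all
  next
    case 3
    then show ?thesis by (rule isolated_min_square_root[OF assms(1), where r = 2]) simp_all
  qed
  then show ?thesis unfolding isolated_min_def .
qed

end
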